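(* Let $e_1>e_2>e_3$ be real numbers. The root-counting measures for each of the eight normalized spectral polynomials $R_n^{\kappa_1,\kappa_2,\kappa_3}(n(n+1)t)$, $(\kappa_1,\kappa_2,\kappa_3)\in\{0,\frac12\}^3$ (regarded as polynomials in $t$, with $n$ of the parity for which $R_n^{\kappa_1,\kappa_2,\kappa_3}$ is defined), as well as that of the normalized spectral polynomial $R_n(n(n+1)t)$, converge to the measure $\mu_Q$ as $n\to\infty$.
   Context: Consider the Lamé equation $$S''(z)+\frac12\sum_{i=1}^3\frac1{z-e_i}S'(z)-\frac{n(n+1)z+E}{4\prod_{i=1}^3(z-e_i)}S(z)=0,$$ with $n$ a nonnegative integer and $E$ a constant (the energy). A Lamé solution of the first kind is a solution of the form $S(z)=(z-e_1)^{\kappa_1}(z-e_2)^{\kappa_2}(z-e_3)^{\kappa_3}\tilde S(z)$ with each $\kappa_i$ either $0$ or $\frac12$ and $\tilde S$ a polynomial. If $n$ is even, such solutions occur only with zero or two of the $\kappa_i$ equal to $\frac12$; if $n$ is odd, only with one or three of the $\kappa_i$ equal to $\frac12$. In both cases the total number of Lamé solutions, over all appropriate $E$, is $2n+1$. The spectral polynomial $R_n(E)$ is the monic polynomial of degree $2n+1$ whose roots are exactly the values of $E$ at which the equation has a Lamé solution. For $(\kappa_1,\kappa_2,\kappa_3)$ allowed by the parity of $n$, $R_n^{\kappa_1,\kappa_2,\kappa_3}(E)$ is the monic polynomial whose roots are precisely the values of $E$ for which the equation has a Lamé solution with exponents $\kappa_1,\kappa_2,\kappa_3$ (for example, for $n$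 even $R_n^{0,0,0}$ has degree $\frac{n+2}2$ and its roots are the values of $E$ for which there is a pure polynomial solution). These satisfy $$R_n=R_n^{0,0,0}R_n^{\frac12,\frac12,0}R_n^{\frac12,0,\frac12}R_n^{0,\frac12,\frac12}\ \ (n\text{ even}),\qquad R_n=R_n^{\frac12,0,0}R_n^{0,\frac12,0}R_n^{0,0,\frac12}R_n^{\frac12,\frac12,\frac12}\ \ (n\text{ odd}).$$ The root-counting measure of a polynomial of degree $d\ge1$ with roots $t_1,\dots,t_d$ is $\frac1d\sum_{j=1}^d\delta_{t_j}$, where $\delta_a$ is the Dirac measure at $a$. $\mu_Q$ is the probability measure supported on $[e_3,e_1]$ with density $$\rho_Q(s)=\frac1{2\pi}\int_{e_2}^{e_1}\frac{dx}{\sqrt{(e_1-x)(x-e_2)(x-e_3)(x-s)}}\quad\text{when } e_3<s<e_2,$$ $$\rho_Q(s)=\frac1{2\pi}\int_{e_3}^{e_2}\frac{dx}{\sqrt{(e_1-x)(e_2-x)(x-e_3)(s-x)}}\quad\text{when } e_2<s<e_1.$$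
   Formalization: The normalized polynomials are taken as R(-n(n+1)t) instead of R(n(n+1)t): with the displayed equation (coefficient n(n+1)z+E) the printed sign gives convergence to the reflection of mu_Q, so the printed claim fails, e.g. for (e_1,e_2,e_3)=(3,2,1). *)

theory Defs
  imports "HOL-Probability.Probability" "HOL-Computational_Algebra.Polynomial"
begin

text \<open>
  The parameters are \<open>e i\<close> and \<open>\<kappa> i\<close> for \<open>i \<in> {1..3}\<close>; values at other indices are never used.
\<close>

definition lame_operator :: "(nat \<Rightarrow> real) \<Rightarrow> nat \<Rightarrow> complex \<Rightarrow> (complex \<Rightarrow> complex) \<Rightarrow> complex \<Rightarrow> complex"
  where "lame_operator e n E S z =
    deriv (deriv S) z
    + 1/2 * (\<Sum>i\<in>{1..3}. 1 / (z - complex_of_real (e i))) * deriv S z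
    - (of_nat (n * (n + 1)) * z + E) / (4 * (\<Prod>i\<in>{1..3}. (z - complex_of_real (e i)))) * S z"

text \<open>
  The powers are principal branches, so everything lives on the complex plane slit along the real
  axis to the left of the largest \<open>e i\<close>. This is no restriction: any other branch of a solution
  arises from this one by analytic continuation and a constant factor.
\<close>

definition slit_domain :: "(nat \<Rightarrow> real) \<Rightarrow> complex set"
  where "slit_domain e = {z. \<forall>i\<in>{1..3}. z - complex_of_real (e i) \<notin> \<real>\<^sub>\<le>\<^sub>0}"

definition lame_form :: "(nat \<Rightarrow> real) \<Rightarrow> (nat \<Rightarrow> real) \<Rightarrow> complex poly \<Rightarrow> complex \<Rightarrow> complex"
  where "lame_form e \<kappa> p z =
    (\<Prod>i\<in>{1..3}. (z - complex_of_real (e i)) powr complex_of_real (\<kappa> i)) * poly p z"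

definition has_lame_solution :: "(nat \<Rightarrow> real) \<Rightarrow> nat \<Rightarrow> (nat \<Rightarrow> real) \<Rightarrow> complex \<Rightarrow> bool"
  where "has_lame_solution e n \<kappa> E \<longleftrightarrow>
    (\<exists>p. p \<noteq> 0 \<and> lame_form e \<kappa> p holomorphic_on slit_domain e \<and>
      (\<forall>z\<in>slit_domain e. lame_operator e n E (lame_form e \<kappa> p) z = 0))"

abbreviation lame_exponents :: "(nat \<Rightarrow> real) set"
  where "lame_exponents \<equiv> {1..3} \<rightarrow>\<^sub>E {0, 1/2}"

definition admissible_exponents :: "nat \<Rightarrow> (nat \<Rightarrow> real) \<Rightarrow> bool"
  where "admissible_exponents n \<kappa> \<longleftrightarrow>
    (if even n then card {i\<in>{1..3}. \<kappa> i = 1/2} \<in> {0, 2}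
     else card {i\<in>{1..3}. \<kappa> i = 1/2} \<in> {1, 3})"

text \<open>
  The spectral polynomial for a fixed exponent vector has simple roots: one root for each energy.
\<close>

definition spectral_poly_exp :: "(nat \<Rightarrow> real) \<Rightarrow> nat \<Rightarrow> (nat \<Rightarrow> real) \<Rightarrow> complex poly"
  where "spectral_poly_exp e n \<kappa> =
    (THE R. lead_coeff R = 1 \<and> rsquarefree R \<and>
      {E. poly R E = 0} = {E. has_lame_solution e n \<kappa> E})"

text \<open>
  The equation has \<open>2 * n + 1\<close> distinct energies in total, so the prescribed degree makes the
  following description unique.
\<close>

definition spectral_poly :: "(nat \<Rightarrow> real) \<Rightarrow> nat \<Rightarrow> complex poly"
  where "spectral_poly e n =
    (THE R. lead_coeff R = 1 \<and> degree R = 2 * n + 1 \<and>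
      {E. poly R E = 0} = {E. \<exists>\<kappa>\<in>lame_exponents. has_lame_solution e n \<kappa> E})"

text \<open>
  Uniform distribution on the multiset of roots, as a Borel measure on the complex plane;
  meaningful only for polynomials of degree at least 1.
\<close>

definition root_counting_measure :: "complex poly \<Rightarrow> complex measure"
  where "root_counting_measure p = distr (measure_pmf (pmf_of_multiset (proots p))) borel (\<lambda>t. t)"

text \<open>
  The point of the normalization is the zero \<open>t\<close> of \<open>n (n + 1) z + E\<close>, i.e. \<open>E = - n (n + 1) t\<close>;
  these zeros lie in \<open>[e 3, e 1]\<close>. With the positive energy scale \<open>E = n (n + 1) t\<close> the roots would
  lie in \<open>[- e 1, - e 3]\<close> instead and the limit would be the reflection of \<open>mu_Q\<close>.
\<close>

definition normalize_energy :: "nat \<Rightarrow> complex poly \<Rightarrow> complex poly"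
  where "normalize_energy n R = R \<circ>\<^sub>p [:0, - of_nat (n * (n + 1)):]"

definition rho_Q :: "(nat \<Rightarrow> real) \<Rightarrow> real \<Rightarrow> real"
  where "rho_Q e s =
    (if e 3 < s \<and> s < e 2 then
       1 / (2 * pi) * (LINT x:{e 2..e 1}|lborel. 1 / sqrt ((e 1 - x) * (x - e 2) * (x - e 3) * (x - s)))
     else if e 2 < s \<and> s < e 1 then
       1 / (2 * pi) * (LINT x:{e 3..e 2}|lborel. 1 / sqrt ((e 1 - x) * (e 2 - x) * (x - e 3) * (s - x)))
     else 0)"

definition mu_Q :: "(nat \<Rightarrow> real) \<Rightarrow> complex measure"
  where "mu_Q e = distr (density lborel (\<lambda>s. ennreal (rho_Q e s))) borel complex_of_real"

text \<open>
  Weak convergence along a filter, since each exponent vector only occurs for one parity of \<open>n\<close>.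
\<close>

definition converges_weakly :: "('i \<Rightarrow> 'a::topological_space measure) \<Rightarrow> 'a measure \<Rightarrow> 'i filter \<Rightarrow> bool"
  where "converges_weakly M N F \<longleftrightarrow>
    (\<forall>f :: 'a \<Rightarrow> real. continuous_on UNIV f \<longrightarrow> bounded (range f) \<longrightarrow>
      ((\<lambda>n. \<integral>x. f x \<partial>M n) \<longlongrightarrow> (\<integral>x. f x \<partial>N)) F)"

end

theory Submission
  imports Defs "HOL-Computational_Algebra.Fundamental_Theorem_Algebra"
    "HOL-Computational_Algebra.Polynomial_FPS" "HOL-Complex_Analysis.Cauchy_Integral_Formula"
    "Jordan_Normal_Form.Determinant"
begin

text \<open>
  In powers of \<open>z - e 2\<close> the Lame operator on the polynomial factors is tridiagonal, and because
  \<open>e 2\<close> is the middle singularity the products of its off-diagonal entries are positive. Hence its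
  eigenvalues are the real simple zeros of an orthogonal polynomial. After division by \<open>n (n + 1)\<close> the
  entries at position \<open>k = x N\<close> converge to polynomials in \<open>x\<close>; the traces of the powers then give
  the limiting moments as integrals over \<open>x \<in> [0, 1]\<close>, independently of the exponents.

  These are the moments of \<open>e 1 * u1\<^sup>2 + e 2 * u2\<^sup>2 + e 3 * u3\<^sup>2\<close> for a uniform point \<open>u\<close> of the sphere:
  both moment sequences are read off the generating function \<open>((1 - a x) (1 + b x)) powr (- 1/2)\<close>,
  where \<open>a = e 1 - e 2\<close> and \<open>b = e 2 - e 3\<close>. Slicing the sphere perpendicularly to the third axis
  yields the density \<open>rho_Q\<close> below \<open>e 2\<close>, slicing it perpendicularly to the first axis yields it
  above \<open>e 2\<close>.

  For a common energy, the Wronskian of two Lame solutions with different exponents of the same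
  parity would have to vanish, which the parity of the orders at the \<open>e i\<close> forbids. So the spectra for
  different exponents are disjoint and \<open>spectral_poly\<close> is the product of its four factors.
\<close>

section \<open>Jacobi polynomials with real simple zeros\<close>

text \<open>Moments are accessible because an entry of the \<open>j\<close>-th matrix power depends
  only on entries within \<open>j\<close> places of it, where the rescaled coefficients are nearly
  constant. A diagonal entry near \<open>x N\<close> therefore tends to the middle coefficient of a
  trinomial power, and the normalized trace becomes a Riemann sum. Since all roots stay in one
  compact interval, convergence of moments is enough for weak convergence. The obstacle is on the
  side of \<open>rho_Q\<close>: it consists of elliptic integrals with a singularity at
  \<open>e 2\<close>, whose moments are not directly accessible. The uniform law on the sphere
  replaces them by Beta and Wallis integrals, and the elliptic integrals appear only as inner
  integrals after Tonelli. Each slicing does give a density on the whole line, but on the wrong side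
  of \<open>e 2\<close> its inner integral is cut off at \<open>s\<close> and does not have the form
  of \<open>rho_Q\<close>; hence both slicings are used. Their laws are equal by comparison of
  moments, and finiteness of the inner integrals almost everywhere comes from the total mass
  1.\<close>

fun jacobi_poly :: "(int \<Rightarrow> real) \<Rightarrow> (int \<Rightarrow> real) \<Rightarrow> nat \<Rightarrow> complex poly" where
  "jacobi_poly d b 0 = 1"
| "jacobi_poly d b (Suc 0) = [:- of_real (d 0), 1:]"
| "jacobi_poly d b (Suc (Suc k)) = [:- of_real (d (int k + 1)), 1:] * jacobi_poly d b (Suc k)
     - Polynomial.smult (of_real (b (int k + 1))) (jacobi_poly d b k)"

lemma degree_lead_jacobi_poly: "degree (jacobi_poly d b k) = k \<and> lead_coeff (jacobi_poly d b k) = 1"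
proof (induction d b k rule: jacobi_poly.induct)
  case (3 d b k)
  have lc: "coeff (jacobi_poly d b (Suc k)) (Suc k) = 1" using 3 by metis
  have z: "coeff (jacobi_poly d b (Suc k)) (Suc (Suc k)) = 0" "coeff (jacobi_poly d b k) (Suc (Suc k)) = 0"
    using 3 by (auto intro!: coeff_eq_0)
  have d1: "degree ([:- of_real (d (int k + 1)), 1:] * jacobi_poly d b (Suc k)) = Suc (Suc k)"
    using 3 by (subst degree_mult_eq) (auto)
  have d2: "degree (Polynomial.smult (of_real (b (int k + 1))) (jacobi_poly d b k)) < Suc (Suc k)"
    using 3 by (intro order_le_less_trans[OF degree_smult_le]) auto
  have "degree (jacobi_poly d b (Suc (Suc k))) = Suc (Suc k)"
    using d1 d2 degree_add_eq_left[of "- Polynomial.smult (of_real (b (int k + 1))) (jacobi_poly d b k)"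
      "[:- of_real (d (int k + 1)), 1:] * jacobi_poly d b (Suc k)"]
    by (simp del: mult_pCons_left)
  moreover have "coeff (jacobi_poly d b (Suc (Suc k))) (Suc (Suc k)) = 1"
    using lc z by simp
  ultimately show ?case by simp
qed auto

lemma jacobi_poly_nz [simp]: "jacobi_poly d b k \<noteq> 0"
  using degree_lead_jacobi_poly[of d b k] by auto

lemma jacobi_poly_cnj: "poly (jacobi_poly d b k) (cnj x) = cnj (poly (jacobi_poly d b k) x)"
  by (induction d b k rule: jacobi_poly.induct) auto

lemma jacobi_poly_real: "poly (jacobi_poly d b k) (of_real r) \<in> \<real>"
  by (metis Reals_cnj_iff complex_cnj_complex_of_real jacobi_poly_cnj)

text \<open>In matrix terms only the products \<open>b\<close> of opposite off-diagonal entries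
  matter, so their positivity plays the role of symmetry. The zeros of \<open>b\<close> at 0 and
  \<open>N + 1\<close> cut rows 0 to \<open>N\<close> off from the rest of the integer line.\<close>

locale jacobi =
  fixes d b :: "int \<Rightarrow> real" and N :: nat
  assumes b_pos: "\<And>k. 0 < k \<Longrightarrow> k \<le> int N \<Longrightarrow> b k > 0"
    and b_0: "b 0 = 0" and b_end: "b (int N + 1) = 0"
begin

abbreviation "P k \<equiv> poly (jacobi_poly d b k)"

text \<open>The squared norms of the monic orthogonal polynomials in Favard's theorem.\<close>

definition "norm_sq k = (\<Prod>i\<in>{1..k}. b (int i))"

lemma norm_sq_pos: "k \<le> N \<Longrightarrow> norm_sq k > 0"
  unfolding norm_sq_def by (intro prod_pos) (auto intro!: b_pos)

lemma norm_sq_0 [simp]: "norm_sq 0 = 1" by (simp add: norm_sq_def)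
lemma norm_sq_Suc: "norm_sq (Suc k) = norm_sq k * b (int k + 1)" by (simp add: norm_sq_def add.commute)

text \<open>
  The ratios \<open>r k = P (k + 1) x / P k x\<close> satisfy \<open>r (k + 1) = x - d (k + 1) - b (k + 1) / r k\<close>, and for
  \<open>Im x > 0\<close> this map preserves the upper half plane.
\<close>

lemma jacobi_poly_Im_pos:
  assumes "Im x > 0" "k \<le> N"
  shows "P k x \<noteq> 0 \<and> Im (P (Suc k) x / P k x) > 0"
  using assms(2)
proof (induction k)
  case 0
  then show ?case using assms by simp
next
  case (Suc k)
  then have IH: "P k x \<noteq> 0" "Im (P (Suc k) x / P k x) > 0" by auto
  define r where "r = P (Suc k) x / P k x"
  have r: "Im r > 0" using IH by (simp add: r_def)
  then have "r \<noteq> 0" by auto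
  then have nz: "P (Suc k) x \<noteq> 0" by (auto simp: r_def)
  have b: "b (int k + 1) > 0" using Suc.prems by (intro b_pos) auto
  have eq: "P (Suc (Suc k)) x / P (Suc k) x = (x - of_real (d (int k + 1))) - of_real (b (int k + 1)) / r"
    using nz IH(1) by (simp add: r_def field_simps)
  have "Im (of_real (b (int k + 1)) / r) < 0"
    using b r by (simp add: Im_divide divide_less_0_iff sum_power2_gt_zero_iff)
  then show ?case using nz eq assms(1) by simp
qed

lemma jacobi_poly_root_real:
  assumes "P (Suc N) x = 0"
  shows "x \<in> \<real>"
proof -
  have "P (Suc N) y \<noteq> 0" if "Im y > 0" for y
    using jacobi_poly_Im_pos[OF that order_refl] by auto
  then have "\<not> Im x > 0" "\<not> Im (cnj x) > 0" using assms jacobi_poly_cnj[of d b "Suc N" x] by auto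
  then show ?thesis by (simp add: complex_is_Real_iff)
qed

lemma jacobi_poly_Suc_Suc: "P (Suc (Suc k)) x = (x - of_real (d (int k + 1))) * P (Suc k) x - of_real (b (int k + 1)) * P k x"
  by simp (simp add: algebra_simps)

text \<open>When the recurrence is inserted at level \<open>m + 1\<close>, the linear factors leave
  \<open>x - y\<close> and the \<open>b\<close> terms reproduce level \<open>m\<close>, because
  \<open>norm_sq\<close> gains exactly the factor \<open>b (m + 1)\<close>.\<close>

lemma christoffel_darboux:
  assumes "m \<le> N"
  shows "(x - y) * (\<Sum>k\<le>m. P k x * P k y / of_real (norm_sq k)) =
    (P (Suc m) x * P m y - P m x * P (Suc m) y) / of_real (norm_sq m)"
  using assms
proof (induction m)
  case 0
  then show ?case by simp
next
  case (Suc m)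
  have h: "norm_sq m > 0" "b (int m + 1) > 0" using Suc.prems by (auto intro!: norm_sq_pos b_pos)
  have IH: "(x - y) * (\<Sum>k\<le>m. P k x * P k y / of_real (norm_sq k)) =
    (P (Suc m) x * P m y - P m x * P (Suc m) y) / of_real (norm_sq m)" using Suc by simp
  have "(x - y) * (\<Sum>k\<le>Suc m. P k x * P k y / of_real (norm_sq k)) = 
     (P (Suc m) x * P m y - P m x * P (Suc m) y) / of_real (norm_sq m)
      + (x - y) * P (Suc m) x * P (Suc m) y / of_real (norm_sq (Suc m))"
    by (simp add: distrib_left IH mult.assoc del: jacobi_poly.simps)
  also have "\<dots> = (P (Suc (Suc m)) x * P (Suc m) y - P (Suc m) x * P (Suc (Suc m)) y) / of_real (norm_sq (Suc m))"
    unfolding jacobi_poly_Suc_Suc norm_sq_Suc using h by (simp add: field_simps del: jacobi_poly.simps)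
  finally show ?case .
qed

lemma pderiv_jacobi_poly_Suc_Suc: "poly (pderiv (jacobi_poly d b (Suc (Suc k)))) x =
   P (Suc k) x + (x - of_real (d (int k + 1))) * poly (pderiv (jacobi_poly d b (Suc k))) x
     - of_real (b (int k + 1)) * poly (pderiv (jacobi_poly d b k)) x"
  by (simp add: pderiv_diff pderiv_add pderiv_smult pderiv_mult pderiv_pCons algebra_simps)

text \<open>The confluent case \<open>y = x\<close>, obtained by differentiating the recurrence
  instead of passing to a limit.\<close>

lemma christoffel_darboux_diag:
  assumes "m \<le> N"
  shows "(\<Sum>k\<le>m. P k x * P k x / of_real (norm_sq k)) =
    (poly (pderiv (jacobi_poly d b (Suc m))) x * P m x - poly (pderiv (jacobi_poly d b m)) x * P (Suc m) x) / of_real (norm_sq m)"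
  using assms
proof (induction m)
  case 0
  then show ?case by (simp add: pderiv_pCons)
next
  case (Suc m)
  have h: "norm_sq m > 0" "b (int m + 1) > 0" using Suc.prems by (auto intro!: norm_sq_pos b_pos)
  have "(\<Sum>k\<le>Suc m. P k x * P k x / of_real (norm_sq k)) =
    (poly (pderiv (jacobi_poly d b (Suc m))) x * P m x - poly (pderiv (jacobi_poly d b m)) x * P (Suc m) x) / of_real (norm_sq m)
     + P (Suc m) x * P (Suc m) x / of_real (norm_sq (Suc m))"
    using Suc by (simp del: jacobi_poly.simps)
  also have "\<dots> = (poly (pderiv (jacobi_poly d b (Suc (Suc m)))) x * P (Suc m) x - poly (pderiv (jacobi_poly d b (Suc m))) x * P (Suc (Suc m)) x) / of_real (norm_sq (Suc m))"
    unfolding jacobi_poly_Suc_Suc pderiv_jacobi_poly_Suc_Suc norm_sq_Suc using h by (simp add: field_simps del: jacobi_poly.simps)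
  finally show ?case .
qed

text \<open>At a point of \<open>Z\<close> this is the reciprocal of the Gauss quadrature
  weight.\<close>

definition "christoffel x = (\<Sum>k\<le>N. P k x * P k x / of_real (norm_sq k))"

lemma christoffel_nz:
  assumes "x \<in> \<real>"
  shows "christoffel x \<noteq> 0"
proof -
  obtain r where x: "x = of_real r" using assms by (auto elim: Reals_cases)
  define q where "q k = Re (P k x)" for k
  have q: "P k x = of_real (q k)" for k
    using jacobi_poly_real[of d b k r] by (simp add: q_def x of_real_Re)
  have "christoffel x = of_real (\<Sum>k\<le>N. (q k)\<^sup>2 / norm_sq k)"
    unfolding christoffel_def q by (simp add: power2_eq_square)
  moreover have "(\<Sum>k\<le>N. (q k)\<^sup>2 / norm_sq k) > 0"
  proof (rule sum_pos2[of _ 0])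
    have "q 0 = 1" by (simp add: q_def)
    then show "0 < (q 0)\<^sup>2 / norm_sq 0" by simp
    fix i assume "i \<in> {..N}"
    then show "0 \<le> (q i)\<^sup>2 / norm_sq i" using norm_sq_pos[of i] by simp
  qed auto
  ultimately show ?thesis by (metis less_irrefl of_real_eq_0_iff)
qed

text \<open>At a double zero the confluent formula with \<open>m = N\<close> would vanish, whereas
  at a real point \<open>christoffel\<close> is a positive sum of squares that starts with
  \<open>P 0 = 1\<close>.\<close>

lemma rsquarefree_jacobi_poly: "rsquarefree (jacobi_poly d b (Suc N))"
  unfolding rsquarefree_roots
proof (intro allI notI)
  fix x assume *: "P (Suc N) x = 0 \<and> poly (pderiv (jacobi_poly d b (Suc N))) x = 0"
  then have "christoffel x = 0" unfolding christoffel_def using christoffel_darboux_diag[OF order_refl, of x]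
    by (simp del: jacobi_poly.simps)
  then show False using christoffel_nz jacobi_poly_root_real * by blast
qed

definition "Z = {x. P (Suc N) x = 0}"

lemma finite_Z: "finite Z" unfolding Z_def by (rule poly_roots_finite) simp

lemma card_Z: "card Z = Suc N"
proof -
  have "proots (jacobi_poly d b (Suc N)) = mset_set Z"
  proof (rule multiset_eqI)
    fix x
    have "order x (jacobi_poly d b (Suc N)) = (if x \<in> Z then 1 else 0)"
      using rsquarefree_jacobi_poly rsquarefree_root_order[OF rsquarefree_jacobi_poly] by (auto simp: Z_def order_root simp del: jacobi_poly.simps)
    then show "count (proots (jacobi_poly d b (Suc N))) x = count (mset_set Z) x"
      using finite_Z by (simp del: jacobi_poly.simps)
  qed
  then have "size (mset_set Z) = degree (jacobi_poly d b (Suc N))" by (metis size_proots_complex)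
  then show ?thesis using degree_lead_jacobi_poly[of d b "Suc N"] by (simp del: jacobi_poly.simps)
qed

lemma Z_real: "x \<in> Z \<Longrightarrow> x \<in> \<real>" using jacobi_poly_root_real by (simp add: Z_def)

text \<open>
  The Christoffel-Darboux formula says that the square matrix of the values \<open>P k x\<close>, \<open>x \<in> Z\<close>, has a
  right inverse; this is the statement that it is also a left inverse.
\<close>

lemma dual_orthogonality:
  assumes "k \<le> N" "l \<le> N"
  shows "(\<Sum>x\<in>Z. P k x * P l x / (of_real (norm_sq k) * christoffel x)) = (if k = l then 1 else 0)"
proof -
  obtain lam where lam: "bij_betw lam {0..<Suc N} Z"
    using ex_bij_betw_nat_finite[OF finite_Z] card_Z by metis
  define A where "A = Matrix.mat (Suc N) (Suc N) (\<lambda>(i,k). P k (lam i))"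
  define B where "B = Matrix.mat (Suc N) (Suc N) (\<lambda>(k,i). P k (lam i) / (of_real (norm_sq k) * christoffel (lam i)))"
  have A: "A \<in> carrier_mat (Suc N) (Suc N)" and B: "B \<in> carrier_mat (Suc N) (Suc N)"
    by (auto simp: A_def B_def)
  have lamZ: "lam i \<in> Z" if "i < Suc N" for i using lam that by (auto simp: bij_betw_def)
  have AB: "A * B = 1\<^sub>m (Suc N)"
  proof (rule eq_matI)
    fix i j assume ij: "i < dim_row (1\<^sub>m (Suc N))" "j < dim_col (1\<^sub>m (Suc N))"
    then have ij: "i < Suc N" "j < Suc N" by auto
    have "(A * B) $$ (i,j) = (\<Sum>k\<in>{0..<Suc N}. P k (lam i) * (P k (lam j) / (of_real (norm_sq k) * christoffel (lam j))))"
      using ij by (simp add: A_def B_def scalar_prod_def del: sum.op_ivl_Suc jacobi_poly.simps)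
    also have "\<dots> = (\<Sum>k\<le>N. P k (lam i) * P k (lam j) / of_real (norm_sq k)) / christoffel (lam j)"
      by (simp add: sum_divide_distrib atLeast0LessThan lessThan_Suc_atMost mult.commute mult.left_commute del: jacobi_poly.simps)
    also have "\<dots> = (if i = j then 1 else 0)"
    proof (cases "i = j")
      case True
      then show ?thesis using christoffel_nz[OF Z_real[OF lamZ[OF ij(2)]]] by (simp add: christoffel_def)
    next
      case False
      then have "lam i \<noteq> lam j" using lam ij by (auto simp: bij_betw_def inj_on_def)
      moreover have "P (Suc N) (lam i) = 0" "P (Suc N) (lam j) = 0" using lamZ ij by (auto simp: Z_def)
      then have "(lam i - lam j) * (\<Sum>k\<le>N. P k (lam i) * P k (lam j) / of_real (norm_sq k)) = 0"
        by (subst christoffel_darboux) (auto simp del: jacobi_poly.simps)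
      ultimately show ?thesis using False by simp
    qed
    finally show "(A * B) $$ (i,j) = 1\<^sub>m (Suc N) $$ (i,j)" using ij by simp
  qed (auto simp: A_def B_def)
  have BA: "B * A = 1\<^sub>m (Suc N)" by (rule mat_mult_left_right_inverse[OF A B AB])
  have "(B * A) $$ (k,l) = (\<Sum>i\<in>{0..<Suc N}. P k (lam i) / (of_real (norm_sq k) * christoffel (lam i)) * P l (lam i))"
    using assms by (simp add: A_def B_def scalar_prod_def del: sum.op_ivl_Suc jacobi_poly.simps)
  also have "\<dots> = (\<Sum>x\<in>Z. P k x / (of_real (norm_sq k) * christoffel x) * P l x)"
    using lam by (rule sum.reindex_bij_betw)
  finally show ?thesis using BA assms by (simp add: mult.commute mult.left_commute)
qed

end

section \<open>Power sums of the zeros\<close>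

text \<open>
  \<open>path_weight d b j k m\<close> is the total weight of the lattice paths of length \<open>j\<close> from \<open>k\<close> to \<open>k + m - j\<close>,
  that is, an entry of the \<open>j\<close>-th power of the Jacobi matrix. Up steps weigh \<open>1\<close>, level steps \<open>d\<close> and
  down steps \<open>b\<close> of the position they leave. Positions range over all integers: since \<open>b\<close> vanishes at
  both ends, the truncation of the matrix needs no separate treatment.
\<close>

fun path_weight :: "(int \<Rightarrow> real) \<Rightarrow> (int \<Rightarrow> real) \<Rightarrow> nat \<Rightarrow> int \<Rightarrow> nat \<Rightarrow> real" where
  "path_weight d b 0 k m = (if m = 0 then 1 else 0)"
| "path_weight d b (Suc j) k m = (if m \<ge> 2 then path_weight d b j k (m - 2) else 0)
     + (if m \<ge> 1 then d (k + int m - 1 - int j) * path_weight d b j k (m - 1) else 0)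
     + b (k + int m - int j) * path_weight d b j k m"

context jacobi
begin

abbreviation "H \<equiv> path_weight d b"

text \<open>Extension by zero, to be paired with the integer positions of
  \<open>path_weight\<close>; at index 0 the recurrence stays valid because
  \<open>b 0 = 0\<close>.\<close>

definition "Pz l x = (if l < 0 then 0 else P (nat l) x)"

lemma path_weight_beyond: "m > 2 * j \<Longrightarrow> H j k m = 0"
  by (induction j arbitrary: m) auto

text \<open>A path can become negative only by a down step from 0, and that step has weight
  \<open>b 0 = 0\<close>.\<close>

lemma path_weight_neg: "k \<ge> 0 \<Longrightarrow> k + int m - int j < 0 \<Longrightarrow> H j k m = 0"
proof (induction j arbitrary: m)
  case 0
  then show ?case by simp
next
  case (Suc j)
  have 1: "(if m \<ge> 2 then H j k (m - 2) else 0) = 0" using Suc by auto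
  have 2: "(if m \<ge> 1 then d (k + int m - 1 - int j) * H j k (m - 1) else 0) = 0" using Suc by auto
  have 3: "b (k + int m - int j) * H j k m = 0"
  proof (cases "k + int m - int j = 0")
    case True
    then show ?thesis by (simp add: b_0)
  next
    case False
    then show ?thesis using Suc by auto
  qed
  show ?case using 1 2 3 by simp
qed

lemma Pz_rec:
  assumes "l \<ge> 0"
  shows "x * Pz l x = Pz (l + 1) x + of_real (d l) * Pz l x + of_real (b l) * Pz (l - 1) x"
proof -
  obtain k where l: "l = int k" using assms nonneg_int_cases by blast
  show ?thesis
  proof (cases k)
    case 0
    then show ?thesis by (simp add: Pz_def l b_0)
  next
    case (Suc i)
    have e: "nat (1 + int i) = Suc i" "nat (2 + int i) = Suc (Suc i)" by auto
    show ?thesis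
      by (simp add: Pz_def l Suc e) (simp add: algebra_simps)
  qed
qed

text \<open>\<open>b (N + 1) = 0\<close> makes \<open>P (N + 2) x\<close> a multiple of
  \<open>P (N + 1) x = 0\<close>, and two consecutive zeros propagate through the
  recurrence.\<close>

lemma Pz_beyond:
  assumes "x \<in> Z" "l > int N"
  shows "Pz l x = 0"
proof -
  have "P (Suc N + i) x = 0 \<and> P (Suc (Suc N + i)) x = 0" for i
  proof (induction i)
    case 0
    have "P (Suc N) x = 0" using assms by (simp add: Z_def)
    moreover have "P (Suc (Suc N)) x = 0"
      unfolding jacobi_poly_Suc_Suc using b_end \<open>P (Suc N) x = 0\<close> by simp
    ultimately show ?case by simp
  next
    case (Suc i)
    then have "P (Suc (Suc (Suc N + i))) x = 0" unfolding jacobi_poly_Suc_Suc[of "Suc N + i"]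
      by (simp del: jacobi_poly.simps)
    then show ?case using Suc by (simp del: jacobi_poly.simps)
  qed
  from this[of "nat l - Suc N"] show ?thesis using assms(2) by (simp add: Pz_def)
qed

text \<open>Multiplication by \<open>x\<close> is one step of a lattice path. Since positions are
  recorded relative to \<open>- j\<close>, up, level and down steps raise \<open>m\<close> by 2, 1
  and 0.\<close>

lemma power_mult_P:
  assumes "k \<ge> 0"
  shows "x ^ j * Pz k x = (\<Sum>m\<le>2*j. of_real (H j k m) * Pz (k + int m - int j) x)"
proof (induction j)
  case 0
  then show ?case by simp
next
  case (Suc j)
  let ?h = "\<lambda>m. complex_of_real (H j k m)"
  have "x ^ Suc j * Pz k x = (\<Sum>m\<le>2*j. ?h m * (x * Pz (k + int m - int j) x))"
    using Suc by (simp add: mult.assoc sum_distrib_left mult.left_commute)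
  also have "\<dots> = (\<Sum>m\<le>2*j. ?h m * Pz (k + int m - int j + 1) x
      + ?h m * of_real (d (k + int m - int j)) * Pz (k + int m - int j) x
      + ?h m * of_real (b (k + int m - int j)) * Pz (k + int m - int j - 1) x)"
  proof (rule sum.cong)
    fix m assume "m \<in> {..2*j}"
    show "?h m * (x * Pz (k + int m - int j) x) = ?h m * Pz (k + int m - int j + 1) x
      + ?h m * of_real (d (k + int m - int j)) * Pz (k + int m - int j) x
      + ?h m * of_real (b (k + int m - int j)) * Pz (k + int m - int j - 1) x"
    \<comment> \<open>At position -1 the recurrence for \<open>Pz\<close> fails because
      \<open>Pz 0 x = 1\<close>; paths that reach negative positions have weight 0.\<close>
    proof (cases "k + int m - int j < 0")
      case True
      then show ?thesis using path_weight_neg[OF assms True] by simp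
    next
      case False
      then show ?thesis by (subst Pz_rec) (auto simp: algebra_simps)
    qed
  qed simp
  also have "\<dots> = (\<Sum>m\<le>2*j. ?h m * Pz (k + int (Suc (Suc m)) - int (Suc j)) x)
      + (\<Sum>m\<le>2*j. ?h m * of_real (d (k + int (Suc m) - 1 - int j)) * Pz (k + int (Suc m) - int (Suc j)) x)
      + (\<Sum>m\<le>2*j. ?h m * of_real (b (k + int m - int j)) * Pz (k + int m - int (Suc j)) x)"
    by (simp add: sum.distrib algebra_simps)
  also have "(\<Sum>m\<le>2*j. ?h m * Pz (k + int (Suc (Suc m)) - int (Suc j)) x)
     = (\<Sum>m\<le>2*Suc j. of_real (if m \<ge> 2 then H j k (m - 2) else 0) * Pz (k + int m - int (Suc j)) x)"
    by (simp add: sum.atMost_Suc_shift del: sum.atMost_Suc of_nat_Suc)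
  also have "(\<Sum>m\<le>2*j. ?h m * of_real (d (k + int (Suc m) - 1 - int j)) * Pz (k + int (Suc m) - int (Suc j)) x)
     = (\<Sum>m\<le>2*Suc j. of_real (if m \<ge> 1 then d (k + int m - 1 - int j) * H j k (m - 1) else 0) * Pz (k + int m - int (Suc j)) x)"
  proof -
    have "(\<Sum>m\<le>2*Suc j. of_real (if m \<ge> 1 then d (k + int m - 1 - int j) * H j k (m - 1) else 0) * Pz (k + int m - int (Suc j)) x)
       = (\<Sum>m\<le>Suc (2*j). of_real (d (k + int (Suc m) - 1 - int j) * H j k m) * Pz (k + int (Suc m) - int (Suc j)) x)"
      using sum.atMost_Suc_shift[of "\<lambda>m. of_real (if m \<ge> 1 then d (k + int m - 1 - int j) * H j k (m - 1) else 0) * Pz (k + int m - int (Suc j)) x" "Suc (2*j)"]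
      by (simp del: sum.atMost_Suc of_nat_Suc)
    also have "\<dots> = (\<Sum>m\<le>2*j. ?h m * of_real (d (k + int (Suc m) - 1 - int j)) * Pz (k + int (Suc m) - int (Suc j)) x)"
      by (simp add: path_weight_beyond mult.commute mult.left_commute del: of_nat_Suc)
    finally show ?thesis by simp
  qed
  also have "(\<Sum>m\<le>2*j. ?h m * of_real (b (k + int m - int j)) * Pz (k + int m - int (Suc j)) x)
     = (\<Sum>m\<le>2*Suc j. of_real (b (k + int m - int j) * H j k m) * Pz (k + int m - int (Suc j)) x)"
    by (simp add: path_weight_beyond mult.commute mult.left_commute del: of_nat_Suc)
  finally show ?case
    by (simp add: sum.distrib distrib_right del: sum.atMost_Suc of_nat_Suc mult_Suc_right)
qed

text \<open>This is the trace of the \<open>j\<close>-th power. At each zero, 1 is written as the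
  normalized sum of the squares of the \<open>P k x\<close>; after the sums are swapped, dual
  orthogonality keeps only the return paths \<open>m = j\<close>.\<close>

lemma sum_power_Z: "(\<Sum>x\<in>Z. x ^ j) = of_real (\<Sum>k\<le>N. H j (int k) j)"
proof -
  have "(\<Sum>x\<in>Z. x ^ j) = (\<Sum>x\<in>Z. \<Sum>k\<le>N. x ^ j * (P k x * P k x / (of_real (norm_sq k) * christoffel x)))"
  proof (rule sum.cong)
    fix x assume "x \<in> Z"
    then have nz: "christoffel x \<noteq> 0" using christoffel_nz Z_real by auto
    have "(\<Sum>k\<le>N. x ^ j * (P k x * P k x / (of_real (norm_sq k) * christoffel x))) = 
       x ^ j * ((\<Sum>k\<le>N. P k x * P k x / of_real (norm_sq k)) / christoffel x)"
      by (simp add: sum_distrib_left sum_divide_distrib)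
    then show "x ^ j = (\<Sum>k\<le>N. x ^ j * (P k x * P k x / (of_real (norm_sq k) * christoffel x)))"
      using nz by (simp add: christoffel_def[symmetric])
  qed simp
  also have "\<dots> = (\<Sum>k\<le>N. \<Sum>x\<in>Z. x ^ j * (P k x * P k x / (of_real (norm_sq k) * christoffel x)))"
    by (rule sum.swap)
  also have "\<dots> = (\<Sum>k\<le>N. of_real (H j (int k) j))"
  proof (rule sum.cong)
    fix k assume k: "k \<in> {..N}"
    let ?f = "\<lambda>x. P k x / (of_real (norm_sq k) * christoffel x)"
    have "(\<Sum>x\<in>Z. x ^ j * (P k x * P k x / (of_real (norm_sq k) * christoffel x))) = (\<Sum>x\<in>Z. (x ^ j * Pz (int k) x) * ?f x)"
      by (simp add: Pz_def mult.assoc)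
    also have "\<dots> = (\<Sum>x\<in>Z. \<Sum>m\<le>2*j. of_real (H j (int k) m) * (Pz (int k + int m - int j) x * ?f x))"
      by (subst power_mult_P) (auto simp: sum_distrib_right sum_divide_distrib mult.assoc)
    also have "\<dots> = (\<Sum>m\<le>2*j. of_real (H j (int k) m) * (\<Sum>x\<in>Z. Pz (int k + int m - int j) x * ?f x))"
      by (subst sum.swap) (simp add: sum_distrib_left)
    also have "\<dots> = (\<Sum>m\<le>2*j. of_real (H j (int k) m) * (if m = j then 1 else 0))"
    proof (rule sum.cong)
      fix m assume "m \<in> {..2*j}"
      define l where "l = int k + int m - int j"
      have "(\<Sum>x\<in>Z. Pz l x * ?f x) = (if l = int k then 1 else 0)"
      proof -
        \<comment> \<open>Paths that end outside 0 to \<open>N\<close> contribute nothing, so the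
          unrestricted lattice yields the trace of the truncated matrix.\<close>
        consider "l < 0" | "l > int N" | "0 \<le> l \<and> l \<le> int N" by linarith
        then show ?thesis
        proof cases
          case 1
          then show ?thesis by (auto simp: Pz_def)
        next
          case 2
          then show ?thesis using k by (auto simp: Pz_beyond)
        next
          case 3
          then obtain i where l: "l = int i" "i \<le> N" using nonneg_int_cases by (metis of_nat_le_iff)
          have "(\<Sum>x\<in>Z. Pz l x * ?f x) = (\<Sum>x\<in>Z. P k x * P i x / (of_real (norm_sq k) * christoffel x))"
            by (simp add: l Pz_def mult.commute)
          then show ?thesis using dual_orthogonality[of k i] k l by auto
        qed
      qed
      then show "of_real (H j (int k) m) * (\<Sum>x\<in>Z. Pz (int k + int m - int j) x * ?f x) = complex_of_real (H j (int k) m) * (if m = j then 1 else 0)"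
        by (auto simp: l_def)
    qed simp
    also have "\<dots> = of_real (H j (int k) j)" by (simp add: if_distrib sum.delta cong: if_cong)
    finally show "(\<Sum>x\<in>Z. x ^ j * (P k x * P k x / (of_real (norm_sq k) * christoffel x))) = of_real (H j (int k) j)" .
  qed simp
  finally show ?thesis by simp
qed

text \<open>Outside this disk the recurrence makes \<open>norm (P k x)\<close> nondecreasing in
  \<open>k\<close>, starting from 1, so \<open>P (N + 1) x\<close> cannot vanish. Entries bounded
  uniformly in \<open>N\<close> thus confine all zeros to one compact set.\<close>

lemma Z_bound:
  assumes "\<And>k. 0 \<le> k \<Longrightarrow> k \<le> int N \<Longrightarrow> \<bar>d k\<bar> \<le> K" "\<And>k. 0 \<le> k \<Longrightarrow> k \<le> int N \<Longrightarrow> \<bar>b k\<bar> \<le> K" "x \<in> Z"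
  shows "norm x \<le> 2 * K + 1"
proof (rule ccontr)
  assume "\<not> norm x \<le> 2 * K + 1"
  then have x: "norm x > 2 * K + 1" by simp
  have K: "K \<ge> 0" using assms(1)[of 0] by auto
  have "k \<le> N \<Longrightarrow> norm (P (Suc k) x) \<ge> norm (P k x) \<and> norm (P k x) > 0" for k
  proof (induction k)
    case 0
    have "norm x - \<bar>d 0\<bar> \<le> norm (x - of_real (d 0))" by (metis norm_of_real norm_triangle_ineq2)
    then show ?case using assms(1)[of 0] x K by simp
  next
    case (Suc k)
    then have IH: "norm (P (Suc k) x) \<ge> norm (P k x)" "norm (P k x) > 0" by (auto simp del: jacobi_poly.simps)
    have dk: "\<bar>d (int k + 1)\<bar> \<le> K" "\<bar>b (int k + 1)\<bar> \<le> K" using Suc.prems by (auto intro!: assms)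
    have "norm (x - of_real (d (int k + 1))) \<ge> K + 1"
      using norm_triangle_ineq2[of x "of_real (d (int k + 1))"] dk x by simp
    then have 1: "norm ((x - of_real (d (int k + 1))) * P (Suc k) x) \<ge> (K + 1) * norm (P (Suc k) x)"
      by (simp add: norm_mult mult_right_mono del: jacobi_poly.simps)
    have 2: "norm (of_real (b (int k + 1)) * P k x) \<le> K * norm (P (Suc k) x)"
      unfolding norm_mult using dk IH(1) K by (intro mult_mono) (auto simp del: jacobi_poly.simps)
    have "norm (P (Suc (Suc k)) x) \<ge> norm ((x - of_real (d (int k + 1))) * P (Suc k) x) - norm (of_real (b (int k + 1)) * P k x)"
      unfolding jacobi_poly_Suc_Suc by (rule norm_triangle_ineq2)
    then have "norm (P (Suc (Suc k)) x) \<ge> norm (P (Suc k) x)" using 1 2 by (simp add: algebra_simps del: jacobi_poly.simps)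
    moreover have "norm (P (Suc k) x) > 0" using IH by linarith
    ultimately show ?case by blast
  qed
  from this[of N] show False using assms(3) by (auto simp: Z_def simp del: jacobi_poly.simps)
qed

end

section \<open>Slowly varying coefficients\<close>

text \<open>
  Row \<open>N\<close> of \<open>f\<close> samples \<open>g\<close> at the points \<open>k / N\<close>, up to a uniform error \<open>O(1 / N)\<close>.
\<close>

definition approx :: "(nat \<Rightarrow> nat \<Rightarrow> real) \<Rightarrow> (real \<Rightarrow> real) \<Rightarrow> bool" where
  "approx f g \<longleftrightarrow> (\<exists>C. \<forall>N k. 0 < N \<longrightarrow> k \<le> N \<longrightarrow> \<bar>f N k - g (real k / real N)\<bar> \<le> C / real N)
     \<and> (\<exists>B. \<forall>x\<in>{0..1}. \<bar>g x\<bar> \<le> B)"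

lemma approxI:
  assumes "\<And>N k. 0 < N \<Longrightarrow> k \<le> N \<Longrightarrow> \<bar>f N k - g (real k / real N)\<bar> \<le> C / real N"
    and "\<And>x. 0 \<le> x \<Longrightarrow> x \<le> 1 \<Longrightarrow> \<bar>g x\<bar> \<le> B"
  shows "approx f g"
  using assms unfolding approx_def by (meson atLeastAtMost_iff)

lemma approxE:
  assumes "approx f g"
  obtains C B where "C \<ge> 0" "B \<ge> 0"
    "\<And>N k. 0 < N \<Longrightarrow> k \<le> N \<Longrightarrow> \<bar>f N k - g (real k / real N)\<bar> \<le> C / real N"
    "\<And>x. 0 \<le> x \<Longrightarrow> x \<le> 1 \<Longrightarrow> \<bar>g x\<bar> \<le> B"
proof -
  obtain C B where C: "\<And>N k. 0 < N \<Longrightarrow> k \<le> N \<Longrightarrow> \<bar>f N k - g (real k / real N)\<bar> \<le> C / real N"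
    and B: "\<And>x. x \<in> {0..1} \<Longrightarrow> \<bar>g x\<bar> \<le> B"
    using assms unfolding approx_def by blast
  have "C \<ge> 0" using C[of 1 0] by simp
  moreover have "B \<ge> 0" using B[of 0] by simp
  ultimately show ?thesis using that[of C B] C B by auto
qed

lemma approx_const [intro]: "approx (\<lambda>N k. c) (\<lambda>x. c)"
  by (rule approxI[where C = 0 and B = "\<bar>c\<bar>"]) auto

lemma approx_add [intro]:
  assumes "approx f g" "approx f' g'"
  shows "approx (\<lambda>N k. f N k + f' N k) (\<lambda>x. g x + g' x)"
proof -
  obtain C B where 1: "C \<ge> 0" "B \<ge> 0"
    "\<And>N k. 0 < N \<Longrightarrow> k \<le> N \<Longrightarrow> \<bar>f N k - g (real k / real N)\<bar> \<le> C / real N"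
    "\<And>x. 0 \<le> x \<Longrightarrow> x \<le> 1 \<Longrightarrow> \<bar>g x\<bar> \<le> B" using approxE[OF assms(1)] by metis
  obtain C' B' where 2: "C' \<ge> 0" "B' \<ge> 0"
    "\<And>N k. 0 < N \<Longrightarrow> k \<le> N \<Longrightarrow> \<bar>f' N k - g' (real k / real N)\<bar> \<le> C' / real N"
    "\<And>x. 0 \<le> x \<Longrightarrow> x \<le> 1 \<Longrightarrow> \<bar>g' x\<bar> \<le> B'" using approxE[OF assms(2)] by metis
  show ?thesis
  proof (rule approxI[where C = "C + C'" and B = "B + B'"])
    fix N k :: nat assume "0 < N" "k \<le> N"
    from 1(3)[OF this] 2(3)[OF this]
    show "\<bar>f N k + f' N k - (g (real k / real N) + g' (real k / real N))\<bar> \<le> (C + C') / real N"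
      by (simp add: add_divide_distrib)
  next
    fix x :: real assume "0 \<le> x" "x \<le> 1"
    from 1(4)[OF this] 2(4)[OF this] show "\<bar>g x + g' x\<bar> \<le> B + B'" by simp
  qed
qed

lemma approx_mult [intro]:
  assumes "approx f g" "approx f' g'"
  shows "approx (\<lambda>N k. f N k * f' N k) (\<lambda>x. g x * g' x)"
proof -
  obtain C B where 1: "C \<ge> 0" "B \<ge> 0"
    "\<And>N k. 0 < N \<Longrightarrow> k \<le> N \<Longrightarrow> \<bar>f N k - g (real k / real N)\<bar> \<le> C / real N"
    "\<And>x. 0 \<le> x \<Longrightarrow> x \<le> 1 \<Longrightarrow> \<bar>g x\<bar> \<le> B" using approxE[OF assms(1)] by metis
  obtain C' B' where 2: "C' \<ge> 0" "B' \<ge> 0"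
    "\<And>N k. 0 < N \<Longrightarrow> k \<le> N \<Longrightarrow> \<bar>f' N k - g' (real k / real N)\<bar> \<le> C' / real N"
    "\<And>x. 0 \<le> x \<Longrightarrow> x \<le> 1 \<Longrightarrow> \<bar>g' x\<bar> \<le> B'" using approxE[OF assms(2)] by metis
  show ?thesis
  proof (rule approxI[where C = "C * (B' + C') + B * C'" and B = "B * B'"])
    fix N k :: nat assume Nk: "0 < N" "k \<le> N"
    define x where "x = real k / real N"
    have x: "0 \<le> x" "x \<le> 1" using Nk by (auto simp: x_def)
    have c1: "\<bar>f N k - g x\<bar> \<le> C / real N" and c2: "\<bar>f' N k - g' x\<bar> \<le> C' / real N"
      using 1(3)[OF Nk] 2(3)[OF Nk] by (auto simp: x_def)
    have "C' / real N \<le> C'" using Nk 2(1) by (simp add: divide_le_eq mult_left_mono[of 1 "real N" C', simplified])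
    then have f': "\<bar>f' N k\<bar> \<le> B' + C'" using c2 2(4)[OF x] by linarith
    have "f N k * f' N k - g x * g' x = (f N k - g x) * f' N k + g x * (f' N k - g' x)" by (simp add: algebra_simps)
    then have "\<bar>f N k * f' N k - g x * g' x\<bar> \<le> \<bar>f N k - g x\<bar> * \<bar>f' N k\<bar> + \<bar>g x\<bar> * \<bar>f' N k - g' x\<bar>"
      by (metis abs_mult abs_triangle_ineq)
    also have "\<dots> \<le> (C / real N) * (B' + C') + B * (C' / real N)"
      using c1 c2 f' 1(1,2) 1(4)[OF x] by (intro add_mono mult_mono) auto
    finally show "\<bar>f N k * f' N k - g (real k / real N) * g' (real k / real N)\<bar> \<le> (C * (B' + C') + B * C') / real N"
      by (simp add: x_def add_divide_distrib)
  next
    fix x :: real assume "0 \<le> x" "x \<le> 1"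
    from 1(4)[OF this] 2(4)[OF this] 1(2) 2(2) show "\<bar>g x * g' x\<bar> \<le> B * B'" by (simp add: abs_mult mult_mono)
  qed
qed

lemma approx_cong:
  assumes "approx f g" "\<And>N k. N > 0 \<Longrightarrow> k \<le> N \<Longrightarrow> f N k = f' N k" "\<And>x. g x = g' x"
  shows "approx f' g'"
  using assms unfolding approx_def by simp

lemma approx_index: "approx (\<lambda>N k. (real k + r) / real N) (\<lambda>x. x)"
  by (rule approxI[where C = "\<bar>r\<bar>" and B = 1]) (auto simp: add_divide_distrib)

lemma approx_inverse: "approx (\<lambda>N k. 1 / real N) (\<lambda>x. 0)"
  by (rule approxI[where C = 1 and B = 0]) auto

text \<open>To be used twice, with \<open>c\<close> equal to \<open>half_count\<close> and to
  \<open>half_count + 1\<close>: for \<open>n = 2 * N + half_count\<close> the product of the two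
  quotients is \<open>N^2 / (n (n + 1))\<close>, with limit 1/4.\<close>

lemma approx_half:
  assumes "c \<ge> 0"
  shows "approx (\<lambda>N k. real N / (2 * real N + c)) (\<lambda>x. 1 / 2)"
proof (rule approxI[where C = c and B = 1])
  fix N k :: nat assume N: "0 < N"
  have "real N / (2 * real N + c) - 1 / 2 = - c / (2 * (2 * real N + c))" using N assms by (simp add: field_simps)
  then have "\<bar>real N / (2 * real N + c) - 1 / 2\<bar> = c / (2 * (2 * real N + c))" using N assms by simp
  also have "\<dots> \<le> c / real N" using N assms by (intro divide_left_mono) (auto intro!: mult_pos_pos add_pos_nonneg)
  finally show "\<bar>real N / (2 * real N + c) - 1 / 2\<bar> \<le> c / real N" .
qed auto

text \<open>A path of fixed length visits only positions at bounded distance from \<open>k\<close>,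
  and all of them have the same limit \<open>x\<close>. The limit is the weight of paths with
  constant step weights, which a trinomial power generates. The shifts \<open>i\<close> in the
  hypotheses absorb the displacement along the path.\<close>

lemma approx_path_weight:
  assumes d: "\<And>i. approx (\<lambda>N k. d N (int k + i)) \<alpha>" and b: "\<And>i. approx (\<lambda>N k. b N (int k + i)) \<beta>"
  shows "approx (\<lambda>N k. path_weight (d N) (b N) j (int k) m) (\<lambda>x. coeff ([:\<beta> x, \<alpha> x, 1:] ^ j) m)"
proof (induction j arbitrary: m)
  case 0
  show ?case by (cases "m = 0") (auto intro: approx_const)
next
  case (Suc j)
  have 1: "approx (\<lambda>N k. if m \<ge> 2 then path_weight (d N) (b N) j (int k) (m - 2) else 0)
         (\<lambda>x. if m \<ge> 2 then coeff ([:\<beta> x, \<alpha> x, 1:] ^ j) (m - 2) else 0)"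
    using Suc[of "m - 2"] approx_const[of 0] by (cases "m \<ge> 2") auto
  have 2: "approx (\<lambda>N k. if m \<ge> 1 then d N (int k + int m - 1 - int j) * path_weight (d N) (b N) j (int k) (m - 1) else 0)
         (\<lambda>x. if m \<ge> 1 then \<alpha> x * coeff ([:\<beta> x, \<alpha> x, 1:] ^ j) (m - 1) else 0)"
    using approx_mult[OF d[of "int m - 1 - int j"] Suc[of "m - 1"]] approx_const[of 0] by (cases "m \<ge> 1") (auto simp: algebra_simps)
  have 3: "approx (\<lambda>N k. b N (int k + int m - int j) * path_weight (d N) (b N) j (int k) m)
         (\<lambda>x. \<beta> x * coeff ([:\<beta> x, \<alpha> x, 1:] ^ j) m)"
    using approx_mult[OF b[of "int m - int j"] Suc[of "m"]] by (simp add: algebra_simps)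
  show ?case
  proof (rule approx_cong[OF approx_add[OF approx_add[OF 1 2] 3]])
    fix x
    show "(if m \<ge> 2 then coeff ([:\<beta> x, \<alpha> x, 1:] ^ j) (m - 2) else 0) + (if m \<ge> 1 then \<alpha> x * coeff ([:\<beta> x, \<alpha> x, 1:] ^ j) (m - 1) else 0)
       + \<beta> x * coeff ([:\<beta> x, \<alpha> x, 1:] ^ j) m = coeff ([:\<beta> x, \<alpha> x, 1:] ^ Suc j) m"
      by (cases m rule: nat.exhaust; cases "m - 1" rule: nat.exhaust) (auto simp: coeff_pCons split: nat.splits)
  qed simp
qed

lemma riemann_sum_tendsto:
  fixes g :: "real \<Rightarrow> real"
  assumes g: "continuous_on {0..1} g"
  shows "(\<lambda>N. (\<Sum>k<N. g (real k / real N)) / real N) \<longlonglongrightarrow> integral {0..1} g"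
proof (rule LIMSEQ_I)
  fix e :: real assume e: "e > 0"
  have "uniformly_continuous_on {0..1} g" using g by (intro compact_uniformly_continuous) auto
  then obtain \<delta> where \<delta>: "\<delta> > 0" "\<And>x y. x \<in> {0..1} \<Longrightarrow> y \<in> {0..1} \<Longrightarrow> dist y x < \<delta> \<Longrightarrow> dist (g y) (g x) < e / 2"
    using e uniformly_continuous_onE[of "{0..1}" g "e / 2"] by (metis half_gt_zero)
  obtain N0 :: nat where N0: "1 / \<delta> < real N0" using reals_Archimedean2 by blast
  have "norm ((\<Sum>k<N. g (real k / real N)) / real N - integral {0..1} g) < e" if N: "N \<ge> Suc N0" for N
  proof -
    have Npos: "real N > 0" using N by simp
    have small: "1 / real N < \<delta>" using N0 N \<delta>(1) Npos by (simp add: field_simps) (smt (verit) mult_left_mono of_nat_Suc of_nat_mono)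
    have int: "g integrable_on {u..v}" if "0 \<le> u" "v \<le> 1" for u v
      using that by (intro integrable_continuous_real continuous_on_subset[OF g]) auto
    have "k \<le> N \<Longrightarrow> \<bar>integral {0..real k / real N} g - (\<Sum>i<k. g (real i / real N)) / real N\<bar> \<le> (e / 2) * (real k / real N)" for k
    proof (induction k)
      case 0
      then show ?case by simp
    next
      case (Suc k)
      let ?u = "real k / real N" and ?v = "real (Suc k) / real N"
      have uv: "0 \<le> ?u" "?u \<le> ?v" "?v \<le> 1" using Suc.prems Npos by (auto simp: divide_right_mono)
      have vu: "?v - ?u = 1 / real N" by (simp add: add_divide_distrib)
      have comb: "integral {0..?v} g = integral {0..?u} g + integral {?u..?v} g"
        using uv int by (intro Henstock_Kurzweil_Integration.integral_combine[symmetric]) auto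
      have "norm (integral {?u..?v} (\<lambda>x. g x - g ?u)) \<le> (e / 2) * (?v - ?u)"
      proof (rule integral_bound)
        show "continuous_on {?u..?v} (\<lambda>x. g x - g ?u)" using uv by (intro continuous_intros continuous_on_subset[OF g]) auto
        fix t assume t: "t \<in> {?u..?v}"
        then have "dist t ?u < \<delta>" using vu small by (auto simp: dist_real_def)
        moreover have "0 \<le> t" using t order_trans[OF uv(1)] by auto
        then have "t \<in> {0..1}" "?u \<in> {0..1}" using t uv by auto
        ultimately have "dist (g t) (g ?u) < e / 2" using \<delta>(2)[of ?u t] by blast
        then show "norm (g t - g ?u) \<le> e / 2" by (simp add: dist_norm)
      qed (use uv in auto)
      moreover have "integral {?u..?v} (\<lambda>x. g x - g ?u) = integral {?u..?v} g - g ?u / real N"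
        using uv int[of ?u ?v] vu by (subst Henstock_Kurzweil_Integration.integral_diff) auto
      ultimately have "\<bar>integral {?u..?v} g - g ?u / real N\<bar> \<le> (e / 2) * (1 / real N)" using vu by simp
      moreover have "\<bar>integral {0..?u} g - (\<Sum>i<k. g (real i / real N)) / real N\<bar> \<le> (e / 2) * ?u" using Suc by simp
      moreover have "(e / 2) * ?v = (e / 2) * ?u + (e / 2) * (1 / real N)" by (simp add: add_divide_distrib distrib_left)
      ultimately show ?case unfolding comb by (simp add: add_divide_distrib)
    qed
    from this[of N] have "\<bar>integral {0..1} g - (\<Sum>i<N. g (real i / real N)) / real N\<bar> \<le> e / 2" using Npos by simp
    then show ?thesis using e by (simp add: abs_minus_commute)
  qed
  then show "\<exists>no. \<forall>n\<ge>no. norm ((\<Sum>k<n. g (real k / real n)) / real n - integral {0..1} g) < e" by blast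
qed

lemma approx_mean_tendsto:
  assumes "approx f g" "continuous_on {0..1} g"
  shows "(\<lambda>N. (\<Sum>k\<le>N. f N k) / real (Suc N)) \<longlonglongrightarrow> integral {0..1} g"
proof -
  obtain C B where 1: "C \<ge> 0" "B \<ge> 0"
    "\<And>N k. 0 < N \<Longrightarrow> k \<le> N \<Longrightarrow> \<bar>f N k - g (real k / real N)\<bar> \<le> C / real N"
    "\<And>x. 0 \<le> x \<Longrightarrow> x \<le> 1 \<Longrightarrow> \<bar>g x\<bar> \<le> B" using approxE[OF assms(1)] by metis
  \<comment> \<open>The sum up to \<open>k = N\<close> is the left Riemann sum, renormalized by
    \<open>N / (N + 1)\<close>, plus the endpoint term \<open>g 1\<close>.\<close>
  have "(\<lambda>N. (\<Sum>k<N. g (real k / real N)) / real N * (real N / real (Suc N)) + g 1 / real (Suc N)) \<longlonglongrightarrow> integral {0..1} g * 1 + 0"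
    by (intro tendsto_intros riemann_sum_tendsto assms LIMSEQ_n_over_Suc_n lim_const_over_n LIMSEQ_Suc[of "\<lambda>n. g 1 / real n", OF lim_const_over_n])
  moreover have "(\<Sum>k<N. g (real k / real N)) / real N * (real N / real (Suc N)) + g 1 / real (Suc N) = (\<Sum>k\<le>N. g (real k / real N)) / real (Suc N)" if "N > 0" for N
    using that by (simp add: lessThan_Suc_atMost[symmetric] add_divide_distrib)
  ultimately have A: "(\<lambda>N. (\<Sum>k\<le>N. g (real k / real N)) / real (Suc N)) \<longlonglongrightarrow> integral {0..1} g"
    by (rule_tac Lim_transform_eventually) (auto intro: eventually_sequentiallyI[of 1])
  have B: "(\<lambda>N. (\<Sum>k\<le>N. f N k) / real (Suc N) - (\<Sum>k\<le>N. g (real k / real N)) / real (Suc N)) \<longlonglongrightarrow> 0"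
  proof (rule Lim_null_comparison)
    show "(\<lambda>N. C / real N) \<longlonglongrightarrow> 0" by (rule lim_const_over_n)
    show "\<forall>\<^sub>F N in sequentially. norm ((\<Sum>k\<le>N. f N k) / real (Suc N) - (\<Sum>k\<le>N. g (real k / real N)) / real (Suc N)) \<le> C / real N"
    proof (rule eventually_sequentiallyI[of 1])
      fix N :: nat assume N: "1 \<le> N"
      have "\<bar>(\<Sum>k\<le>N. f N k) - (\<Sum>k\<le>N. g (real k / real N))\<bar> \<le> (\<Sum>k\<le>N. \<bar>f N k - g (real k / real N)\<bar>)"
        by (simp add: sum_subtractf[symmetric] sum_abs)
      also have "\<dots> \<le> (\<Sum>k\<le>N. C / real N)" using N by (intro sum_mono 1(3)) auto
      also have "\<dots> = real (Suc N) * (C / real N)" by simp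
      finally have "\<bar>(\<Sum>k\<le>N. f N k) - (\<Sum>k\<le>N. g (real k / real N))\<bar> \<le> real (Suc N) * (C / real N)" .
      then show "norm ((\<Sum>k\<le>N. f N k) / real (Suc N) - (\<Sum>k\<le>N. g (real k / real N)) / real (Suc N)) \<le> C / real N"
        by (simp add: diff_divide_distrib[symmetric] abs_divide divide_le_eq mult.commute)
    qed
  qed
  from tendsto_add[OF B A] show ?thesis by simp
qed

section \<open>The limiting moments\<close>

text \<open>If \<open>r\<close> factors contribute the square of the variable, the other
  \<open>j - r\<close> must contribute the power \<open>j - 2 * r\<close>, so \<open>r\<close> of
  them give \<beta>. For \<open>2 * r > j\<close> the second binomial vanishes, which makes the
  truncated exponent harmless.\<close>

lemma coeff_trinomial_power:
  fixes \<alpha> \<beta> :: "'a::comm_ring_1"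
  shows "coeff ([:\<beta>, \<alpha>, 1:] ^ j) j = (\<Sum>r\<le>j. of_nat ((j choose r) * ((j - r) choose r)) * \<alpha> ^ (j - 2 * r) * \<beta> ^ r)"
proof -
  have "[:\<beta>, \<alpha>, 1:] = monom 1 2 + [:\<beta>, \<alpha>:]" by (simp add: monom_altdef numeral_2_eq_2)
  then have "coeff ([:\<beta>, \<alpha>, 1:] ^ j) j = (\<Sum>r\<le>j. of_nat (j choose r) * coeff (monom 1 (2 * r) * [:\<beta>, \<alpha>:] ^ (j - r)) j)"
    by (simp add: binomial_ring coeff_sum monom_power mult.assoc) (simp add: of_nat_poly)
  also have "\<dots> = (\<Sum>r\<le>j. of_nat ((j choose r) * ((j - r) choose r)) * \<alpha> ^ (j - 2 * r) * \<beta> ^ r)"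
  proof (rule sum.cong)
    fix r assume r: "r \<in> {..j}"
    show "of_nat (j choose r) * coeff (monom 1 (2 * r) * [:\<beta>, \<alpha>:] ^ (j - r)) j
      = of_nat ((j choose r) * ((j - r) choose r)) * \<alpha> ^ (j - 2 * r) * \<beta> ^ r"
    proof (cases "2 * r \<le> j")
      case True
      have "j - r - (j - 2 * r) = r" using True by simp
      moreover have "(j - r) choose (j - 2 * r) = (j - r) choose r"
        using True binomial_symmetric[of r "j - r"] by (simp add: diff_diff_left mult_2)
      ultimately show ?thesis using True
        by (simp add: coeff_monom_mult coeff_linear_poly_power mult.assoc)
    next
      case False
      then show ?thesis by (simp add: coeff_monom_mult binomial_eq_0)
    qed
  qed simp
  finally show ?thesis .
qed

text \<open>Half of the Beta function at \<open>(p + 1/2, r + 1)\<close>, with the Gamma quotients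
  written as Pochhammer symbols.\<close>

definition "beta_value p r = fact r * pochhammer (1/2::real) p / (2 * pochhammer (1/2) (p + r + 1))"

lemma poch_half_pos: "pochhammer (1/2::real) n > 0" by (rule pochhammer_pos) simp

text \<open>Integration by parts: \<open>?F\<close> vanishes at both ends, and its derivative trades
  one power of \<open>1 - z^2\<close> for two powers of \<open>z\<close>. Hence the induction on
  \<open>r\<close> with \<open>p\<close> arbitrary.\<close>

lemma has_integral_beta:
  "((\<lambda>z::real. z ^ (2 * p) * (1 - z\<^sup>2) ^ r) has_integral beta_value p r) {0..1}"
proof (induction r arbitrary: p)
  case 0
  have "((\<lambda>z::real. z ^ (2 * p)) has_integral (1 ^ Suc (2*p) / Suc (2*p) - 0 ^ Suc (2*p) / Suc (2*p))) {0..1}"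
    by (rule fundamental_theorem_of_calculus)
      (auto intro!: derivative_eq_intros simp: has_real_derivative_iff_has_vector_derivative[symmetric] simp del: power_Suc)
  moreover have "beta_value p 0 = 1 / Suc (2*p)"
  proof -
    have "x / (2 * (x * (1 / 2 + real p))) = 1 / Suc (2*p)" if "x > 0" for x :: real
      using that by (simp add: divide_simps)
    from this[OF poch_half_pos[of p]] show ?thesis by (simp add: beta_value_def pochhammer_Suc)
  qed
  ultimately show ?case by simp
next
  case (Suc r)
  let ?F = "\<lambda>z::real. z ^ (2 * p + 1) * (1 - z\<^sup>2) ^ Suc r"
  have "((\<lambda>z. (2 * p + 1) * (z ^ (2 * p) * (1 - z\<^sup>2) ^ Suc r) - 2 * (r + 1) * (z ^ (2 * (p + 1)) * (1 - z\<^sup>2) ^ r)) has_integral (?F 1 - ?F 0)) {0..1}"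
  proof (rule fundamental_theorem_of_calculus)
    fix z :: real assume "z \<in> {0..1}"
    have "(?F has_real_derivative ((2 * p + 1) * (z ^ (2 * p) * (1 - z\<^sup>2) ^ Suc r) - 2 * (r + 1) * (z ^ (2 * (p + 1)) * (1 - z\<^sup>2) ^ r))) (at z within {0..1})"
      by (auto intro!: derivative_eq_intros simp del: power_Suc simp add: algebra_simps power_add power2_eq_square)
         (simp add: algebra_simps)
    then show "(?F has_vector_derivative ((2 * p + 1) * (z ^ (2 * p) * (1 - z\<^sup>2) ^ Suc r) - 2 * (r + 1) * (z ^ (2 * (p + 1)) * (1 - z\<^sup>2) ^ r))) (at z within {0..1})"
      by (simp add: has_real_derivative_iff_has_vector_derivative)
  qed simp
  then have "((\<lambda>z. (2 * p + 1) * (z ^ (2 * p) * (1 - z\<^sup>2) ^ Suc r) - 2 * (r + 1) * (z ^ (2 * (p + 1)) * (1 - z\<^sup>2) ^ r)) has_integral 0) {0..1}"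
    by simp
  from has_integral_add[OF this has_integral_mult_right[OF Suc[of "p + 1"], of "2 * (r + 1)"]]
  have "((\<lambda>z. (2 * p + 1) * (z ^ (2 * p) * (1 - z\<^sup>2) ^ Suc r)) has_integral 2 * (r + 1) * beta_value (p + 1) r) {0..1}"
    by (simp del: power_Suc)
  from has_integral_mult_right[OF this, of "1 / (2 * p + 1)"]
  have "((\<lambda>z. z ^ (2 * p) * (1 - z\<^sup>2) ^ Suc r) has_integral (2 * (r + 1) * beta_value (p + 1) r / (2 * p + 1))) {0..1}"
    by (simp del: power_Suc of_nat_Suc of_nat_add)
  moreover have "2 * (r + 1) * beta_value (p + 1) r / (2 * p + 1) = beta_value p (Suc r)"
    using poch_half_pos[of p] poch_half_pos[of "p + r + 2"]
    by (simp add: beta_value_def pochhammer_Suc divide_simps) (simp add: algebra_simps)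
  ultimately show ?case by simp
qed

text \<open>
  The Taylor coefficients of \<open>(1 - x) powr (- 1/2)\<close>.
\<close>

definition "half_coeff m = pochhammer (1/2::real) m / fact m"

lemma half_coeff_0 [simp]: "half_coeff 0 = 1" by (simp add: half_coeff_def)

text \<open>Wallis' reduction: \<open>?F\<close> vanishes at both ends and links the powers
  \<open>2 * m\<close> and \<open>2 * m + 2\<close>.\<close>

lemma has_integral_sin_power:
  "((\<lambda>t::real. sin t ^ (2 * m)) has_integral pi / 2 * half_coeff m) {0..pi/2}"
proof (induction m)
  case 0
  show ?case using has_integral_const_real[of "1::real" 0 "pi/2"] by simp
next
  case (Suc m)
  let ?F = "\<lambda>t::real. sin t ^ (2 * m + 1) * cos t"
  have "((\<lambda>t. (2 * m + 1) * sin t ^ (2 * m) - (2 * m + 2) * sin t ^ (2 * Suc m)) has_integral (?F (pi/2) - ?F 0)) {0..pi/2}"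
  proof (rule fundamental_theorem_of_calculus)
    fix t :: real
    have c: "cos t * cos t = 1 - sin t * sin t" using sin_cos_squared_add[of t] by (simp add: power2_eq_square algebra_simps)
    have "(?F has_real_derivative ((2 * m + 1) * sin t ^ (2 * m) * cos t * cos t - sin t ^ (2 * m + 1) * sin t)) (at t within {0..pi/2})"
      by (auto intro!: derivative_eq_intros simp del: power_Suc simp add: algebra_simps)
    moreover have "(2 * m + 1) * sin t ^ (2 * m) * cos t * cos t - sin t ^ (2 * m + 1) * sin t = (2 * m + 1) * sin t ^ (2 * m) - (2 * m + 2) * sin t ^ (2 * Suc m)"
      by (simp add: c mult.assoc) (simp add: algebra_simps)
    ultimately show "(?F has_vector_derivative ((2 * m + 1) * sin t ^ (2 * m) - (2 * m + 2) * sin t ^ (2 * Suc m))) (at t within {0..pi/2})"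
      by (simp add: has_real_derivative_iff_has_vector_derivative)
  qed simp
  then have "((\<lambda>t. (2 * m + 1) * sin t ^ (2 * m) - (2 * m + 2) * sin t ^ (2 * Suc m)) has_integral 0) {0..pi/2}" by simp
  from has_integral_diff[OF has_integral_mult_right[OF Suc, of "2 * m + 1"] this]
  have "((\<lambda>t. (2 * m + 2) * sin t ^ (2 * Suc m)) has_integral (2 * m + 1) * (pi / 2 * half_coeff m)) {0..pi/2}"
    by (simp del: power_Suc)
  from has_integral_mult_right[OF this, of "1 / (2 * m + 2)"]
  have "((\<lambda>t. sin t ^ (2 * Suc m)) has_integral (2 * m + 1) * (pi / 2 * half_coeff m) / (2 * m + 2)) {0..pi/2}"
    by (simp add: mult.commute del: power_Suc of_nat_Suc of_nat_add mult_Suc_right)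
  moreover have "(2 * m + 1) * (pi / 2 * half_coeff m) / (2 * m + 2) = pi / 2 * half_coeff (Suc m)"
    by (simp add: half_coeff_def pochhammer_Suc divide_simps)
  ultimately show ?case by (simp only:)
qed

lemma half_coeff_convolution:
  fixes p q :: real
  shows "(\<Sum>r\<le>j. half_coeff (j - r) * real ((j - r) choose r) * (p + q) ^ (j - 2 * r) * (- (p * q)) ^ r)
    = (\<Sum>i\<le>j. half_coeff i * half_coeff (j - i) * p ^ i * q ^ (j - i))"
proof -
  \<comment> \<open>Both sides are the \<open>j\<close>-th coefficients of power series with square \<open>1 / ((1 - p x) (1 - q x))\<close>.\<close>
  define \<Phi> where "\<Phi> = Abs_fps half_coeff"
  define h where "h = fps_of_poly [:0, p + q, - (p * q):]"
  \<comment> \<open>Chu-Vandermonde for \<open>1/2 + 1/2 = 1\<close>: every coefficient of the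
    square is 1.\<close>
  have \<Phi>2: "\<Phi> * \<Phi> * (1 - fps_X) = 1"
  proof -
    have "fps_nth (\<Phi> * \<Phi>) n = 1" for n
    proof -
      have "fps_nth (\<Phi> * \<Phi>) n = (\<Sum>i\<le>n. real (n choose i) * pochhammer (1/2) i * pochhammer (1/2) (n - i)) / fact n"
        by (simp add: fps_mult_nth \<Phi>_def half_coeff_def binomial_fact sum_divide_distrib atLeast0AtMost)
      then show ?thesis using pochhammer_binomial_sum[of "1/2" "1/2::real" n]
        by (simp add: pochhammer_fact[symmetric] del: divide_eq_1_iff) (metis divide_self fact_nonzero)
    qed
    then have "\<Phi> * \<Phi> = Abs_fps (\<lambda>_. 1)" by (simp add: fps_eq_iff)
    moreover have "Abs_fps (\<lambda>_. 1::real) * (1 - fps_X) = 1"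
      by (simp add: fps_eq_iff algebra_simps)
    ultimately show ?thesis by simp
  qed
  have comp: "(\<Phi> oo g) * (\<Phi> oo g) * (1 - g) = 1" if "fps_nth g 0 = 0" for g
  proof -
    have "(\<Phi> * \<Phi> * (1 - fps_X)) oo g = (\<Phi> oo g) * (\<Phi> oo g) * (1 - g)"
      using that by (simp add: fps_compose_mult_distrib fps_compose_sub_distrib)
    then show ?thesis by (simp add: \<Phi>2)
  qed
  define F where "F = \<Phi> oo h"
  define G where "G = (\<Phi> oo (fps_const p * fps_X)) * (\<Phi> oo (fps_const q * fps_X))"
  have h0: "fps_nth h 0 = 0" by (simp add: h_def)
  have hf: "1 - h = (1 - fps_const p * fps_X) * (1 - fps_const q * fps_X)"
    by (simp add: h_def fps_of_poly_pCons algebra_simps fps_const_add[symmetric] fps_const_mult[symmetric] fps_const_neg[symmetric] del: fps_const_add fps_const_mult fps_const_neg)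
  have F2: "F * F * (1 - h) = 1" unfolding F_def by (rule comp[OF h0])
  have "G * G * (1 - h) = ((\<Phi> oo (fps_const p * fps_X)) * (\<Phi> oo (fps_const p * fps_X)) * (1 - fps_const p * fps_X)) *
     ((\<Phi> oo (fps_const q * fps_X)) * (\<Phi> oo (fps_const q * fps_X)) * (1 - fps_const q * fps_X))"
    by (simp add: G_def hf mult.commute mult.left_commute)
  also have "\<dots> = 1" by (simp add: comp)
  finally have G2: "G * G * (1 - h) = 1" .
  have nz: "1 - h \<noteq> 0" using F2 by auto
  have "F * F = G * G" using F2 G2 nz by (metis mult_cancel_right)
  then have "(F - G) * (F + G) = 0" by (simp add: algebra_simps)
  then have "F = G \<or> F = - G" by (auto simp: eq_neg_iff_add_eq_0)
  \<comment> \<open>The constant coefficient decides the sign of the square root.\<close>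
  moreover have "fps_nth F 0 = 1" "fps_nth G 0 = 1" by (auto simp: F_def G_def \<Phi>_def)
  ultimately have FG: "F = G" by auto
  \<comment> \<open>\<open>h\<close> is \<open>X * ((p + q) - p * q * X)\<close>, so its
    \<open>i\<close>-th power reaches degree \<open>j\<close> by taking the second term
    \<open>j - i\<close> times; the index in the claim is \<open>r = j - i\<close>.\<close>
  have "fps_nth F j = (\<Sum>i\<le>j. half_coeff i * (fps_nth (h ^ i) j))" by (simp add: F_def fps_compose_nth \<Phi>_def atLeast0AtMost)
  also have "\<dots> = (\<Sum>i\<le>j. half_coeff i * (real (i choose (j - i)) * (p + q) ^ (2 * i - j) * (- (p * q)) ^ (j - i)))"
  proof (rule sum.cong)
    fix i assume i: "i \<in> {..j}"
    have "[:0, p + q, - (p * q):] = monom 1 1 * [:p + q, - (p * q):]" by (simp add: monom_altdef)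
    then have "[:0, p + q, - (p * q):] ^ i = monom 1 i * [:p + q, - (p * q):] ^ i"
      by (simp only: power_mult_distrib monom_power power_one mult_1)
    then have "h ^ i = fps_of_poly (monom 1 i * [:p + q, - (p * q):] ^ i)"
      by (simp only: h_def fps_of_poly_power[symmetric])
    then have hij: "fps_nth (h ^ i) j = coeff ([:p + q, - (p * q):] ^ i) (j - i)"
      using i by (simp add: coeff_monom_mult)
    have "degree ([:p + q, - (p * q):] ^ i) \<le> 1 * i"
      by (rule order_trans[OF degree_power_le]) (intro mult_right_mono, auto)
    then have "coeff ([:p + q, - (p * q):] ^ i) (j - i) = real (i choose (j - i)) * (- (p * q)) ^ (j - i) * (p + q) ^ (i - (j - i))"
      by (cases "j - i \<le> i") (simp_all add: coeff_linear_poly_power coeff_eq_0 binomial_eq_0)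
    then have "fps_nth (h ^ i) j = real (i choose (j - i)) * (- (p * q)) ^ (j - i) * (p + q) ^ (i - (j - i))"
      by (simp only: hij)
    moreover have "i - (j - i) = 2 * i - j" using i by auto
    ultimately show "half_coeff i * (fps_nth (h ^ i) j) = half_coeff i * (real (i choose (j - i)) * (p + q) ^ (2 * i - j) * (- (p * q)) ^ (j - i))"
      by (simp add: mult.assoc mult.left_commute)
  qed simp
  also have "\<dots> = (\<Sum>r\<le>j. half_coeff (j - r) * (real ((j - r) choose (j - (j - r))) * (p + q) ^ (2 * (j - r) - j) * (- (p * q)) ^ (j - (j - r))))"
    by (rule sum.reindex_bij_witness[of _ "\<lambda>r. j - r" "\<lambda>r. j - r"]) auto
  also have "\<dots> = (\<Sum>r\<le>j. half_coeff (j - r) * real ((j - r) choose r) * (p + q) ^ (j - 2 * r) * (- (p * q)) ^ r)"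
  proof (rule sum.cong)
    fix r assume "r \<in> {..j}"
    then have "j - (j - r) = r" "2 * (j - r) - j = j - 2 * r" by auto
    then show "half_coeff (j - r) * (real ((j - r) choose (j - (j - r))) * (p + q) ^ (2 * (j - r) - j) * (- (p * q)) ^ (j - (j - r)))
       = half_coeff (j - r) * real ((j - r) choose r) * (p + q) ^ (j - 2 * r) * (- (p * q)) ^ r" by (simp only: mult.assoc)
  qed simp
  finally have 1: "fps_nth F j = \<dots>" .
  have "fps_nth G j = (\<Sum>i\<le>j. half_coeff i * half_coeff (j - i) * p ^ i * q ^ (j - i))"
    unfolding G_def \<Phi>_def fps_compose_linear by (simp add: fps_mult_nth atLeast0AtMost mult_ac)
  then show ?thesis using 1 FG by simp
qed

text \<open>
  The sum is the \<open>j\<close>-th Taylor coefficient of \<open>((1 - a x) (1 + b x)) powr (- 1/2)\<close>.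
\<close>

definition "moment a b j = fact j / (2 * pochhammer (1/2::real) (j + 1)) *
   (\<Sum>i\<le>j. half_coeff i * half_coeff (j - i) * a ^ i * (- b) ^ (j - i))"

lemma integral_symbol:
  fixes a b :: real
  defines "g \<equiv> \<lambda>j x. coeff ([:a * b * x\<^sup>2 * (1 - x\<^sup>2), (a - b) * x\<^sup>2, 1:] ^ j) j"
  shows "integral {0..1} (g j) = moment a b j" and "continuous_on {0..1} (g j)"
proof -
  have g: "g j x = (\<Sum>r\<le>j. real (j choose r) * real ((j - r) choose r) * (a - b) ^ (j - 2 * r) * (a * b) ^ r * (x ^ (2 * (j - r)) * (1 - x\<^sup>2) ^ r))" for x
    unfolding g_def coeff_trinomial_power
  proof (rule sum.cong)
    fix r assume r: "r \<in> {..j}"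
    show "of_nat ((j choose r) * ((j - r) choose r)) * ((a - b) * x\<^sup>2) ^ (j - 2 * r) * (a * b * x\<^sup>2 * (1 - x\<^sup>2)) ^ r
      = real (j choose r) * real ((j - r) choose r) * (a - b) ^ (j - 2 * r) * (a * b) ^ r * (x ^ (2 * (j - r)) * (1 - x\<^sup>2) ^ r)"
    proof (cases "2 * r \<le> j")
      case True
      then have "2 * (j - r) = 2 * (j - 2 * r) + 2 * r" by simp
      then have "x ^ (2 * (j - r)) = (x\<^sup>2) ^ (j - 2 * r) * (x\<^sup>2) ^ r" by (simp only: power_add power_mult)
      then show ?thesis by (simp add: power_mult_distrib mult.assoc mult.left_commute)
    next
      case False
      then show ?thesis by (simp add: binomial_eq_0)
    qed
  qed simp
  show "continuous_on {0..1} (g j)" unfolding g by (intro continuous_intros)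
  have "(g j has_integral (\<Sum>r\<le>j. real (j choose r) * real ((j - r) choose r) * (a - b) ^ (j - 2 * r) * (a * b) ^ r * beta_value (j - r) r)) {0..1}"
    unfolding g by (intro has_integral_sum has_integral_mult_right has_integral_beta) auto
  then have "integral {0..1} (g j) = (\<Sum>r\<le>j. real (j choose r) * real ((j - r) choose r) * (a - b) ^ (j - 2 * r) * (a * b) ^ r * beta_value (j - r) r)"
    by (rule integral_unique)
  also have "\<dots> = (\<Sum>r\<le>j. fact j / (2 * pochhammer (1/2) (j + 1)) * (half_coeff (j - r) * real ((j - r) choose r) * (a + - b) ^ (j - 2 * r) * (- (a * - b)) ^ r))"
  proof (rule sum.cong)
    fix r assume "r \<in> {..j}"
    then have r: "r \<le> j" by simp
    \<comment> \<open>The factorial of \<open>r\<close> cancels and the denominator of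
      \<open>beta_value\<close> depends only on \<open>j\<close>; the identity
      \<open>half_coeff_convolution\<close> then applies with \<open>p = a\<close> and
      \<open>q = - b\<close>.\<close>
    have "real (j choose r) * beta_value (j - r) r = fact j / (2 * pochhammer (1/2) (j + 1)) * half_coeff (j - r)"
      using r poch_half_pos[of "j + 1"] by (simp add: beta_value_def half_coeff_def binomial_fact field_simps)
    moreover have "real (j choose r) * real ((j - r) choose r) * (a - b) ^ (j - 2 * r) * (a * b) ^ r * beta_value (j - r) r
       = (real (j choose r) * beta_value (j - r) r) * (real ((j - r) choose r) * (a - b) ^ (j - 2 * r) * (a * b) ^ r)"
      by (simp only: mult_ac)
    ultimately show "real (j choose r) * real ((j - r) choose r) * (a - b) ^ (j - 2 * r) * (a * b) ^ r * beta_value (j - r) r =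
       fact j / (2 * pochhammer (1/2) (j + 1)) * (half_coeff (j - r) * real ((j - r) choose r) * (a + - b) ^ (j - 2 * r) * (- (a * - b)) ^ r)"
      by simp
  qed simp
  also have "\<dots> = moment a b j"
    unfolding sum_distrib_left[symmetric] half_coeff_convolution by (simp add: moment_def)
  finally show "integral {0..1} (g j) = moment a b j" .
qed

lemma moment_swap: "moment (- b) (- a) j = moment a b j"
  unfolding moment_def
  by (rule arg_cong[where f = "\<lambda>x. _ * x"], rule sum.reindex_bij_witness[of _ "\<lambda>i. j - i" "\<lambda>i. j - i"]) (auto simp: mult.commute mult.left_commute)

text \<open>These are the terms of the binomial expansion of a moment of \<open>sphere_law\<close>:
  \<open>beta_value\<close> comes from the height and \<open>half_coeff\<close> from the
  longitude.\<close>

lemma sum_moment_terms: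
  "(\<Sum>i\<le>j. real (j choose i) * (- b) ^ i * a ^ (j - i) * beta_value i (j - i) * half_coeff (j - i)) = moment a b j"
proof -
  have "(\<Sum>i\<le>j. real (j choose i) * (- b) ^ i * a ^ (j - i) * beta_value i (j - i) * half_coeff (j - i))
     = (\<Sum>i\<le>j. fact j / (2 * pochhammer (1/2) (j + 1)) * (half_coeff i * half_coeff (j - i) * (- b) ^ i * a ^ (j - i)))"
    using poch_half_pos[of "j + 1"]
    by (intro sum.cong) (auto simp: beta_value_def half_coeff_def binomial_fact field_simps)
  then show ?thesis unfolding moment_swap[of b a, symmetric] by (simp add: moment_def sum_distrib_left)
qed

section \<open>Distribution of a quadratic form on the sphere\<close>

text \<open>By Weierstrass, \<open>f\<close> is within \<open>e / 4\<close> of a polynomial in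
  \<open>x - c\<close> on the common support, so each integral moves by at most
  \<open>e / 4\<close>; the polynomial part converges because the moments do.\<close>

lemma tendsto_integral_of_moments:
  fixes M :: "'i \<Rightarrow> real measure" and f :: "real \<Rightarrow> real"
  assumes M: "\<And>i. i \<in> I \<Longrightarrow> prob_space (M i)" "\<And>i. i \<in> I \<Longrightarrow> (\<lambda>x. x) \<in> borel_measurable (M i)"
    "\<And>i. i \<in> I \<Longrightarrow> AE x in M i. x \<in> {l..u}"
    and N: "prob_space N" "(\<lambda>x. x) \<in> borel_measurable N" "AE x in N. x \<in> {l..u}"
    and F: "eventually (\<lambda>i. i \<in> I) F"
    and mom: "\<And>j::nat. ((\<lambda>i. \<integral>x. (x - c) ^ j \<partial>M i) \<longlongrightarrow> (\<integral>x. (x - c) ^ j \<partial>N)) F"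
    and f: "continuous_on UNIV f"
  shows "((\<lambda>i. \<integral>x. f x \<partial>M i) \<longlongrightarrow> (\<integral>x. f x \<partial>N)) F"
proof (rule tendstoI)
  fix e :: real assume e: "e > 0"
  have "continuous_on {l - c..u - c} (\<lambda>x. f (x + c))"
    by (intro continuous_intros continuous_on_compose2[OF f]) auto
  then obtain q where q: "real_polynomial_function q" "\<And>x. x \<in> {l - c..u - c} \<Longrightarrow> \<bar>f (x + c) - q x\<bar> < e / 4"
    using Stone_Weierstrass_real_polynomial_function[of "{l - c..u - c}" "\<lambda>x. f (x + c)" "e / 4"] e by auto
  obtain a n where qa: "q = (\<lambda>x. \<Sum>i\<le>n. a i * x ^ i)" using q(1) real_polynomial_function_iff_sum by blast
  have bnd: "integrable K h" if K: "prob_space K" "(\<lambda>x. x) \<in> borel_measurable K" "AE x in K. x \<in> {l..u}"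
    and h: "continuous_on UNIV h" for K and h :: "real \<Rightarrow> real"
  proof -
    interpret prob_space K by fact
    have "compact (h ` {l..u})" by (intro compact_continuous_image continuous_on_subset[OF h]) auto
    then have "bounded (h ` {l..u})" by (rule compact_imp_bounded)
    then obtain B where B: "\<And>x. x \<in> {l..u} \<Longrightarrow> norm (h x) \<le> B"
      unfolding bounded_iff by blast
    have "h \<in> borel_measurable borel" by (rule borel_measurable_continuous_onI[OF h])
    then have "(\<lambda>x. h x) \<in> borel_measurable K" by (rule measurable_compose[OF K(2)])
    then show ?thesis
      using B by (intro integrable_const_bound[where B = B] eventually_mono[OF K(3)]) auto
  qed
  have close: "\<bar>(\<integral>x. f x \<partial>K) - (\<Sum>i\<le>n. a i * (\<integral>x. (x - c) ^ i \<partial>K))\<bar> \<le> e / 4"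
    if K: "prob_space K" "(\<lambda>x. x) \<in> borel_measurable K" "AE x in K. x \<in> {l..u}" for K
  proof -
    interpret prob_space K by fact
    have i: "integrable K (\<lambda>x. (x - c) ^ i)" for i by (intro bnd K continuous_intros)
    have "(\<Sum>i\<le>n. a i * (\<integral>x. (x - c) ^ i \<partial>K)) = (\<integral>x. q (x - c) \<partial>K)"
      unfolding qa using i by simp
    moreover have iq: "integrable K (\<lambda>x. q (x - c))" unfolding qa using i by simp
    moreover have if': "integrable K f" by (intro bnd K f)
    ultimately have "(\<integral>x. f x \<partial>K) - (\<Sum>i\<le>n. a i * (\<integral>x. (x - c) ^ i \<partial>K)) = (\<integral>x. f x - q (x - c) \<partial>K)" by simp
    also have "\<bar>\<dots>\<bar> \<le> (\<integral>x. \<bar>f x - q (x - c)\<bar> \<partial>K)" by (rule integral_abs_bound)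
    also have "\<dots> \<le> (\<integral>x. e / 4 \<partial>K)"
    proof (rule integral_mono_AE)
      show "AE x in K. \<bar>f x - q (x - c)\<bar> \<le> e / 4" using K(3)
      proof eventually_elim
        fix x assume "x \<in> {l..u}"
        then show "\<bar>f x - q (x - c)\<bar> \<le> e / 4" using q(2)[of "x - c"] by auto
      qed
    qed (use iq if' in auto)
    finally show ?thesis by (simp add: prob_space)
  qed
  have "((\<lambda>i. \<Sum>k\<le>n. a k * (\<integral>x. (x - c) ^ k \<partial>M i)) \<longlongrightarrow> (\<Sum>k\<le>n. a k * (\<integral>x. (x - c) ^ k \<partial>N))) F"
    by (intro tendsto_intros mom)
  then have "eventually (\<lambda>i. dist (\<Sum>k\<le>n. a k * (\<integral>x. (x - c) ^ k \<partial>M i)) (\<Sum>k\<le>n. a k * (\<integral>x. (x - c) ^ k \<partial>N)) < e / 4) F"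
    using e by (intro tendstoD) auto
  then show "eventually (\<lambda>i. dist (\<integral>x. f x \<partial>M i) (\<integral>x. f x \<partial>N) < e) F" using F
  proof eventually_elim
    case (elim i)
    have "\<bar>(\<integral>x. f x \<partial>M i) - (\<Sum>k\<le>n. a k * (\<integral>x. (x - c) ^ k \<partial>M i))\<bar> \<le> e / 4"
      using elim by (intro close M)
    then show ?case using close[OF N] elim e unfolding dist_real_def by linarith
  qed
qed

text \<open>The previous lemma for a constant sequence gives equal integrals of continuous
  functions. Applied to cosine and sine, it gives equal characteristic functions.\<close>

lemma real_distribution_eqI_moments:
  assumes M: "real_distribution M" "AE x in M. x \<in> {l..u}"
    and N: "real_distribution N" "AE x in N. x \<in> {l..u}"
    and mom: "\<And>j::nat. (\<integral>x. (x - c) ^ j \<partial>M) = (\<integral>x. (x - c) ^ j \<partial>N)"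
  shows "M = N"
proof (rule Levy_uniqueness[OF M(1) N(1)])
  interpret M: real_distribution M by fact
  interpret N: real_distribution N by fact
  have eq: "(\<integral>x. f x \<partial>M) = (\<integral>x. f x \<partial>N)" if f: "continuous_on UNIV f" for f :: "real \<Rightarrow> real"
  proof -
    have "((\<lambda>i::nat. \<integral>x. f x \<partial>M) \<longlongrightarrow> (\<integral>x. f x \<partial>N)) sequentially"
      by (rule tendsto_integral_of_moments[where I = UNIV and l = l and u = u and c = c])
         (use assms f M.prob_space_axioms N.prob_space_axioms in \<open>auto\<close>)
    then show ?thesis by (simp add: LIMSEQ_const_iff)
  qed
  show "char M = char N"
  proof
    fix t
    have RM: "Re (char M t) = (\<integral>x. cos (t * x) \<partial>M)" "Im (char M t) = (\<integral>x. sin (t * x) \<partial>M)"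
      unfolding char_def using integral_Re[OF M.integrable_iexp[of "\<lambda>x. t * x"]] integral_Im[OF M.integrable_iexp[of "\<lambda>x. t * x"]]
      by (simp_all add: Re_exp Im_exp)
    have RN: "Re (char N t) = (\<integral>x. cos (t * x) \<partial>N)" "Im (char N t) = (\<integral>x. sin (t * x) \<partial>N)"
      unfolding char_def using integral_Re[OF N.integrable_iexp[of "\<lambda>x. t * x"]] integral_Im[OF N.integrable_iexp[of "\<lambda>x. t * x"]]
      by (simp_all add: Re_exp Im_exp)
    show "char M t = char N t"
      by (rule complex_eqI; unfold RM RN; intro eq continuous_intros)
  qed
qed

text \<open>
  The law of \<open>p * u1\<^sup>2 + q0 * u2\<^sup>2 + q1 * u3\<^sup>2\<close> for a uniform point \<open>u\<close> of the unit sphere. By Archimedes the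
  coordinate \<open>z = u1\<close> is uniform and independent of the longitude \<open>t\<close>; by symmetry \<open>z \<le> 0\<close> and
  \<open>0 \<le> t \<le> pi / 2\<close> suffice, and on this range both substitutions below are increasing.
\<close>

definition sphere_law :: "real \<Rightarrow> real \<Rightarrow> real \<Rightarrow> real measure" where
  "sphere_law p q0 q1 = distr (uniform_measure lborel {0..pi/2} \<Otimes>\<^sub>M uniform_measure lborel {-1..0}) borel
     (\<lambda>(t, z). (q0 + (q1 - q0) * (sin t)\<^sup>2) - (q0 + (q1 - q0) * (sin t)\<^sup>2 - p) * z\<^sup>2)"

text \<open>Here \<open>y\<close> is the value of the form on the equator \<open>z = 0\<close> at a
  given longitude, and \<open>s\<close> runs from \<open>p\<close> to \<open>y\<close> along that
  meridian. The constant is \<open>1/2 * 1/2\<close> from the two substitutions, divided by the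
  length \<open>pi / 2\<close> of the longitude range.\<close>

definition sphere_density :: "real \<Rightarrow> real \<Rightarrow> real \<Rightarrow> real \<Rightarrow> ennreal" where
  "sphere_density p q0 q1 s = (\<integral>\<^sup>+y. ennreal (1 / (2 * pi) * (1 / sqrt ((q1 - y) * (y - q0) * (y - p) * (y - s))))
      * indicator {q0..q1} y * indicator {p..y} s \<partial>lborel)"

lemma prob_spaces: "prob_space (uniform_measure lborel {0..pi/2})" "prob_space (uniform_measure lborel {-1..0::real})"
  by (auto intro!: prob_space_uniform_measure simp: emeasure_lborel_Icc_eq)

lemma real_distribution_sphere_law: "real_distribution (sphere_law p q0 q1)"
proof -
  interpret U: prob_space "uniform_measure lborel {0..pi/2}" by (rule prob_spaces)
  interpret V: prob_space "uniform_measure lborel {-1..0::real}" by (rule prob_spaces)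
  interpret pair_prob_space "uniform_measure lborel {0..pi/2}" "uniform_measure lborel {-1..0::real}" ..
  show ?thesis unfolding sphere_law_def by (rule real_distribution_distr) measurable
qed

lemma measurable_sphere_density [measurable]: "sphere_density p q0 q1 \<in> borel_measurable borel"
proof -
  have "(\<lambda>s. \<integral>\<^sup>+y. ennreal (1 / (2 * pi) * (1 / sqrt ((q1 - y) * (y - q0) * (y - p) * (y - s))))
      * indicator {q0..q1} y * (if p \<le> s \<and> s \<le> y then 1 else 0) \<partial>lborel) \<in> borel_measurable borel"
    by measurable
  then show ?thesis unfolding sphere_density_def by (simp add: indicator_def of_bool_def)
qed

lemma sphere_law_eq_density:
  assumes "p < q0" "q0 < q1"
  shows "sphere_law p q0 q1 = density lborel (sphere_density p q0 q1)"
proof (rule measure_eqI)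
  show "sets (sphere_law p q0 q1) = sets (density lborel (sphere_density p q0 q1))" by (simp add: sphere_law_def)
  let ?w = "\<lambda>y s. ennreal (1 / (4 * sqrt ((q1 - y) * (y - q0) * (y - p) * (y - s))))"
  let ?v = "\<lambda>y s. ennreal (1 / (2 * pi) * (1 / sqrt ((q1 - y) * (y - q0) * (y - p) * (y - s))))"
  fix A assume "A \<in> sets (sphere_law p q0 q1)"
  then have A[measurable]: "A \<in> sets borel" by (simp add: sphere_law_def)
  define Y where "Y t = q0 + (q1 - q0) * (sin t)\<^sup>2" for t :: real
  have [measurable]: "Y \<in> borel_measurable borel" unfolding Y_def by measurable
  have Y: "q0 \<le> Y t" for t using assms by (simp add: Y_def)
  interpret V: prob_space "uniform_measure lborel {-1..0::real}" by (rule prob_spaces)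
  define H where "H y = (\<integral>\<^sup>+s. indicator A s * ennreal (1 / (2 * sqrt ((y - s) * (y - p)))) * (if p \<le> s \<and> s \<le> y then 1 else 0) \<partial>lborel)" for y
  have [measurable]: "H \<in> borel_measurable borel" unfolding H_def by measurable
  \<comment> \<open>For \<open>s = y - (y - p) * z^2\<close> and \<open>z < 0\<close>, the Jacobian
    \<open>- 2 * (y - p) * z\<close> equals \<open>2 * sqrt ((y - s) * (y - p))\<close>, the
    reciprocal of the weight in \<open>H\<close>.\<close>
  have inner: "(\<integral>\<^sup>+z. indicator A (y - (y - p) * z\<^sup>2) * indicator {-1..0} z \<partial>lborel) = H y" if y: "q0 \<le> y" for y
  proof -
    define g where "g z = y - (y - p) * z\<^sup>2" for z
    have yp: "y - p > 0" using y assms by simp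
    have "(\<integral>\<^sup>+s. (indicator A s * ennreal (1 / (2 * sqrt ((y - s) * (y - p))))) * indicator {g (-1)..g 0} s \<partial>lborel)
      = (\<integral>\<^sup>+z. (indicator A (g z) * ennreal (1 / (2 * sqrt ((y - g z) * (y - p))))) * ennreal (- 2 * (y - p) * z) * indicator {-1..0} z \<partial>lborel)"
    proof (rule nn_integral_substitution_aux[where g = g and g' = "\<lambda>z. - 2 * (y - p) * z"])
      show "(g has_real_derivative - 2 * (y - p) * z) (at z)" for z
        unfolding g_def[abs_def] by (auto intro!: derivative_eq_intros simp: algebra_simps)
      show "0 \<le> - 2 * (y - p) * z" if "z \<in> {-1..0}" for z
        using that yp by (intro mult_nonpos_nonpos) auto
    qed (auto intro!: continuous_intros)
    also have "\<dots> = (\<integral>\<^sup>+z. indicator A (y - (y - p) * z\<^sup>2) * indicator {-1..0} z \<partial>lborel)"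
    proof (rule nn_integral_cong_AE)
      \<comment> \<open>At \<open>z = 0\<close> the weight is \<open>1 / 0 = 0\<close> and the
        integrands may differ.\<close>
      have "AE z in lborel. z \<noteq> (0::real)" by (rule AE_lborel_singleton)
      then show "AE z in lborel. (indicator A (g z) * ennreal (1 / (2 * sqrt ((y - g z) * (y - p))))) * ennreal (- 2 * (y - p) * z) * indicator {-1..0} z
          = indicator A (y - (y - p) * z\<^sup>2) * indicator {-1..0} z"
      proof eventually_elim
        fix z :: real assume z: "z \<noteq> 0"
        show "(indicator A (g z) * ennreal (1 / (2 * sqrt ((y - g z) * (y - p))))) * ennreal (- 2 * (y - p) * z) * indicator {-1..0} z
          = indicator A (y - (y - p) * z\<^sup>2) * indicator {-1..0} z"
        proof (cases "z \<in> {-1..0}")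
          case True
          then have z0: "z < 0" using z by auto
          define w where "w = (y - p) * (- z)"
          have w: "w > 0" unfolding w_def using yp z0 by (intro mult_pos_pos) auto
          have "(y - g z) * (y - p) = w\<^sup>2" by (simp add: g_def w_def power2_eq_square)
          then have "sqrt ((y - g z) * (y - p)) = w" using w by simp
          moreover have "- 2 * (y - p) * z = 2 * w" by (simp add: w_def algebra_simps)
          ultimately have "ennreal (1 / (2 * sqrt ((y - g z) * (y - p)))) * ennreal (- 2 * (y - p) * z) = ennreal (1 / (2 * w)) * ennreal (2 * w)"
            by (simp only:)
          also have "\<dots> = 1" using w by (subst ennreal_mult[symmetric]) auto
          finally have "ennreal (1 / (2 * sqrt ((y - g z) * (y - p)))) * ennreal (- 2 * (y - p) * z) = 1" .
          then show ?thesis by (simp add: g_def mult.assoc)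
        qed simp
      qed
    qed
    finally show ?thesis by (simp add: H_def g_def indicator_def of_bool_def mult.assoc)
  qed
  have "emeasure (sphere_law p q0 q1) A = (\<integral>\<^sup>+w. indicator A w \<partial>sphere_law p q0 q1)"
    by (simp add: sphere_law_def)
  also have "\<dots> = (\<integral>\<^sup>+w. indicator A (Y (fst w) - (Y (fst w) - p) * (snd w)\<^sup>2) \<partial>(uniform_measure lborel {0..pi/2} \<Otimes>\<^sub>M uniform_measure lborel {-1..0}))"
    unfolding sphere_law_def Y_def by (subst nn_integral_distr) (auto simp: case_prod_beta)
  also have "\<dots> = (\<integral>\<^sup>+t. \<integral>\<^sup>+z. indicator A (Y t - (Y t - p) * z\<^sup>2) \<partial>uniform_measure lborel {-1..0} \<partial>uniform_measure lborel {0..pi/2})"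
    by (subst V.nn_integral_fst[symmetric]) auto
  also have "\<dots> = (\<integral>\<^sup>+t. H (Y t) \<partial>uniform_measure lborel {0..pi/2})"
  proof (rule nn_integral_cong)
    fix t :: real
    show "(\<integral>\<^sup>+z. indicator A (Y t - (Y t - p) * z\<^sup>2) \<partial>uniform_measure lborel {-1..0}) = H (Y t)"
      by (subst nn_integral_uniform_measure) (auto simp: inner Y divide_ennreal_def)
  qed
  also have "\<dots> = (\<integral>\<^sup>+t. H (Y t) * indicator {0..pi/2} t \<partial>lborel) / ennreal (pi / 2)"
    by (subst nn_integral_uniform_measure) auto
  also have "(\<integral>\<^sup>+t. H (Y t) * indicator {0..pi/2} t \<partial>lborel) =
    (\<integral>\<^sup>+t. (H (Y t) * ennreal (1 / (2 * sqrt ((q1 - Y t) * (Y t - q0))))) * ennreal (2 * (q1 - q0) * sin t * cos t) * indicator {0..pi/2} t \<partial>lborel)"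
  proof (rule nn_integral_cong_AE)
    \<comment> \<open>The same device for the longitude: \<open>(q1 - Y t) * (Y t - q0)\<close> is
      the square of half the derivative of \<open>Y\<close>, which vanishes at the two
      endpoints.\<close>
    have "AE t in lborel. t \<noteq> (0::real) \<and> t \<noteq> pi/2" using AE_lborel_singleton[of 0] AE_lborel_singleton[of "pi/2"] by auto
    then show "AE t in lborel. H (Y t) * indicator {0..pi/2} t = (H (Y t) * ennreal (1 / (2 * sqrt ((q1 - Y t) * (Y t - q0))))) * ennreal (2 * (q1 - q0) * sin t * cos t) * indicator {0..pi/2} t"
    proof eventually_elim
      fix t :: real assume t: "t \<noteq> 0 \<and> t \<noteq> pi/2"
      show "H (Y t) * indicator {0..pi/2} t = (H (Y t) * ennreal (1 / (2 * sqrt ((q1 - Y t) * (Y t - q0))))) * ennreal (2 * (q1 - q0) * sin t * cos t) * indicator {0..pi/2} t"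
      proof (cases "t \<in> {0..pi/2}")
        case True
        then have s: "sin t > 0" "cos t > 0" using t by (auto intro!: sin_gt_zero cos_gt_zero)
        have "q1 - Y t = (q1 - q0) * (cos t)\<^sup>2" by (simp add: Y_def cos_squared_eq algebra_simps)
        then have "(q1 - Y t) * (Y t - q0) = ((q1 - q0) * sin t * cos t)\<^sup>2" by (simp add: Y_def power2_eq_square)
        then have "sqrt ((q1 - Y t) * (Y t - q0)) = (q1 - q0) * sin t * cos t" using assms s by (simp add: abs_mult)
        then have "ennreal (1 / (2 * sqrt ((q1 - Y t) * (Y t - q0)))) * ennreal (2 * (q1 - q0) * sin t * cos t) = 1"
          using assms s by (subst ennreal_mult[symmetric]) auto
        then show ?thesis by (simp add: mult.assoc)
      qed simp
    qed
  qed
  also have "\<dots> = (\<integral>\<^sup>+y. (H y * ennreal (1 / (2 * sqrt ((q1 - y) * (y - q0))))) * indicator {Y 0..Y (pi/2)} y \<partial>lborel)"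
    by (rule nn_integral_substitution_aux[where g = Y and g' = "\<lambda>t. 2 * (q1 - q0) * sin t * cos t", symmetric])
       (use assms in \<open>auto simp: Y_def[abs_def] intro!: derivative_eq_intros continuous_intros mult_nonneg_nonneg sin_ge_zero cos_ge_zero\<close>)
  also have "\<dots> = (\<integral>\<^sup>+y. \<integral>\<^sup>+s. indicator A s * ?w y s
      * (if q0 \<le> y \<and> y \<le> q1 then 1 else 0) * (if p \<le> s \<and> s \<le> y then 1 else 0) \<partial>lborel \<partial>lborel)"
  proof (rule nn_integral_cong)
    fix y :: real
    have "(H y * ennreal (1 / (2 * sqrt ((q1 - y) * (y - q0))))) * indicator {Y 0..Y (pi/2)} y
      = (\<integral>\<^sup>+s. (indicator A s * ennreal (1 / (2 * sqrt ((y - s) * (y - p)))) * (if p \<le> s \<and> s \<le> y then 1 else 0)) * (ennreal (1 / (2 * sqrt ((q1 - y) * (y - q0)))) * indicator {Y 0..Y (pi/2)} y) \<partial>lborel)"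
      unfolding H_def mult.assoc by (subst nn_integral_multc[symmetric]) (auto simp: mult.assoc)
    also have "\<dots> = (\<integral>\<^sup>+s. indicator A s * ?w y s
      * (if q0 \<le> y \<and> y \<le> q1 then 1 else 0) * (if p \<le> s \<and> s \<le> y then 1 else 0) \<partial>lborel)"
    proof (rule nn_integral_cong)
      fix s :: real
      show "(indicator A s * ennreal (1 / (2 * sqrt ((y - s) * (y - p)))) * (if p \<le> s \<and> s \<le> y then 1 else 0)) * (ennreal (1 / (2 * sqrt ((q1 - y) * (y - q0)))) * indicator {Y 0..Y (pi/2)} y)
        = indicator A s * ?w y s
      * (if q0 \<le> y \<and> y \<le> q1 then 1 else 0) * (if p \<le> s \<and> s \<le> y then 1 else 0)"
      proof (cases "q0 \<le> y \<and> y \<le> q1 \<and> p \<le> s \<and> s \<le> y")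
        case True
        have "ennreal (1 / (2 * sqrt ((y - s) * (y - p)))) * ennreal (1 / (2 * sqrt ((q1 - y) * (y - q0)))) = ?w y s"
          using True assms by (subst ennreal_mult[symmetric]) (auto simp: real_sqrt_mult mult_ac)
        then show ?thesis using True by (simp add: Y_def mult.assoc)
      qed (auto simp: Y_def indicator_def)
    qed
    finally show "(H y * ennreal (1 / (2 * sqrt ((q1 - y) * (y - q0))))) * indicator {Y 0..Y (pi/2)} y = \<dots>" .
  qed
  also have "\<dots> = (\<integral>\<^sup>+s. \<integral>\<^sup>+y. indicator A s * ?w y s
      * (if q0 \<le> y \<and> y \<le> q1 then 1 else 0) * (if p \<le> s \<and> s \<le> y then 1 else 0) \<partial>lborel \<partial>lborel)"
    \<comment> \<open>Integrating over \<open>y\<close> first exposes the density in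
      \<open>s\<close>.\<close>
    by (rule lborel_pair.Fubini') measurable
  also have "\<dots> / ennreal (pi / 2) = (\<integral>\<^sup>+s. (\<integral>\<^sup>+y. indicator A s * ?w y s
      * (if q0 \<le> y \<and> y \<le> q1 then 1 else 0) * (if p \<le> s \<and> s \<le> y then 1 else 0) \<partial>lborel) / ennreal (pi / 2) \<partial>lborel)"
    by (rule nn_integral_divide[symmetric]) measurable
  also have "\<dots> = (\<integral>\<^sup>+s. sphere_density p q0 q1 s * indicator A s \<partial>lborel)"
  proof (rule nn_integral_cong)
    fix s :: real
    have "(\<integral>\<^sup>+y. indicator A s * ?w y s
      * (if q0 \<le> y \<and> y \<le> q1 then 1 else 0) * (if p \<le> s \<and> s \<le> y then 1 else 0) \<partial>lborel) / ennreal (pi / 2)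
      = (\<integral>\<^sup>+y. (?w y s
      * (if q0 \<le> y \<and> y \<le> q1 then 1 else 0) * (if p \<le> s \<and> s \<le> y then 1 else 0)) * (inverse (ennreal (pi / 2)) * indicator A s) \<partial>lborel)"
      by (subst nn_integral_multc) (auto simp: divide_ennreal_def mult_ac nn_integral_cmult)
    also have "\<dots> = (\<integral>\<^sup>+y. (?v y s
      * indicator {q0..q1} y * indicator {p..y} s) * indicator A s \<partial>lborel)"
    proof (rule nn_integral_cong)
      fix y :: real
      show "(?w y s
      * (if q0 \<le> y \<and> y \<le> q1 then 1 else 0) * (if p \<le> s \<and> s \<le> y then 1 else 0)) * (inverse (ennreal (pi / 2)) * indicator A s)
        = (?v y s
      * indicator {q0..q1} y * indicator {p..y} s) * indicator A s"
      proof (cases "q0 \<le> y \<and> y \<le> q1 \<and> p \<le> s \<and> s \<le> y")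
        case True
        then have "(q1 - y) * (y - q0) * (y - p) * (y - s) \<ge> 0" using assms by (intro mult_nonneg_nonneg) auto
        then have "?w y s * inverse (ennreal (pi / 2)) = 
          ?v y s"
          by (subst inverse_ennreal) (auto simp: ennreal_mult[symmetric] field_simps)
        then show ?thesis using True by (simp add: mult_ac)
      qed (auto simp: indicator_def)
    qed
    also have "\<dots> = sphere_density p q0 q1 s * indicator A s"
      unfolding sphere_density_def
      by (rule nn_integral_multc) (simp add: indicator_def of_bool_def)
    finally show "(\<integral>\<^sup>+y. indicator A s * ?w y s
      * (if q0 \<le> y \<and> y \<le> q1 then 1 else 0) * (if p \<le> s \<and> s \<le> y then 1 else 0) \<partial>lborel) / ennreal (pi / 2) = \<dots>" .
  qed
  also have "\<dots> = emeasure (density lborel (sphere_density p q0 q1)) A"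
    by (subst emeasure_density) auto
  finally show "emeasure (sphere_law p q0 q1) A = emeasure (density lborel (sphere_density p q0 q1)) A" .
qed

lemma sphere_density_outside:
  assumes "s \<notin> {p..q1}"
  shows "sphere_density p q0 q1 s = 0"
proof -
  have "sphere_density p q0 q1 s = (\<integral>\<^sup>+(y::real). 0 \<partial>lborel)"
    unfolding sphere_density_def using assms by (intro nn_integral_cong) (auto simp: indicator_def)
  then show ?thesis by simp
qed

lemma AE_sphere_law:
  assumes "p < q0" "q0 < q1"
  shows "AE s in sphere_law p q0 q1. s \<in> {p..q1}"
proof -
  have "s \<in> {p..q1}" if "0 < sphere_density p q0 q1 s" for s
    using sphere_density_outside[of s p q1 q0] that by (metis less_irrefl)
  then show ?thesis
    unfolding sphere_law_eq_density[OF assms] by (subst AE_density) auto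
qed

section \<open>Moments and reflection of the sphere law\<close>

lemma integral_uniform_Icc:
  fixes h :: "real \<Rightarrow> real"
  assumes h: "continuous_on UNIV h" "(h has_integral I) {l..u}" and lu: "l < u"
  shows "integrable (uniform_measure lborel {l..u}) h \<and> (\<integral>x. h x \<partial>uniform_measure lborel {l..u}) = I / (u - l)"
proof -
  have [measurable]: "h \<in> borel_measurable borel" by (rule borel_measurable_continuous_onI[OF h(1)])
  have dens: "uniform_measure lborel {l..u} = density lborel (\<lambda>x. ennreal (indicator {l..u} x / (u - l)))"
    unfolding uniform_measure_def using lu
    by (intro density_cong) (auto simp: indicator_def divide_ennreal[symmetric] of_bool_def)
  have si: "set_integrable lborel {l..u} h"
    by (intro borel_integrable_atLeastAtMost' continuous_on_subset[OF h(1)]) simp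
  have eq: "(\<lambda>x. (indicator {l..u} x / (u - l)) *\<^sub>R h x) = (\<lambda>x. (1 / (u - l)) *\<^sub>R (indicator {l..u} x *\<^sub>R h x))" by auto
  have "(\<integral>x. indicator {l..u} x *\<^sub>R h x \<partial>lborel) = I"
    using set_borel_integral_eq_integral[OF si] h(2) by (simp add: set_lebesgue_integral_def integral_unique)
  then have "(\<integral>x. (indicator {l..u} x / (u - l)) *\<^sub>R h x \<partial>lborel) = I / (u - l)"
    unfolding eq by simp
  moreover have "integrable lborel (\<lambda>x. (indicator {l..u} x / (u - l)) *\<^sub>R h x)"
    unfolding eq using si by (simp add: set_integrable_def)
  ultimately show ?thesis
    unfolding dens using lu by (simp add: integral_density integrable_density)
qed

lemma integral_pair_mult:
  fixes f :: "'a \<Rightarrow> real" and g :: "'b \<Rightarrow> real"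
  assumes "prob_space U" "prob_space V" and f: "integrable U f" and g: "integrable V g"
  shows "integrable (U \<Otimes>\<^sub>M V) (\<lambda>(x, y). f x * g y) \<and>
    (\<integral>w. (case w of (x, y) \<Rightarrow> f x * g y) \<partial>(U \<Otimes>\<^sub>M V)) = (\<integral>x. f x \<partial>U) * (\<integral>y. g y \<partial>V)"
proof -
  interpret U: prob_space U by fact
  interpret V: prob_space V by fact
  interpret pair_prob_space U V ..
  have int: "integrable (U \<Otimes>\<^sub>M V) (\<lambda>(x, y). f x * g y)"
  proof (rule Fubini_integrable)
    show "(\<lambda>(x, y). f x * g y) \<in> borel_measurable (U \<Otimes>\<^sub>M V)"
      using f g by measurable
    have "integrable U (\<lambda>x. norm (f x) * (\<integral>y. norm (g y) \<partial>V))" using f by simp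
    then show "integrable U (\<lambda>x. \<integral>y. norm (case (x, y) of (x, y) \<Rightarrow> f x * g y) \<partial>V)"
      by (simp add: abs_mult)
    show "AE x in U. integrable V (\<lambda>y. case (x, y) of (x, y) \<Rightarrow> f x * g y)" using g by simp
  qed
  moreover have "(\<integral>w. (case w of (x, y) \<Rightarrow> f x * g y) \<partial>(U \<Otimes>\<^sub>M V)) = (\<integral>x. f x \<partial>U) * (\<integral>y. g y \<partial>V)"
    using integral_fst'[OF int] by simp
  ultimately show ?thesis by simp
qed

text \<open>Centred at \<open>q0\<close>, the form is
  \<open>- b * z^2 + a * (sin t)^2 * (1 - z^2)\<close>; the binomial theorem separates the
  independent variables into Wallis and Beta integrals.\<close>

lemma integral_sphere_law_moment:
  "(\<integral>s. (s - q0) ^ j \<partial>sphere_law p q0 q1) = moment (q1 - q0) (q0 - p) j"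
proof -
  let ?U = "uniform_measure lborel {0..pi/2}" and ?V = "uniform_measure lborel {-1..0::real}"
  define a b where "a = q1 - q0" and "b = q0 - p"
  define f where "f i t = (sin t) ^ (2 * (j - i))" for i and t :: real
  define g where "g i z = z ^ (2 * i) * (1 - z\<^sup>2) ^ (j - i)" for i and z :: real
  have f: "integrable ?U (f i) \<and> (\<integral>t. f i t \<partial>?U) = half_coeff (j - i)" for i
  proof -
    have "integrable ?U (f i) \<and> (\<integral>t. f i t \<partial>?U) = (pi / 2 * half_coeff (j - i)) / (pi/2 - 0)"
      unfolding f_def by (intro integral_uniform_Icc continuous_intros has_integral_sin_power) simp
    then show ?thesis by simp
  qed
  have g: "integrable ?V (g i) \<and> (\<integral>t. g i t \<partial>?V) = beta_value i (j - i)" for i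
  proof -
    have "((\<lambda>z. g i (- z)) has_integral beta_value i (j - i)) {- 1..- 0}"
      using has_integral_beta[of i "j - i"] by (subst has_integral_reflect_real) (simp add: g_def[abs_def])
    then have "(g i has_integral beta_value i (j - i)) {-1..0}" by (simp add: g_def[abs_def])
    then have "integrable ?V (g i) \<and> (\<integral>t. g i t \<partial>?V) = beta_value i (j - i) / (0 - (-1))"
      by (intro integral_uniform_Icc) (auto simp: g_def intro!: continuous_intros)
    then show ?thesis by simp
  qed
  have fg: "integrable (?U \<Otimes>\<^sub>M ?V) (\<lambda>(t, z). f i t * g i z) \<and>
    (\<integral>w. (case w of (t, z) \<Rightarrow> f i t * g i z) \<partial>(?U \<Otimes>\<^sub>M ?V)) = half_coeff (j - i) * beta_value i (j - i)" for i
    using integral_pair_mult[OF prob_spaces, of "f i" "g i"] f g by simp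
  have "(\<integral>s. (s - q0) ^ j \<partial>sphere_law p q0 q1) = (\<integral>w. (case w of (t, z) \<Rightarrow> ((q0 + (q1 - q0) * (sin t)\<^sup>2) - (q0 + (q1 - q0) * (sin t)\<^sup>2 - p) * z\<^sup>2 - q0) ^ j) \<partial>(?U \<Otimes>\<^sub>M ?V))"
    unfolding sphere_law_def by (subst integral_distr) (auto simp: case_prod_beta')
  also have "\<dots> = (\<integral>w. (\<Sum>i\<le>j. (real (j choose i) * (- b) ^ i * a ^ (j - i)) * (case w of (t, z) \<Rightarrow> f i t * g i z)) \<partial>(?U \<Otimes>\<^sub>M ?V))"
  proof (rule Bochner_Integration.integral_cong)
    fix w :: "real \<times> real"
    obtain t z where w: "w = (t, z)" by (cases w)
    have eq: "(q0 + (q1 - q0) * (sin t)\<^sup>2) - (q0 + (q1 - q0) * (sin t)\<^sup>2 - p) * z\<^sup>2 - q0 = (- b) * z\<^sup>2 + a * ((sin t)\<^sup>2 * (1 - z\<^sup>2))"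
      by (simp add: a_def b_def algebra_simps)
    show "(case w of (t, z) \<Rightarrow> ((q0 + (q1 - q0) * (sin t)\<^sup>2) - (q0 + (q1 - q0) * (sin t)\<^sup>2 - p) * z\<^sup>2 - q0) ^ j) =
      (\<Sum>i\<le>j. (real (j choose i) * (- b) ^ i * a ^ (j - i)) * (case w of (t, z) \<Rightarrow> f i t * g i z))"
      unfolding w prod.case eq binomial_ring
    proof (rule sum.cong)
      fix i assume "i \<in> {..j}"
      have "(- b * z\<^sup>2) ^ i = (- b) ^ i * z ^ (2 * i)" by (simp only: power_mult_distrib power_mult)
      moreover have "(a * ((sin t)\<^sup>2 * (1 - z\<^sup>2))) ^ (j - i) = a ^ (j - i) * (sin t ^ (2 * (j - i)) * (1 - z\<^sup>2) ^ (j - i))"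
        by (simp only: power_mult_distrib power_mult)
      ultimately show "real (j choose i) * (- b * z\<^sup>2) ^ i * (a * ((sin t)\<^sup>2 * (1 - z\<^sup>2))) ^ (j - i)
        = real (j choose i) * (- b) ^ i * a ^ (j - i) * (f i t * g i z)"
        by (simp only: f_def g_def mult_ac)
    qed simp
  qed simp
  also have "\<dots> = (\<Sum>i\<le>j. (real (j choose i) * (- b) ^ i * a ^ (j - i)) * (half_coeff (j - i) * beta_value i (j - i)))"
    using fg by (subst Bochner_Integration.integral_sum) auto
  also have "\<dots> = moment a b j" by (subst sum_moment_terms[symmetric]) (simp add: mult_ac)
  finally show ?thesis by (simp add: a_def b_def)
qed

text \<open>After negation, the form on the left is the form on the right with the first and third
  axes interchanged. Instead of rotation invariance the proof compares moments: reflection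
  multiplies the \<open>j\<close>-th moment by the \<open>j\<close>-th power of -1 and interchanges
  the two gaps.\<close>

lemma sphere_law_reflect:
  assumes "e3 < e2" "e2 < e1"
  shows "distr (sphere_law (- e1) (- e2) (- e3)) borel uminus = sphere_law e3 e2 e1"
proof (rule real_distribution_eqI_moments[where l = e3 and u = e1 and c = e2])
  interpret L: real_distribution "sphere_law (- e1) (- e2) (- e3)" by (rule real_distribution_sphere_law)
  have m: "uminus \<in> measurable (sphere_law (- e1) (- e2) (- e3)) borel" by measurable
  show "real_distribution (distr (sphere_law (- e1) (- e2) (- e3)) borel uminus)" using m by simp
  show "real_distribution (sphere_law e3 e2 e1)" by (rule real_distribution_sphere_law)
  show "AE x in sphere_law e3 e2 e1. x \<in> {e3..e1}" using assms by (intro AE_sphere_law)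
  have "AE x in sphere_law (- e1) (- e2) (- e3). x \<in> {- e1..- e3}" using assms by (intro AE_sphere_law) auto
  then have "AE x in sphere_law (- e1) (- e2) (- e3). - x \<in> {e3..e1}" by eventually_elim auto
  then show "AE x in distr (sphere_law (- e1) (- e2) (- e3)) borel uminus. x \<in> {e3..e1}"
    by (subst AE_distr_iff[OF m]) auto
  fix j :: nat
  have "(\<integral>x. (x - e2) ^ j \<partial>distr (sphere_law (- e1) (- e2) (- e3)) borel uminus) = (\<integral>x. (- x - e2) ^ j \<partial>sphere_law (- e1) (- e2) (- e3))"
    by (subst integral_distr[OF m]) auto
  also have "\<dots> = (\<integral>x. (- 1) ^ j * (x - (- e2)) ^ j \<partial>sphere_law (- e1) (- e2) (- e3))"
    by (simp add: power_mult_distrib[symmetric])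
  also have "\<dots> = (- 1) ^ j * moment (e2 - e3) (e1 - e2) j"
    using integral_sphere_law_moment[where ?q0.0 = "- e2" and p = "- e1" and ?q1.0 = "- e3" and j = j] by simp
  also have "\<dots> = moment (- (e2 - e3)) (- (e1 - e2)) j"
  proof -
    have "(\<Sum>i\<le>j. half_coeff i * half_coeff (j - i) * (- x) ^ i * (- (- y)) ^ (j - i)) =
      (- 1) ^ j * (\<Sum>i\<le>j. half_coeff i * half_coeff (j - i) * x ^ i * (- y) ^ (j - i))" for x y :: real
      unfolding sum_distrib_left
    proof (rule sum.cong)
      fix i assume "i \<in> {..j}"
      then have "(- 1 :: real) ^ j = (- 1) ^ i * (- 1) ^ (j - i)" by (simp add: power_add[symmetric])
      then show "half_coeff i * half_coeff (j - i) * (- x) ^ i * (- (- y)) ^ (j - i) = (- 1) ^ j * (half_coeff i * half_coeff (j - i) * x ^ i * (- y) ^ (j - i))"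
        using power_mult_distrib[of "-1" x i] power_mult_distrib[of "-1" "-y" "j - i"] by (simp add: mult_ac)
    qed simp
    from this[of "e2 - e3" "e1 - e2"] show ?thesis unfolding moment_def by (simp only: mult_ac)
  qed
  also have "\<dots> = moment (e1 - e2) (e2 - e3) j" by (rule moment_swap)
  finally show "(\<integral>x. (x - e2) ^ j \<partial>distr (sphere_law (- e1) (- e2) (- e3)) borel uminus) = (\<integral>x. (x - e2) ^ j \<partial>sphere_law e3 e2 e1)"
    by (simp add: integral_sphere_law_moment)
qed

section \<open>Identification of the sphere density with \<open>rho_Q\<close>\<close>

text \<open>The Bochner integral in \<open>rho_Q\<close> is 0 by convention for a non-integrable
  integrand, so it can stand for the nonnegative integral only where the latter is finite.\<close>

lemma ennreal_set_lebesgue_integral: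
  fixes h :: "real \<Rightarrow> real"
  assumes [measurable]: "h \<in> borel_measurable borel" "A \<in> sets borel" and energy_unit: "\<And>x. x \<in> A \<Longrightarrow> h x \<ge> 0" and c: "c \<ge> 0"
    and eq: "r = (\<integral>\<^sup>+x. ennreal (c * h x) * indicator A x \<partial>lborel)" and fin: "r < \<infinity>"
  shows "r = ennreal (c * (LINT x:A|lborel. h x))"
proof -
  have r: "r = (\<integral>\<^sup>+x. ennreal (c * (indicator A x * h x)) \<partial>lborel)"
    unfolding eq by (intro nn_integral_cong) (auto simp: indicator_def)
  have nonneg: "c * (indicator A x * h x) \<ge> 0" for x using energy_unit c by (auto simp: indicator_def)
  have "integrable lborel (\<lambda>x. c * (indicator A x * h x))"
    using fin nonneg unfolding r by (intro integrableI_nonneg) auto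
  then have "r = ennreal (\<integral>x. c * (indicator A x * h x) \<partial>lborel)"
    unfolding r using nonneg by (intro nn_integral_eq_integral) auto
  then show ?thesis by (simp add: set_lebesgue_integral_def)
qed

text \<open>For \<open>s\<close> below \<open>e 2\<close> the cutoff at \<open>s\<close> is
  automatic on \<open>{e 2..e 1}\<close>, so the inner integral has the full range required by
  \<open>rho_Q\<close>.\<close>

lemma sphere_density_eq_rho_Q_lower:
  assumes "e 3 < e 2" "e 2 < e 1" "e 3 < s" "s < e 2" "sphere_density (e 3) (e 2) (e 1) s < \<infinity>"
  shows "sphere_density (e 3) (e 2) (e 1) s = ennreal (rho_Q e s)"
proof -
  have "sphere_density (e 3) (e 2) (e 1) s = ennreal (1 / (2 * pi) * (LINT x:{e 2..e 1}|lborel. 1 / sqrt ((e 1 - x) * (x - e 2) * (x - e 3) * (x - s))))"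
  proof (rule ennreal_set_lebesgue_integral)
    show "sphere_density (e 3) (e 2) (e 1) s = (\<integral>\<^sup>+x. ennreal (1 / (2 * pi) * (1 / sqrt ((e 1 - x) * (x - e 2) * (x - e 3) * (x - s)))) * indicator {e 2..e 1} x \<partial>lborel)"
      unfolding sphere_density_def using assms by (intro nn_integral_cong) (auto simp: indicator_def)
    show "1 / sqrt ((e 1 - x) * (x - e 2) * (x - e 3) * (x - s)) \<ge> 0" if "x \<in> {e 2..e 1}" for x
      using that assms by (auto intro!: mult_nonneg_nonneg)
  qed (use assms in auto)
  then show ?thesis using assms by (simp add: rho_Q_def)
qed

text \<open>The mirror image: for \<open>s\<close> above \<open>e 2\<close> the cutoff is automatic
  in the reflected slicing, and the substitution of \<open>- x\<close> for \<open>y\<close> restores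
  the range \<open>{e 3..e 2}\<close>.\<close>

lemma sphere_density_eq_rho_Q_upper:
  assumes "e 3 < e 2" "e 2 < e 1" "e 2 < s" "s < e 1" "sphere_density (- e 1) (- e 2) (- e 3) (- s) < \<infinity>"
  shows "sphere_density (- e 1) (- e 2) (- e 3) (- s) = ennreal (rho_Q e s)"
proof -
  have "sphere_density (- e 1) (- e 2) (- e 3) (- s) = ennreal (1 / (2 * pi) * (LINT x:{e 3..e 2}|lborel. 1 / sqrt ((e 1 - x) * (e 2 - x) * (x - e 3) * (s - x))))"
  proof (rule ennreal_set_lebesgue_integral)
    have "sphere_density (- e 1) (- e 2) (- e 3) (- s) = (\<integral>\<^sup>+y. ennreal (1 / (2 * pi) * (1 / sqrt ((- e 3 - y) * (y + e 2) * (y + e 1) * (y + s)))) * (if - e 2 \<le> y \<and> y \<le> - e 3 then 1 else 0) \<partial>lborel)"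
      unfolding sphere_density_def using assms by (intro nn_integral_cong) (auto simp: indicator_def)
    also have "\<dots> = (\<integral>\<^sup>+x. ennreal (1 / (2 * pi) * (1 / sqrt ((- e 3 + x) * (- x + e 2) * (- x + e 1) * (- x + s)))) * (if - e 2 \<le> - x \<and> - x \<le> - e 3 then 1 else 0) \<partial>lborel)"
      by (subst nn_integral_real_affine[where c = "-1" and t = 0]) auto
    also have "\<dots> = (\<integral>\<^sup>+x. ennreal (1 / (2 * pi) * (1 / sqrt ((e 1 - x) * (e 2 - x) * (x - e 3) * (s - x)))) * indicator {e 3..e 2} x \<partial>lborel)"
      by (intro nn_integral_cong) (auto simp: indicator_def mult_ac)
    finally show "sphere_density (- e 1) (- e 2) (- e 3) (- s) = (\<integral>\<^sup>+x. ennreal (1 / (2 * pi) * (1 / sqrt ((e 1 - x) * (e 2 - x) * (x - e 3) * (s - x)))) * indicator {e 3..e 2} x \<partial>lborel)" .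
    show "1 / sqrt ((e 1 - x) * (e 2 - x) * (x - e 3) * (s - x)) \<ge> 0" if "x \<in> {e 3..e 2}" for x
      using that assms by (auto intro!: mult_nonneg_nonneg)
  qed (use assms in auto)
  then show ?thesis using assms by (simp add: rho_Q_def)
qed

text \<open>The density integrates to 1; this replaces any estimate of elliptic integrals.\<close>

lemma AE_sphere_density_finite:
  assumes "p < q0" "q0 < q1"
  shows "AE s in lborel. sphere_density p q0 q1 s < \<infinity>"
proof -
  interpret real_distribution "sphere_law p q0 q1" by (rule real_distribution_sphere_law)
  have "(\<integral>\<^sup>+s. sphere_density p q0 q1 s \<partial>lborel) = emeasure (sphere_law p q0 q1) UNIV"
    unfolding sphere_law_eq_density[OF assms] by (subst emeasure_density) auto
  then have "(\<integral>\<^sup>+s. sphere_density p q0 q1 s \<partial>lborel) \<noteq> \<infinity>" using emeasure_space_1 by simp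
  then have "AE s in lborel. sphere_density p q0 q1 s \<noteq> \<infinity>" by (intro nn_integral_PInf_AE) auto
  then show ?thesis by (simp add: less_top)
qed

text \<open>Two densities of the same law agree almost everywhere, so either may be used at a given
  \<open>s\<close>: the direct one below \<open>e 2\<close>, the reflected one above.\<close>

lemma sphere_law_eq_density_rho_Q:
  assumes "e 3 < e 2" "e 2 < e 1"
  shows "sphere_law (e 3) (e 2) (e 1) = density lborel (\<lambda>s. ennreal (rho_Q e s))"
    and "rho_Q e \<in> borel_measurable borel"
proof -
  have m: "(\<lambda>s. sphere_density (- e 1) (- e 2) (- e 3) (- s)) \<in> borel_measurable borel"
    by measurable
  have "sphere_law (e 3) (e 2) (e 1) = distr (sphere_law (- e 1) (- e 2) (- e 3)) borel uminus"
    by (rule sphere_law_reflect[OF assms, symmetric])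
  also have "\<dots> = density lborel (\<lambda>s. sphere_density (- e 1) (- e 2) (- e 3) (- s))"
  proof (rule measure_eqI)
    fix A assume "A \<in> sets (distr (sphere_law (- e 1) (- e 2) (- e 3)) borel uminus)"
    then have A[measurable]: "A \<in> sets borel" by simp
    have L: "sphere_law (- e 1) (- e 2) (- e 3) = density lborel (sphere_density (- e 1) (- e 2) (- e 3))"
      using assms by (intro sphere_law_eq_density) auto
    have "emeasure (distr (sphere_law (- e 1) (- e 2) (- e 3)) borel uminus) A = (\<integral>\<^sup>+s. indicator A s \<partial>distr (sphere_law (- e 1) (- e 2) (- e 3)) borel uminus)"
      by simp
    also have "\<dots> = (\<integral>\<^sup>+s. indicator A (- s) \<partial>sphere_law (- e 1) (- e 2) (- e 3))"
      by (subst nn_integral_distr) (auto simp: sphere_law_def)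
    also have "\<dots> = (\<integral>\<^sup>+s. sphere_density (- e 1) (- e 2) (- e 3) s * indicator A (- s) \<partial>lborel)"
      unfolding L by (subst nn_integral_density) auto
    also have "\<dots> = (\<integral>\<^sup>+s. sphere_density (- e 1) (- e 2) (- e 3) (- s) * indicator A s \<partial>lborel)"
      by (subst nn_integral_real_affine[where c = "-1" and t = 0]) auto
    also have "\<dots> = emeasure (density lborel (\<lambda>s. sphere_density (- e 1) (- e 2) (- e 3) (- s))) A"
      by (subst emeasure_density) (use m in auto)
    finally show "emeasure (distr (sphere_law (- e 1) (- e 2) (- e 3)) borel uminus) A = \<dots>" .
  qed simp
  finally have "density lborel (sphere_density (e 3) (e 2) (e 1)) = density lborel (\<lambda>s. sphere_density (- e 1) (- e 2) (- e 3) (- s))"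
    unfolding sphere_law_eq_density[OF assms] .
  then have AE1: "AE s in lborel. sphere_density (e 3) (e 2) (e 1) s = sphere_density (- e 1) (- e 2) (- e 3) (- s)"
    using m by (intro sigma_finite_measure.density_unique[OF sigma_finite_lborel]) auto
  have "AE s in lborel. sphere_density (e 3) (e 2) (e 1) s = ennreal (rho_Q e s)"
    using AE1 AE_sphere_density_finite[OF assms] AE_lborel_singleton[of "e 1"] AE_lborel_singleton[of "e 2"] AE_lborel_singleton[of "e 3"]
  proof eventually_elim
    case (elim s)
    consider "s < e 3" | "e 3 < s" "s < e 2" | "e 2 < s" "s < e 1" | "e 1 < s" using elim by linarith
    then show ?case
    proof cases
      case 1
      then show ?thesis using assms by (subst sphere_density_outside) (auto simp: rho_Q_def)
    next
      case 2
      then show ?thesis using assms elim by (intro sphere_density_eq_rho_Q_lower)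
    next
      case 3
      then show ?thesis using assms elim sphere_density_eq_rho_Q_upper[of e s] by simp
    next
      case 4
      then show ?thesis using assms by (subst sphere_density_outside) (auto simp: rho_Q_def)
    qed
  qed
  moreover show "rho_Q e \<in> borel_measurable borel"
    unfolding rho_Q_def[abs_def] set_lebesgue_integral_def by measurable
  ultimately show "sphere_law (e 3) (e 2) (e 1) = density lborel (\<lambda>s. ennreal (rho_Q e s))"
    unfolding sphere_law_eq_density[OF assms] by (intro density_cong) auto
qed

lemma integral_mu_Q:
  fixes f :: "complex \<Rightarrow> real"
  assumes "e 3 < e 2" "e 2 < e 1" and f: "continuous_on UNIV f"
  shows "(\<integral>z. f z \<partial>mu_Q e) = (\<integral>s. f (complex_of_real s) \<partial>sphere_law (e 3) (e 2) (e 1))"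
proof -
  have "f \<in> borel_measurable borel" using f by (rule borel_measurable_continuous_onI)
  then show ?thesis
    unfolding mu_Q_def sphere_law_eq_density_rho_Q(1)[OF assms(1,2), symmetric]
    by (subst integral_distr) (auto simp: sphere_law_def)
qed

section \<open>From the Lame equation to a three-term recurrence\<close>

lemma atLeastAtMost_1_3: "{1..3::nat} = {1, 2, 3}" by auto

lemma lame_exponents_values:
  assumes "\<kappa> \<in> lame_exponents"
  shows "\<kappa> 1 \<in> {0, 1/2}" "\<kappa> 2 \<in> {0, 1/2}" "\<kappa> 3 \<in> {0, 1/2}"
  using assms by (auto simp: PiE_iff)

lemma lame_exponents_squares:
  assumes "\<kappa> \<in> lame_exponents"
  shows "\<kappa> 1 * \<kappa> 1 = \<kappa> 1 / 2" "\<kappa> 2 * \<kappa> 2 = \<kappa> 2 / 2" "\<kappa> 3 * \<kappa> 3 = \<kappa> 3 / 2"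
proof -
  have "x * x = x / 2" if "x \<in> {0, 1/2}" for x :: real using that by auto
  then show "\<kappa> 1 * \<kappa> 1 = \<kappa> 1 / 2" "\<kappa> 2 * \<kappa> 2 = \<kappa> 2 / 2" "\<kappa> 3 * \<kappa> 3 = \<kappa> 3 / 2"
    using lame_exponents_values[OF assms] by auto
qed

definition "half_count \<kappa> = card {i\<in>{1..3::nat}. \<kappa> i = (1/2::real)}"

lemma half_count_eq:
  assumes "\<kappa> \<in> lame_exponents"
  shows "real (half_count \<kappa>) = 2 * (\<kappa> 1 + \<kappa> 2 + \<kappa> 3)"
proof -
  have "half_count \<kappa> = (\<Sum>i\<in>{1,2,3}. if \<kappa> i = 1/2 then 1 else 0)"
    unfolding half_count_def atLeastAtMost_1_3 by (simp add: sum.If_cases Int_def)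
  then show ?thesis using lame_exponents_values[OF assms] by auto
qed

text \<open>After the prefactor is removed and the equation is multiplied by four times the cubic,
  \<open>ode_A \<kappa> i\<close> multiplies the product of the two linear factors other than
  \<open>i\<close> in the first-order term, and \<open>ode_B \<kappa> i j\<close> the one remaining
  factor in the zeroth-order term.\<close>

definition "ode_A \<kappa> i = 8 * \<kappa> i + (2::real)" for \<kappa> :: "nat \<Rightarrow> real" and i
definition "ode_B \<kappa> i j = 8 * \<kappa> i * \<kappa> j + 2 * \<kappa> i + 2 * (\<kappa> j::real)" for \<kappa> :: "nat \<Rightarrow> real" and i j
definition "energy_unit n = real n * (real n + 1)"

text \<open>
  In the variable \<open>w = z - e 2\<close>, the operator with eigenvalue \<open>E\<close> sends \<open>w ^ k\<close> to
  \<open>U k * w ^ (k + 1) + D k * w ^ k + V k * w ^ (k - 1)\<close>, up to the shift of \<open>E\<close> by \<open>n (n + 1) * e 2\<close>.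
\<close>

definition lame_U :: "nat \<Rightarrow> (nat \<Rightarrow> real) \<Rightarrow> real \<Rightarrow> real" where
  "lame_U n \<kappa> x = 4 * x * (x - 1) + (ode_A \<kappa> 1 + ode_A \<kappa> 2 + ode_A \<kappa> 3) * x + (ode_B \<kappa> 1 2 + ode_B \<kappa> 1 3 + ode_B \<kappa> 2 3) - energy_unit n"
definition lame_D :: "(nat \<Rightarrow> real) \<Rightarrow> (nat \<Rightarrow> real) \<Rightarrow> real \<Rightarrow> real" where
  "lame_D e \<kappa> x = (let a = e 1 - e 2; b = e 2 - e 3 in 4 * (b - a) * x * (x - 1)
     + (ode_A \<kappa> 1 * b + ode_A \<kappa> 2 * (b - a) - ode_A \<kappa> 3 * a) * x + (ode_B \<kappa> 1 2 * b - ode_B \<kappa> 2 3 * a))"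
definition lame_V :: "(nat \<Rightarrow> real) \<Rightarrow> (nat \<Rightarrow> real) \<Rightarrow> real \<Rightarrow> real" where
  "lame_V e \<kappa> x = - ((e 1 - e 2) * (e 2 - e 3) * (4 * x * (x - 1) + ode_A \<kappa> 2 * x))"

text \<open>
  The Lame operator applied to \<open>lame_prefactor e \<kappa> z * poly q (z - e 2)\<close>, divided by the prefactor and
  multiplied by \<open>4 (z - e 1) (z - e 2) (z - e 3)\<close>. All poles cancel because \<open>\<kappa> i * (\<kappa> i - 1/2) = 0\<close>.
\<close>

definition lame_op :: "(nat \<Rightarrow> real) \<Rightarrow> nat \<Rightarrow> (nat \<Rightarrow> real) \<Rightarrow> complex \<Rightarrow> complex poly \<Rightarrow> complex poly" where
  "lame_op e n \<kappa> E q = (let a = e 1 - e 2; b = e 2 - e 3 in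
     [:0, of_real (- 4 * a * b), of_real (4 * (b - a)), 4:] * pderiv (pderiv q)
   + [:of_real (- ode_A \<kappa> 2 * a * b), of_real (ode_A \<kappa> 1 * b + ode_A \<kappa> 2 * (b - a) - ode_A \<kappa> 3 * a), of_real (ode_A \<kappa> 1 + ode_A \<kappa> 2 + ode_A \<kappa> 3):] * pderiv q
   + [:of_real (ode_B \<kappa> 1 2 * b - ode_B \<kappa> 2 3 * a) - (E + of_real (energy_unit n * e 2)), of_real (ode_B \<kappa> 1 2 + ode_B \<kappa> 1 3 + ode_B \<kappa> 2 3 - energy_unit n):] * q)"

lemma coeff_lame_op:
  "coeff (lame_op e n \<kappa> E q) k = (if k = 0 then 0 else of_real (lame_U n \<kappa> (real k - 1)) * coeff q (k - 1))
    + (of_real (lame_D e \<kappa> (real k)) - (E + of_real (energy_unit n * e 2))) * coeff q k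
    + of_real (lame_V e \<kappa> (real k + 1)) * coeff q (k + 1)"
proof -
  consider "k = 0" | "k = 1" | "k = 2" | i where "k = Suc (Suc (Suc i))"
    by (metis One_nat_def Suc_1 not0_implies_Suc)
  then show ?thesis
    by cases (simp_all add: lame_op_def Let_def lame_U_def lame_D_def lame_V_def coeff_pderiv coeff_pCons numeral_2_eq_2 algebra_simps)
qed

definition lame_prefactor :: "(nat \<Rightarrow> real) \<Rightarrow> (nat \<Rightarrow> real) \<Rightarrow> complex \<Rightarrow> complex" where
  "lame_prefactor e \<kappa> z = (\<Prod>i\<in>{1..3}. (z - complex_of_real (e i)) powr complex_of_real (\<kappa> i))"

definition log_deriv :: "(nat \<Rightarrow> real) \<Rightarrow> (nat \<Rightarrow> real) \<Rightarrow> complex \<Rightarrow> complex" where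
  "log_deriv e \<kappa> z = (\<Sum>i\<in>{1..3}. complex_of_real (\<kappa> i) / (z - complex_of_real (e i)))"

lemma slit_domain_nz: "z \<in> slit_domain e \<Longrightarrow> i \<in> {1..3} \<Longrightarrow> z - complex_of_real (e i) \<noteq> 0"
  unfolding slit_domain_def using nonpos_Reals_zero_I by (metis (mono_tags, lifting) mem_Collect_eq)

lemma open_slit_domain: "open (slit_domain e)"
proof -
  have "slit_domain e = (\<Inter>i\<in>{1..3}. (\<lambda>z. z - complex_of_real (e i)) -` (- \<real>\<^sub>\<le>\<^sub>0))"
    by (auto simp: slit_domain_def)
  also have "open \<dots>"
    by (intro open_INT ballI open_vimage continuous_intros) (auto simp: open_Compl)
  finally show ?thesis .
qed

lemma lame_prefactor_nz: "z \<in> slit_domain e \<Longrightarrow> lame_prefactor e \<kappa> z \<noteq> 0"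
  using slit_domain_nz[of z e] by (simp add: lame_prefactor_def)

lemma has_field_derivative_mult3:
  fixes f g h :: "complex \<Rightarrow> complex"
  assumes "(f has_field_derivative f z * a) (at z)" "(g has_field_derivative g z * b) (at z)" "(h has_field_derivative h z * c) (at z)"
  shows "((\<lambda>z. f z * (g z * h z)) has_field_derivative f z * (g z * h z) * (a + (b + c))) (at z)"
  using assms by (auto intro!: derivative_eq_intros simp: algebra_simps)

lemma has_field_derivative_lame_prefactor:
  assumes "z \<in> slit_domain e"
  shows "(lame_prefactor e \<kappa> has_field_derivative lame_prefactor e \<kappa> z * log_deriv e \<kappa> z) (at z)"
proof -
  have 1: "((\<lambda>z. (z - complex_of_real (e i)) powr complex_of_real (\<kappa> i)) has_field_derivative
      (z - complex_of_real (e i)) powr complex_of_real (\<kappa> i) * (complex_of_real (\<kappa> i) / (z - complex_of_real (e i)))) (at z)"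
    if "i \<in> {1..3}" for i
  proof -
    have ns: "z - complex_of_real (e i) \<notin> \<real>\<^sub>\<le>\<^sub>0" using assms that by (auto simp: slit_domain_def)
    have nz: "z - complex_of_real (e i) \<noteq> 0" using slit_domain_nz assms that by blast
    have "((\<lambda>z. (z - complex_of_real (e i)) powr complex_of_real (\<kappa> i)) has_field_derivative
      (complex_of_real (\<kappa> i) * (z - complex_of_real (e i)) powr (complex_of_real (\<kappa> i) - 1)) * (1 - 0)) (at z)"
      by (rule DERIV_chain2[where f = "\<lambda>x. x powr complex_of_real (\<kappa> i)" and g = "\<lambda>z. z - complex_of_real (e i)",
            OF has_field_derivative_powr[OF ns]]) (auto intro!: derivative_eq_intros)
    then show ?thesis using nz by (simp add: powr_diff mult_ac)
  qed
  show ?thesis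
    unfolding lame_prefactor_def[abs_def] log_deriv_def atLeastAtMost_1_3
    using has_field_derivative_mult3[OF 1[of 1] 1[of 2] 1[of 3]] by simp
qed

lemma has_field_derivative_log_deriv:
  assumes "z \<in> slit_domain e"
  shows "(log_deriv e \<kappa> has_field_derivative - (\<Sum>i\<in>{1..3}. complex_of_real (\<kappa> i) / (z - complex_of_real (e i))\<^sup>2)) (at z)"
proof -
  have 1: "((\<lambda>z. complex_of_real (\<kappa> i) / (z - complex_of_real (e i))) has_field_derivative
      - (complex_of_real (\<kappa> i) / (z - complex_of_real (e i))\<^sup>2)) (at z)"
    if "i \<in> {1..3}" for i
    using slit_domain_nz[OF assms that] by (auto intro!: derivative_eq_intros simp: power2_eq_square)
  show ?thesis unfolding log_deriv_def[abs_def] sum_negf[symmetric] by (intro DERIV_sum 1)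
qed

definition shifted :: "(nat \<Rightarrow> real) \<Rightarrow> complex poly \<Rightarrow> complex poly" where
  "shifted e q = q \<circ>\<^sub>p [:- complex_of_real (e 2), 1:]"

lemma poly_shifted [simp]: "poly (shifted e q) z = poly q (z - complex_of_real (e 2))"
  by (simp add: shifted_def poly_pcompose)

lemma has_field_derivative_poly_diff:
  "((\<lambda>z. poly q (z - c)) has_field_derivative poly (pderiv q) (z - c)) (at (z::complex))"
  using DERIV_chain'[of "\<lambda>z. z - c" 1 z UNIV "poly q" "poly (pderiv q) (z - c)"]
  by (auto intro!: derivative_eq_intros poly_DERIV)

lemma lame_form_derivs:
  fixes e n \<kappa> E q
  defines "S \<equiv> lame_form e \<kappa> (shifted e q)"
  defines "w \<equiv> \<lambda>z. z - complex_of_real (e 2)"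
  defines "\<phi> \<equiv> log_deriv e \<kappa>" and "F \<equiv> lame_prefactor e \<kappa>"
  defines "S1 \<equiv> \<lambda>z. F z * (\<phi> z * poly q (w z) + poly (pderiv q) (w z))"
  defines "S2 \<equiv> \<lambda>z. F z * ((\<phi> z ^ 2 - (\<Sum>i\<in>{1..3}. complex_of_real (\<kappa> i) / (z - complex_of_real (e i))\<^sup>2)) * poly q (w z)
      + 2 * \<phi> z * poly (pderiv q) (w z) + poly (pderiv (pderiv q)) (w z))"
  assumes z: "z \<in> slit_domain e"
  shows "(S has_field_derivative S1 z) (at z)" "(S1 has_field_derivative S2 z) (at z)"
proof -
  have S: "S = (\<lambda>z. F z * poly q (w z))" by (simp add: S_def lame_form_def F_def lame_prefactor_def fun_eq_iff w_def)
  note D = has_field_derivative_lame_prefactor[OF z, of \<kappa>, folded F_def \<phi>_def]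
    has_field_derivative_log_deriv[OF z, of \<kappa>, folded \<phi>_def] has_field_derivative_poly_diff[of q "complex_of_real (e 2)" z, folded w_def]
    has_field_derivative_poly_diff[of "pderiv q" "complex_of_real (e 2)" z, folded w_def]
  show "(S has_field_derivative S1 z) (at z)"
    unfolding S S1_def by (auto intro!: derivative_eq_intros D simp: w_def algebra_simps)
  show "(S1 has_field_derivative S2 z) (at z)"
    unfolding S1_def S2_def by (auto intro!: derivative_eq_intros D simp: w_def algebra_simps power2_eq_square)
qed

lemma lame_operator_eq:
  assumes \<kappa>: "\<kappa> \<in> lame_exponents" and z: "z \<in> slit_domain e"
  shows "lame_operator e n E (lame_form e \<kappa> (shifted e q)) z =
    lame_prefactor e \<kappa> z * poly (lame_op e n \<kappa> E q) (z - complex_of_real (e 2))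
      / (4 * (\<Prod>i\<in>{1..3}. z - complex_of_real (e i)))"
proof -
  define S where "S = lame_form e \<kappa> (shifted e q)"
  define w where "w z = z - complex_of_real (e 2)" for z
  define S1 where "S1 z = lame_prefactor e \<kappa> z * (log_deriv e \<kappa> z * poly q (w z) + poly (pderiv q) (w z))" for z
  define S2 where "S2 z = lame_prefactor e \<kappa> z * ((log_deriv e \<kappa> z ^ 2 - (\<Sum>i\<in>{1..3}. complex_of_real (\<kappa> i) / (z - complex_of_real (e i))\<^sup>2)) * poly q (w z)
      + 2 * log_deriv e \<kappa> z * poly (pderiv q) (w z) + poly (pderiv (pderiv q)) (w z))" for z
  have d1: "(S has_field_derivative S1 x) (at x)" and d2: "(S1 has_field_derivative S2 x) (at x)" if "x \<in> slit_domain e" for x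
    using lame_form_derivs[OF that, of \<kappa> q] by (simp_all add: S_def S1_def[abs_def] S2_def w_def)
  have dS: "deriv S x = S1 x" if "x \<in> slit_domain e" for x using d1[OF that] by (rule DERIV_imp_deriv)
  have "eventually (\<lambda>x. x \<in> slit_domain e) (nhds z)" using open_slit_domain z by (rule eventually_nhds_in_open)
  then have "eventually (\<lambda>x. deriv S x = S1 x) (nhds z)" by eventually_elim (rule dS)
  then have "deriv (deriv S) z = deriv S1 z" by (intro deriv_cong_ev) auto
  then have ddS: "deriv (deriv S) z = S2 z" using DERIV_imp_deriv[OF d2[OF z]] by simp
  have Sz: "S z = lame_prefactor e \<kappa> z * poly q (w z)" by (simp add: S_def lame_form_def lame_prefactor_def w_def)
  define z1 z2 z3 where "z1 = z - complex_of_real (e 1)" and "z2 = z - complex_of_real (e 2)" and "z3 = z - complex_of_real (e 3)"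
  have nz: "z1 \<noteq> 0" "z2 \<noteq> 0" "z3 \<noteq> 0" using slit_domain_nz[OF z] by (auto simp: z1_def z2_def z3_def)
  define k1 k2 k3 where "k1 = complex_of_real (\<kappa> 1)" and "k2 = complex_of_real (\<kappa> 2)" and "k3 = complex_of_real (\<kappa> 3)"
  have k: "k1 * k1 = k1 / 2" "k2 * k2 = k2 / 2" "k3 * k3 = k3 / 2"
    unfolding k1_def k2_def k3_def of_real_mult[symmetric] lame_exponents_squares[OF \<kappa>] by simp_all
  define \<phi> where "\<phi> = k1 / z1 + k2 / z2 + k3 / z3"
  define \<psi> where "\<psi> = (1 / z1 + 1 / z2 + 1 / z3) / 2"
  define X where "X = k1 / z1\<^sup>2 + k2 / z2\<^sup>2 + k3 / z3\<^sup>2"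
  define Q where "Q = z1 * z2 * z3"
  have i1: "4 * Q * (2 * \<phi> + \<psi>) = (8 * k1 + 2) * z2 * z3 + (8 * k2 + 2) * z1 * z3 + (8 * k3 + 2) * z1 * z2"
    using nz by (simp add: \<phi>_def \<psi>_def Q_def field_simps)
  have ks: "k1\<^sup>2 = k1 / 2" "k2\<^sup>2 = k2 / 2" "k3\<^sup>2 = k3 / 2" using k by (simp_all add: power2_eq_square)
  \<comment> \<open>The double poles carry the factors \<open>k^2 - k / 2\<close>, the indicial
    polynomial at each singularity, which vanishes at the exponents 0 and 1/2.\<close>
  have "\<phi>\<^sup>2 - X + \<psi> * \<phi> = (k1\<^sup>2 - k1 / 2) / z1\<^sup>2 + (k2\<^sup>2 - k2 / 2) / z2\<^sup>2 + (k3\<^sup>2 - k3 / 2) / z3\<^sup>2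
      + ((2 * k1 * k2 + k1 / 2 + k2 / 2) / (z1 * z2) + (2 * k1 * k3 + k1 / 2 + k3 / 2) / (z1 * z3) + (2 * k2 * k3 + k2 / 2 + k3 / 2) / (z2 * z3))"
    unfolding \<phi>_def \<psi>_def X_def power2_eq_square using nz by (simp add: field_simps)
  then have i2: "4 * Q * (\<phi>\<^sup>2 - X + \<psi> * \<phi>) = (8 * k1 * k2 + 2 * k1 + 2 * k2) * z3 + (8 * k1 * k3 + 2 * k1 + 2 * k3) * z2 + (8 * k2 * k3 + 2 * k2 + 2 * k3) * z1"
  proof -
    assume *: "\<phi>\<^sup>2 - X + \<psi> * \<phi> = (k1\<^sup>2 - k1 / 2) / z1\<^sup>2 + (k2\<^sup>2 - k2 / 2) / z2\<^sup>2 + (k3\<^sup>2 - k3 / 2) / z3\<^sup>2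
      + ((2 * k1 * k2 + k1 / 2 + k2 / 2) / (z1 * z2) + (2 * k1 * k3 + k1 / 2 + k3 / 2) / (z1 * z3) + (2 * k2 * k3 + k2 / 2 + k3 / 2) / (z2 * z3))"
    show ?thesis unfolding * unfolding ks Q_def using nz by (simp add: field_simps)
  qed
  define q0 q1 q2 where "q0 = poly q (w z)" and "q1 = poly (pderiv q) (w z)" and "q2 = poly (pderiv (pderiv q)) (w z)"
  define C where "C = of_nat (n * (n + 1)) * z + E"
  have op: "poly (lame_op e n \<kappa> E q) (w z) = 4 * Q * q2 + ((8 * k1 + 2) * z2 * z3 + (8 * k2 + 2) * z1 * z3 + (8 * k3 + 2) * z1 * z2) * q1
     + ((8 * k1 * k2 + 2 * k1 + 2 * k2) * z3 + (8 * k1 * k3 + 2 * k1 + 2 * k3) * z2 + (8 * k2 * k3 + 2 * k2 + 2 * k3) * z1 - C) * q0"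
    unfolding q0_def[symmetric] q1_def[symmetric] q2_def[symmetric]
    by (simp add: lame_op_def Let_def q0_def[symmetric] q1_def[symmetric] q2_def[symmetric])
       (simp add: w_def ode_A_def ode_B_def energy_unit_def Q_def C_def z1_def z2_def z3_def k1_def k2_def k3_def algebra_simps)
  have ld: "log_deriv e \<kappa> z = \<phi>"
    by (simp add: log_deriv_def atLeastAtMost_1_3 \<phi>_def k1_def k2_def k3_def z1_def z2_def z3_def del: One_nat_def)
  have sX: "(\<Sum>i\<in>{1..3}. complex_of_real (\<kappa> i) / (z - complex_of_real (e i))\<^sup>2) = X"
    by (simp add: atLeastAtMost_1_3 X_def k1_def k2_def k3_def z1_def z2_def z3_def del: One_nat_def)
  have ps: "1/2 * (\<Sum>i\<in>{1..3}. 1 / (z - complex_of_real (e i))) = \<psi>"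
    by (simp add: atLeastAtMost_1_3 \<psi>_def z1_def z2_def z3_def add.assoc add_divide_distrib del: One_nat_def)
  have Qp: "(\<Prod>i\<in>{1..3}. z - complex_of_real (e i)) = Q"
    by (simp add: atLeastAtMost_1_3 Q_def z1_def z2_def z3_def mult.assoc del: One_nat_def)
  have Lop: "lame_operator e n E S z = lame_prefactor e \<kappa> z * ((\<phi>\<^sup>2 - X) * q0 + 2 * \<phi> * q1 + q2 + \<psi> * (\<phi> * q0 + q1) - C / (4 * Q) * q0)"
    unfolding lame_operator_def ddS dS[OF z] Sz S1_def S2_def ld sX ps Qp C_def[symmetric]
      q0_def[symmetric] q1_def[symmetric] q2_def[symmetric]
    by (simp add: algebra_simps)
  have Q0: "Q \<noteq> 0" using nz by (simp add: Q_def)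
  have "((\<phi>\<^sup>2 - X) * q0 + 2 * \<phi> * q1 + q2 + \<psi> * (\<phi> * q0 + q1) - C / (4 * Q) * q0)
     = (4 * Q * q2 + (4 * Q * (2 * \<phi> + \<psi>)) * q1 + (4 * Q * (\<phi>\<^sup>2 - X + \<psi> * \<phi>) - C) * q0) / (4 * Q)"
    using Q0 by (simp add: field_simps)
  also have "\<dots> = poly (lame_op e n \<kappa> E q) (w z) / (4 * Q)" unfolding i1 i2 op ..
  finally show ?thesis unfolding S_def[symmetric] Lop Qp by (simp add: w_def)
qed

lemma half_plane_in_slit_domain:
  assumes "e 3 < e 2" "e 2 < e 1" "Re z > e 1"
  shows "z \<in> slit_domain e"
  unfolding slit_domain_def
proof (intro CollectI ballI)
  fix i :: nat assume "i \<in> {1..3}"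
  then have "e i \<le> e 1" using assms unfolding atLeastAtMost_1_3 by auto
  then show "z - complex_of_real (e i) \<notin> \<real>\<^sub>\<le>\<^sub>0" using assms(3) by (simp add: complex_nonpos_Reals_iff)
qed

lemma poly_eq_0_half_plane:
  assumes "\<And>z. Re z > r \<Longrightarrow> poly p (z - c) = (0::complex)"
  shows "p = 0"
proof (rule ccontr)
  assume "p \<noteq> 0"
  then have "finite {x. poly p x = 0}" by (rule poly_roots_finite)
  moreover have "(\<lambda>k. complex_of_real (r + 1 + real k) - c) ` UNIV \<subseteq> {x. poly p x = 0}"
    using assms by auto
  moreover have "infinite ((\<lambda>k::nat. complex_of_real (r + 1 + real k) - c) ` UNIV)"
    by (intro range_inj_infinite injI) (auto simp del: of_real_add)
  ultimately show False using infinite_super by blast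
qed

text \<open>Prefactor and cubic do not vanish on the slit domain, which contains a half plane; there
  the differential equation becomes a polynomial identity.\<close>

lemma has_lame_solution_iff:
  assumes e: "e 3 < e 2" "e 2 < e 1" and \<kappa>: "\<kappa> \<in> lame_exponents"
  shows "has_lame_solution e n \<kappa> E \<longleftrightarrow> (\<exists>q. q \<noteq> 0 \<and> lame_op e n \<kappa> E q = 0)"
proof -
  have iff: "(\<forall>z\<in>slit_domain e. lame_operator e n E (lame_form e \<kappa> (shifted e q)) z = 0) \<longleftrightarrow> lame_op e n \<kappa> E q = 0" for q
  proof
    assume *: "\<forall>z\<in>slit_domain e. lame_operator e n E (lame_form e \<kappa> (shifted e q)) z = 0"
    show "lame_op e n \<kappa> E q = 0"
    proof (rule poly_eq_0_half_plane[where r = "e 1" and c = "complex_of_real (e 2)"])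
      fix z assume "Re z > e 1"
      then have z: "z \<in> slit_domain e" using e by (intro half_plane_in_slit_domain)
      then have "lame_prefactor e \<kappa> z * poly (lame_op e n \<kappa> E q) (z - complex_of_real (e 2)) / (4 * (\<Prod>i\<in>{1..3}. z - complex_of_real (e i))) = 0"
        using * lame_operator_eq[OF \<kappa> z, of n E q] by metis
      moreover have "(\<Prod>i\<in>{1..3}. z - complex_of_real (e i)) \<noteq> 0"
        using slit_domain_nz[OF z] by (subst prod_zero_iff) auto
      ultimately show "poly (lame_op e n \<kappa> E q) (z - complex_of_real (e 2)) = 0"
        using lame_prefactor_nz[OF z, of \<kappa>] unfolding divide_eq_0_iff mult_eq_0_iff by auto
    qed
  next
    assume "lame_op e n \<kappa> E q = 0"
    then show "\<forall>z\<in>slit_domain e. lame_operator e n E (lame_form e \<kappa> (shifted e q)) z = 0"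
      using lame_operator_eq[OF \<kappa>] by simp
  qed
  have hol: "lame_form e \<kappa> (shifted e q) holomorphic_on slit_domain e" for q
    unfolding holomorphic_on_open[OF open_slit_domain] using lame_form_derivs(1) by blast
  have sh: "\<exists>q. p = shifted e q" for p
  proof
    show "p = shifted e (p \<circ>\<^sub>p [:complex_of_real (e 2), 1:])"
      by (simp add: shifted_def pcompose_assoc[symmetric] pcompose_pCons)
  qed
  have sh0: "shifted e q = 0 \<longleftrightarrow> q = 0" for q
    unfolding shifted_def by (subst pcompose_eq_0_iff) auto
  show ?thesis unfolding has_lame_solution_def using iff hol sh sh0 by metis
qed

text \<open>Entries for the eigenvalue \<open>t\<close> with
  \<open>E = - n (n + 1) * (e 2 + t)\<close>; \<open>lame_offdiag\<close> at \<open>k\<close> is the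
  product of the two entries that couple the powers \<open>k - 1\<close> and
  \<open>k\<close>.\<close>

definition lame_diag :: "(nat \<Rightarrow> real) \<Rightarrow> nat \<Rightarrow> (nat \<Rightarrow> real) \<Rightarrow> int \<Rightarrow> real" where
  "lame_diag e n \<kappa> k = - lame_D e \<kappa> (real_of_int k) / energy_unit n"
definition lame_offdiag :: "(nat \<Rightarrow> real) \<Rightarrow> nat \<Rightarrow> (nat \<Rightarrow> real) \<Rightarrow> int \<Rightarrow> real" where
  "lame_offdiag e n \<kappa> k = lame_U n \<kappa> (real_of_int k - 1) * lame_V e \<kappa> (real_of_int k) / (energy_unit n)\<^sup>2"

text \<open>The factorization locates the zero of the up-weight at
  \<open>x = (n - half_count) / 2\<close>, the only possible degree of the polynomial
  factor.\<close>

lemma lame_U_eq: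
  assumes "\<kappa> \<in> lame_exponents"
  shows "lame_U n \<kappa> x = (2 * x + half_count \<kappa> - n) * (2 * x + half_count \<kappa> + n + 1)"
proof -
  have sq: "\<kappa> 1 * \<kappa> 1 = \<kappa> 1 / 2" "\<kappa> 2 * \<kappa> 2 = \<kappa> 2 / 2" "\<kappa> 3 * \<kappa> 3 = \<kappa> 3 / 2"
    by (rule lame_exponents_squares[OF assms])+
  have "(2 * x + half_count \<kappa> - n) * (2 * x + half_count \<kappa> + n + 1) - lame_U n \<kappa> x
      = 2 * ((2 * (\<kappa> 1 * \<kappa> 1) - \<kappa> 1) + (2 * (\<kappa> 2 * \<kappa> 2) - \<kappa> 2) + (2 * (\<kappa> 3 * \<kappa> 3) - \<kappa> 3))"
    unfolding half_count_eq[OF assms] lame_U_def ode_A_def ode_B_def energy_unit_def by (simp add: algebra_simps)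
  then show ?thesis unfolding sq by simp
qed

lemma energy_unit_pos: "n > 0 \<Longrightarrow> energy_unit n > 0" by (simp add: energy_unit_def)

lemma lame_V_neg:
  assumes "e 3 < e 2" "e 2 < e 1" "\<kappa> \<in> lame_exponents" "x \<ge> 1"
  shows "lame_V e \<kappa> x < 0"
proof -
  have "ode_A \<kappa> 2 > 0" using lame_exponents_values[OF assms(3)] by (auto simp: ode_A_def)
  then have "4 * x * (x - 1) + ode_A \<kappa> 2 * x > 0" using assms(4) by (intro add_nonneg_pos) auto
  then show ?thesis using assms by (simp add: lame_V_def)
qed

text \<open>Below the top degree \<open>U\<close> is negative. \<open>V\<close> is negative because
  the cubic has linear coefficient \<open>- (e 1 - e 2) * (e 2 - e 3)\<close> at \<open>e 2\<close>;
  at \<open>e 1\<close> or \<open>e 3\<close> that coefficient would be positive and the products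
  negative. The matrix ends at row \<open>N\<close> because \<open>U\<close> vanishes there.\<close>

lemma jacobi_lame:
  assumes e: "e 3 < e 2" "e 2 < e 1" and \<kappa>: "\<kappa> \<in> lame_exponents" and n: "n = 2 * N + half_count \<kappa>" "n > 0"
  shows "jacobi (lame_offdiag e n \<kappa>) N"
proof
  fix k assume k: "0 < k" "k \<le> int N"
  then have r: "real_of_int k \<ge> 1" "real_of_int k \<le> real N" by linarith+
  have "lame_U n \<kappa> (real_of_int k - 1) < 0"
    unfolding lame_U_eq[OF \<kappa>] using n r by (intro mult_neg_pos) auto
  then show "0 < lame_offdiag e n \<kappa> k"
    unfolding lame_offdiag_def using lame_V_neg[OF e \<kappa> r(1)] energy_unit_pos[OF n(2)] by (auto intro!: divide_pos_pos mult_neg_neg)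
next
  show "lame_offdiag e n \<kappa> 0 = 0" by (simp add: lame_offdiag_def lame_V_def)
  show "lame_offdiag e n \<kappa> (int N + 1) = 0" unfolding lame_offdiag_def lame_U_eq[OF \<kappa>] using n by simp
qed

lemma lame_eigenvalue_iff:
  assumes e: "e 3 < e 2" "e 2 < e 1" and \<kappa>: "\<kappa> \<in> lame_exponents" and n: "n > 0"
  shows "(\<exists>q. q \<noteq> 0 \<and> lame_op e n \<kappa> (- of_real (energy_unit n) * (of_real (e 2) + t)) q = 0) \<longleftrightarrow>
     (\<exists>N. n = 2 * N + half_count \<kappa> \<and> poly (jacobi_poly (lame_diag e n \<kappa>) (lame_offdiag e n \<kappa>) (Suc N)) t = 0)"
proof -
  define E where "E = - complex_of_real (energy_unit n) * (of_real (e 2) + t)"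
  define v where "v k = - lame_V e \<kappa> (real k) / energy_unit n" for k :: nat
  have v: "v (Suc k) > 0" for k using lame_V_neg[OF e \<kappa>, of "real (Suc k)"] energy_unit_pos[OF n] by (simp add: v_def divide_neg_pos)
  \<comment> \<open>Weighting the \<open>k\<close>-th coefficient of \<open>q\<close> by the first
    \<open>k\<close> down-weights turns its recurrence into the monic one of
    \<open>jacobi_poly\<close>.\<close>
  define vp where "vp k = (\<Prod>i<k. complex_of_real (v (Suc i)))" for k
  have vp_nz: "vp k \<noteq> 0" for k unfolding vp_def using v by (auto simp: less_le)
  define P where "P k = poly (jacobi_poly (lame_diag e n \<kappa>) (lame_offdiag e n \<kappa>) k) t" for k
  have nn0: "complex_of_real (energy_unit n) \<noteq> 0" using energy_unit_pos[OF n] by simp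
  have ET: "E + of_real (energy_unit n * e 2) = - of_real (energy_unit n) * t" by (simp add: E_def algebra_simps)
  have Prec0: "P (Suc 0) = (t - of_real (lame_diag e n \<kappa> 0)) * P 0" by (simp add: P_def)
  have Prec: "P (Suc (Suc k)) = (t - of_real (lame_diag e n \<kappa> (int k + 1))) * P (Suc k) - of_real (lame_offdiag e n \<kappa> (int k + 1)) * P k" for k
    by (simp add: P_def algebra_simps)
  have rec: "coeff (lame_op e n \<kappa> E q) k * vp k * (- 1 / of_real (energy_unit n)) =
     vp (Suc k) * coeff q (Suc k) - (t - of_real (lame_diag e n \<kappa> (int k))) * (vp k * coeff q k)
      + (if k = 0 then 0 else of_real (lame_offdiag e n \<kappa> (int k)) * (vp (k - 1) * coeff q (k - 1)))" for q k
  proof (cases k)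
    case 0
    then show ?thesis using nn0 unfolding coeff_lame_op ET
      by (simp add: vp_def v_def lame_diag_def) (simp add: field_simps)
  next
    case (Suc i)
    then show ?thesis using nn0 unfolding coeff_lame_op ET
      by (simp add: vp_def v_def lame_diag_def lame_offdiag_def power2_eq_square) (simp add: field_simps)
  qed
  have zero_iff: "lame_op e n \<kappa> E q = 0 \<longleftrightarrow> (\<forall>k. vp (Suc k) * coeff q (Suc k) - (t - of_real (lame_diag e n \<kappa> (int k))) * (vp k * coeff q k)
      + (if k = 0 then 0 else of_real (lame_offdiag e n \<kappa> (int k)) * (vp (k - 1) * coeff q (k - 1))) = 0)" for q
    unfolding rec[symmetric] using vp_nz nn0 by (simp add: poly_eq_iff)
  show ?thesis unfolding E_def[symmetric] P_def[symmetric]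
  proof
    assume "\<exists>q. q \<noteq> 0 \<and> lame_op e n \<kappa> E q = 0"
    then obtain q where q: "q \<noteq> 0" "lame_op e n \<kappa> E q = 0" by blast
    define N where "N = degree q"
    \<comment> \<open>One place above the degree of \<open>q\<close> only the \<open>U\<close> term
      survives, which ties \<open>n\<close> to that degree.\<close>
    have "coeff (lame_op e n \<kappa> E q) (Suc N) = 0" by (simp add: q)
    then have "of_real (lame_U n \<kappa> (real N)) * coeff q N = 0"
      unfolding coeff_lame_op by (simp add: N_def coeff_eq_0)
    moreover have "coeff q N \<noteq> 0" using q by (simp add: N_def)
    ultimately have "lame_U n \<kappa> (real N) = 0" by simp
    then have "2 * real N + half_count \<kappa> - n = 0" unfolding lame_U_eq[OF \<kappa>] by (auto simp: add_nonneg_eq_0_iff)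
    then have nN: "n = 2 * N + half_count \<kappa>" by linarith
    have "vp k * coeff q k = coeff q 0 * P k \<and> vp (Suc k) * coeff q (Suc k) = coeff q 0 * P (Suc k)" for k
    proof (induction k)
      case 0
      have "vp (Suc 0) * coeff q (Suc 0) - (t - of_real (lame_diag e n \<kappa> 0)) * (vp 0 * coeff q 0) = 0"
        using q(2)[unfolded zero_iff, rule_format, of 0] by simp
      then show ?case by (simp add: Prec0) (simp add: P_def vp_def)
    next
      case (Suc k)
      have "vp (Suc (Suc k)) * coeff q (Suc (Suc k)) = (t - of_real (lame_diag e n \<kappa> (int k + 1))) * (vp (Suc k) * coeff q (Suc k))
         - of_real (lame_offdiag e n \<kappa> (int k + 1)) * (vp k * coeff q k)"
        using q(2)[unfolded zero_iff, rule_format, of "Suc k"] by (simp add: algebra_simps)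
      also have "\<dots> = coeff q 0 * P (Suc (Suc k))" using Suc unfolding Prec by (simp add: algebra_simps)
      finally show ?case using Suc by simp
    qed
    then have all: "vp k * coeff q k = coeff q 0 * P k" for k by blast
    have "coeff q 0 \<noteq> 0"
    proof
      assume "coeff q 0 = 0"
      then have "coeff q N = 0" using all[of N] vp_nz[of N] by simp
      then show False using \<open>coeff q N \<noteq> 0\<close> by simp
    qed
    moreover have "coeff q (Suc N) = 0" by (simp add: N_def coeff_eq_0)
    ultimately have "P (Suc N) = 0" using all[of "Suc N"] by simp
    then show "\<exists>N. n = 2 * N + half_count \<kappa> \<and> P (Suc N) = 0" using nN by blast
  next
    assume "\<exists>N. n = 2 * N + half_count \<kappa> \<and> P (Suc N) = 0"
    then obtain N where N: "n = 2 * N + half_count \<kappa>" "P (Suc N) = 0" by blast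
    interpret jacobi "lame_diag e n \<kappa>" "lame_offdiag e n \<kappa>" N by (rule jacobi_lame[OF e \<kappa> N(1) n])
    \<comment> \<open>The truncated \<open>q\<close> must satisfy the equations above its degree
      too; they hold because the whole sequence vanishes after \<open>N\<close>.\<close>
    have beyond: "P k = 0" if "k > N" for k
    proof -
      have "t \<in> Z" using N(2) by (simp add: Z_def P_def)
      from Pz_beyond[OF this, of "int k"] that show ?thesis by (simp add: Pz_def P_def)
    qed
    define q where "q = (\<Sum>k\<le>N. monom (P k / vp k) k)"
    have cq: "coeff q k = P k / vp k" for k
      using beyond by (auto simp: q_def coeff_sum coeff_monom sum.delta)
    have cv: "vp k * coeff q k = P k" for k using vp_nz[of k] by (simp add: cq)
    have "coeff q 0 \<noteq> 0" by (simp add: cq vp_def P_def)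
    then have "q \<noteq> 0" by auto
    moreover have "lame_op e n \<kappa> E q = 0" unfolding zero_iff cv
    proof
      fix k
      show "P (Suc k) - (t - of_real (lame_diag e n \<kappa> (int k))) * P k + (if k = 0 then 0 else of_real (lame_offdiag e n \<kappa> (int k)) * P (k - 1)) = 0"
      proof (cases k)
        case 0
        then show ?thesis using Prec0 by simp
      next
        case (Suc i)
        then show ?thesis using Prec[of i] by (simp add: add.commute)
      qed
    qed
    ultimately show "\<exists>q. q \<noteq> 0 \<and> lame_op e n \<kappa> E q = 0" by blast
  qed
qed

section \<open>Wronskians of Lame solutions\<close>

definition "half_exp \<kappa> i = (if \<kappa> i = (1/2::real) then 1 else 0 :: nat)"

text \<open>Squaring removes the branches, so that identities between Lame solutions can be compared
  as polynomials.\<close>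

lemma lame_prefactor_squared:
  assumes "\<And>i. i \<in> {1..3} \<Longrightarrow> \<kappa> i \<in> {0, 1/2}" and z: "z \<in> slit_domain e"
  shows "(lame_prefactor e \<kappa> z)\<^sup>2 = (\<Prod>i\<in>{1..3}. (z - complex_of_real (e i)) ^ half_exp \<kappa> i)"
  unfolding lame_prefactor_def prod_power_distrib
proof (rule prod.cong)
  fix i :: nat assume i: "i \<in> {1..3}"
  have nz: "z - complex_of_real (e i) \<noteq> 0" by (rule slit_domain_nz[OF z i])
  consider "\<kappa> i = 0" | "\<kappa> i = 1/2" using assms(1)[OF i] by auto
  then show "((z - complex_of_real (e i)) powr complex_of_real (\<kappa> i))\<^sup>2 = (z - complex_of_real (e i)) ^ half_exp \<kappa> i"
  proof cases
    case 1
    then show ?thesis using nz by (simp add: half_exp_def)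
  next
    case 2
    have "((z - complex_of_real (e i)) powr (1/2))\<^sup>2 = (z - complex_of_real (e i)) powr (1/2 + 1/2)"
      by (simp only: powr_add power2_eq_square)
    moreover have k: "complex_of_real (\<kappa> i) = 1/2" "half_exp \<kappa> i = 1" unfolding half_exp_def 2 by simp_all
    ultimately show ?thesis unfolding k using nz by simp
  qed
qed simp

definition "root_prod e m = (\<Prod>i\<in>{1..3::nat}. [:- complex_of_real (e i), 1:] ^ m i)"

lemma poly_root_prod: "poly (root_prod e m) z = (\<Prod>i\<in>{1..3}. (z - complex_of_real (e i)) ^ m i)"
  by (simp add: root_prod_def poly_prod)

lemma root_prod_nz [simp]: "root_prod e m \<noteq> 0"
  by (simp add: root_prod_def)

lemma order_linear_power: "Polynomial.order x ([:- y, 1:] ^ k) = (if x = y then k else (0::nat))" for x :: complex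
  using order_power_n_n[of y k] by (auto intro!: order_0I)

lemma order_root_prod:
  assumes "e 3 < e 2" "e 2 < e 1" "j \<in> {1..3}"
  shows "Polynomial.order (complex_of_real (e j)) (root_prod e m) = m j"
proof -
  have "Polynomial.order (complex_of_real (e j)) (root_prod e m) = (\<Sum>i\<in>{1,2,3}. if e j = e i then m i else 0)"
    unfolding root_prod_def atLeastAtMost_1_3
    by (simp add: order_mult order_linear_power del: One_nat_def)
  then show ?thesis using assms unfolding atLeastAtMost_1_3 by auto
qed

lemma poly_eq_half_plane:
  assumes "\<And>z. Re z > r \<Longrightarrow> poly p z = (poly q z::complex)"
  shows "p = q"
  using poly_eq_0_half_plane[of r "p - q" 0] assms by simp

lemma has_lame_solution_disjoint:
  assumes e: "e 3 < e 2" "e 2 < e 1"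
    and \<kappa>: "\<kappa> \<in> lame_exponents" and \<mu>: "\<mu> \<in> lame_exponents" "\<kappa> \<noteq> \<mu>"
    and par: "even (half_count \<kappa> + half_count \<mu>)"
    and sol: "has_lame_solution e n \<kappa> E" "has_lame_solution e n \<mu> E"
  shows False
proof -
  obtain p where p: "p \<noteq> 0" "lame_form e \<kappa> p holomorphic_on slit_domain e"
      "\<And>z. z \<in> slit_domain e \<Longrightarrow> lame_operator e n E (lame_form e \<kappa> p) z = 0"
    using sol(1) unfolding has_lame_solution_def by blast
  obtain q where q: "q \<noteq> 0" "lame_form e \<mu> q holomorphic_on slit_domain e"
      "\<And>z. z \<in> slit_domain e \<Longrightarrow> lame_operator e n E (lame_form e \<mu> q) z = 0"
    using sol(2) unfolding has_lame_solution_def by blast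
  have kv: "\<kappa> i \<in> {0, 1/2}" "\<mu> i \<in> {0, 1/2}" if "i \<in> {1..3}" for i
    using \<kappa> \<mu>(1) that by (auto simp: PiE_iff)
  define F where "F = lame_prefactor e \<kappa>"
  define G where "G = lame_prefactor e \<mu>"
  \<comment> \<open>The logarithmic derivative of \<open>R\<close> is the first-order coefficient of
    the equation, so \<open>W * R\<close> is constant by Abel's identity.\<close>
  define R where "R = lame_prefactor e (\<lambda>_. 1/2)"
  define S where "S = lame_form e \<kappa> p"
  define T where "T = lame_form e \<mu> q"
  have Seq: "S z = F z * poly p z" and Teq: "T z = G z * poly q z" for z
    by (simp_all add: S_def T_def lame_form_def F_def G_def lame_prefactor_def)
  \<comment> \<open>On this half plane \<open>S\<close> has no zero, so the quotient
    \<open>T / S\<close> is available once the Wronskian vanishes.\<close>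
  obtain r where r: "r \<ge> e 1" "\<And>z. Re z > r \<Longrightarrow> poly p z \<noteq> 0"
  proof -
    have "finite {z. poly p z = 0}" using p(1) by (rule poly_roots_finite)
    then have fin: "finite (insert (e 1) (Re ` {z. poly p z = 0}))" by simp
    show ?thesis
    proof (rule that[of "Max (insert (e 1) (Re ` {z. poly p z = 0}))"])
      show "e 1 \<le> Max (insert (e 1) (Re ` {z. poly p z = 0}))" using fin by (intro Max_ge) auto
      fix z assume z: "Max (insert (e 1) (Re ` {z. poly p z = 0})) < Re z"
      show "poly p z \<noteq> 0"
      proof
        assume "poly p z = 0"
        then have "Re z \<le> Max (insert (e 1) (Re ` {z. poly p z = 0}))" using fin by (intro Max_ge) auto
        then show False using z by simp
      qed
    qed
  qed
  define H where "H = {z. Re z > r}"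
  have H: "convex H" "open H" unfolding H_def by (auto intro: convex_halfspace_Re_gt open_halfspace_Re_gt)
  have Hs: "z \<in> slit_domain e" if "z \<in> H" for z
    using that r(1) e by (intro half_plane_in_slit_domain) (auto simp: H_def)
  have DS: "(S has_field_derivative deriv S z) (at z)" "(deriv S has_field_derivative deriv (deriv S) z) (at z)"
    and DT: "(T has_field_derivative deriv T z) (at z)" "(deriv T has_field_derivative deriv (deriv T) z) (at z)"
    if "z \<in> slit_domain e" for z
    using p(2) q(2) that open_slit_domain[of e] unfolding S_def T_def
    by (auto intro!: holomorphic_derivI[of _ "slit_domain e"] holomorphic_deriv)
  define \<psi> where "\<psi> z = 1/2 * (\<Sum>i\<in>{1..3}. 1 / (z - complex_of_real (e i)))" for z
  have \<psi>: "log_deriv e (\<lambda>_. 1/2) z = \<psi> z" for z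
    by (simp add: log_deriv_def \<psi>_def sum_distrib_left)
  define W where "W z = S z * deriv T z - deriv S z * T z" for z
  have DW: "(W has_field_derivative - \<psi> z * W z) (at z)" if z: "z \<in> slit_domain e" for z
  proof -
    define v where "v = (of_nat (n * (n + 1)) * z + E) / (4 * (\<Prod>i\<in>{1..3}. (z - complex_of_real (e i))))"
    have 1: "deriv (deriv S) z = v * S z - \<psi> z * deriv S z"
      using p(3)[OF z] unfolding lame_operator_def S_def[symmetric] \<psi>_def[symmetric] v_def[symmetric]
      by (simp add: algebra_simps add_eq_0_iff)
    have 2: "deriv (deriv T) z = v * T z - \<psi> z * deriv T z"
      using q(3)[OF z] unfolding lame_operator_def T_def[symmetric] \<psi>_def[symmetric] v_def[symmetric]
      by (simp add: algebra_simps add_eq_0_iff)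
    have "(W has_field_derivative (deriv S z * deriv T z + S z * deriv (deriv T) z - (deriv (deriv S) z * T z + deriv S z * deriv T z))) (at z)"
      unfolding W_def[abs_def] using DS[OF z] DT[OF z] by (auto intro!: derivative_eq_intros)
    moreover have "deriv S z * deriv T z + S z * deriv (deriv T) z - (deriv (deriv S) z * T z + deriv S z * deriv T z) = - \<psi> z * W z"
      unfolding 1 2 W_def by (simp add: algebra_simps)
    ultimately show ?thesis by simp
  qed
  have "\<exists>C. \<forall>z\<in>H. W z * R z = C"
  proof (rule has_field_derivative_zero_constant[OF H(1)])
    fix z assume "z \<in> H"
    then have z: "z \<in> slit_domain e" by (rule Hs)
    have "((\<lambda>z. W z * R z) has_field_derivative 0) (at z)"
      using DW[OF z] has_field_derivative_lame_prefactor[OF z, of "\<lambda>_. 1/2", folded R_def, unfolded \<psi>]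
      by (auto intro!: derivative_eq_intros)
    then show "((\<lambda>z. W z * R z) has_field_derivative 0) (at z within H)" by (rule has_field_derivative_at_within)
  qed
  then obtain C where C: "\<And>z. z \<in> H \<Longrightarrow> W z * R z = C" by blast
  define Qp where "Qp = root_prod e (\<lambda>_. 1)"
  have Qp: "poly Qp z = (\<Prod>i\<in>{1..3}. z - complex_of_real (e i))" for z by (simp add: Qp_def poly_root_prod)
  have R2: "(R z)\<^sup>2 = poly Qp z" if "z \<in> slit_domain e" for z
    unfolding R_def Qp using lame_prefactor_squared[of "\<lambda>_. 1/2" z e] that by (simp add: half_exp_def)
  have F2: "(F z)\<^sup>2 = poly (root_prod e (half_exp \<kappa>)) z" and G2: "(G z)\<^sup>2 = poly (root_prod e (half_exp \<mu>)) z"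
    if "z \<in> slit_domain e" for z
    unfolding F_def G_def poly_root_prod
    by (rule lame_prefactor_squared[OF kv(1) that], simp, rule lame_prefactor_squared[OF kv(2) that], simp)
  \<comment> \<open>Numerator of \<open>log_deriv\<close> over the common denominator
    \<open>Qp\<close>.\<close>
  define L where "L \<nu> = (\<Sum>i\<in>{1..3}. Polynomial.smult (complex_of_real (\<nu> i)) (\<Prod>j\<in>{1..3} - {i}. [:- complex_of_real (e j), 1:]))" for \<nu> :: "nat \<Rightarrow> real"
  have L: "poly (L \<nu>) z = poly Qp z * log_deriv e \<nu> z" if z: "z \<in> slit_domain e" for \<nu> z
    unfolding L_def log_deriv_def poly_sum sum_distrib_left
  proof (rule sum.cong)
    fix i :: nat assume i: "i \<in> {1..3}"
    have "poly Qp z = (z - complex_of_real (e i)) * (\<Prod>j\<in>{1..3} - {i}. z - complex_of_real (e j))"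
      unfolding Qp using i by (intro prod.remove) auto
    then show "poly (Polynomial.smult (complex_of_real (\<nu> i)) (\<Prod>j\<in>{1..3} - {i}. [:- complex_of_real (e j), 1:])) z = poly Qp z * (complex_of_real (\<nu> i) / (z - complex_of_real (e i)))"
      using slit_domain_nz[OF z i] by (simp add: poly_prod)
  qed simp
  define V where "V = (L \<mu> - L \<kappa>) * p * q + Qp * (p * pderiv q - pderiv p * q)"
  have QW: "poly Qp z * W z = F z * G z * poly V z" if z: "z \<in> slit_domain e" for z
  proof -
    have "(S has_field_derivative F z * (log_deriv e \<kappa> z * poly p z + poly (pderiv p) z)) (at z)"
      unfolding Seq[abs_def] using has_field_derivative_lame_prefactor[OF z, of \<kappa>, folded F_def] poly_DERIV[of p z]
      by (auto intro!: derivative_eq_intros simp: algebra_simps)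
    then have dS: "deriv S z = F z * (log_deriv e \<kappa> z * poly p z + poly (pderiv p) z)" by (rule DERIV_imp_deriv)
    have "(T has_field_derivative G z * (log_deriv e \<mu> z * poly q z + poly (pderiv q) z)) (at z)"
      unfolding Teq[abs_def] using has_field_derivative_lame_prefactor[OF z, of \<mu>, folded G_def] poly_DERIV[of q z]
      by (auto intro!: derivative_eq_intros simp: algebra_simps)
    then have dT: "deriv T z = G z * (log_deriv e \<mu> z * poly q z + poly (pderiv q) z)" by (rule DERIV_imp_deriv)
    show ?thesis unfolding W_def dS dT Seq Teq V_def poly_add poly_mult poly_diff L[OF z] by (simp add: algebra_simps)
  qed
  \<comment> \<open>Otherwise the order at a root \<open>e i\<close> with equal exponents is odd on one side and even on the other.\<close>
  have C0: "C = 0"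
  proof (rule ccontr)
    assume C0: "C \<noteq> 0"
    \<comment> \<open>The square of \<open>W * R = C\<close>, cleared of denominators.\<close>
    have eq: "Polynomial.smult (C\<^sup>2) Qp = root_prod e (half_exp \<kappa>) * root_prod e (half_exp \<mu>) * (V * V)"
    proof (rule poly_eq_half_plane[of r])
      fix z assume "r < Re z"
      then have z: "z \<in> H" by (simp add: H_def)
      note zs = Hs[OF z]
      have "poly Qp z \<noteq> 0" using slit_domain_nz[OF zs] unfolding Qp by simp
      moreover have "poly Qp z * (C\<^sup>2 * poly Qp z) = (poly Qp z * W z)\<^sup>2 * (R z)\<^sup>2"
        using C[OF z] by (simp add: power2_eq_square algebra_simps flip: C[OF z])
      then have "poly Qp z * (C\<^sup>2 * poly Qp z) = (F z)\<^sup>2 * (G z)\<^sup>2 * (poly V z)\<^sup>2 * poly Qp z"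
        unfolding QW[OF zs] R2[OF zs] by (simp add: power_mult_distrib)
      ultimately show "poly (Polynomial.smult (C\<^sup>2) Qp) z = poly (root_prod e (half_exp \<kappa>) * root_prod e (half_exp \<mu>) * (V * V)) z"
        unfolding F2[OF zs] G2[OF zs] by (simp add: power2_eq_square mult.assoc)
    qed
    \<comment> \<open>Complementary exponent vectors have half counts that add up to 3, contrary to
      equal parity.\<close>
    have "\<exists>i\<in>{1..3}. half_exp \<kappa> i = half_exp \<mu> i"
    proof (rule ccontr)
      assume "\<not> ?thesis"
      then have ne: "half_exp \<kappa> i \<noteq> half_exp \<mu> i" if "i \<in> {1..3}" for i using that by blast
      have "\<kappa> i + \<mu> i = 1/2" if "i \<in> {1..3}" for i
        using kv[OF that] ne[OF that] by (auto simp: half_exp_def split: if_splits)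
      then have sums: "\<kappa> 1 + \<mu> 1 = 1/2" "\<kappa> 2 + \<mu> 2 = 1/2" "\<kappa> 3 + \<mu> 3 = 1/2" by auto
      have "real (half_count \<kappa> + half_count \<mu>) = 2 * ((\<kappa> 1 + \<mu> 1) + (\<kappa> 2 + \<mu> 2) + (\<kappa> 3 + \<mu> 3))"
        unfolding of_nat_add half_count_eq[OF \<kappa>] half_count_eq[OF \<mu>(1)] by (simp add: algebra_simps)
      then have "real (half_count \<kappa> + half_count \<mu>) = 3" unfolding sums by simp
      then have "half_count \<kappa> + half_count \<mu> = 3" by linarith
      then show False using par by simp
    qed
    then obtain i where i: "i \<in> {1..3}" "half_exp \<kappa> i = half_exp \<mu> i" by blast
    let ?o = "Polynomial.order (complex_of_real (e i))"
    have Qnz: "Polynomial.smult (C\<^sup>2) Qp \<noteq> 0" using C0 by (simp add: Qp_def)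
    have "?o (Polynomial.smult (C\<^sup>2) Qp) = 1" using C0 order_root_prod[OF e i(1)] by (simp add: order_smult Qp_def)
    moreover have "?o (root_prod e (half_exp \<kappa>) * root_prod e (half_exp \<mu>) * (V * V)) = 2 * half_exp \<mu> i + 2 * ?o V"
      using Qnz unfolding eq by (simp add: order_mult order_root_prod[OF e i(1)] i(2))
    ultimately show False unfolding eq by presburger
  qed
  have W0: "W z = 0" if z: "z \<in> H" for z
  proof -
    have "R z \<noteq> 0" unfolding R_def by (rule lame_prefactor_nz[OF Hs[OF z]])
    then show ?thesis using C[OF z] C0 by simp
  qed
  have Snz: "S z \<noteq> 0" if "z \<in> H" for z
    using that r(2)[of z] lame_prefactor_nz[OF Hs[OF that], of \<kappa>] by (simp add: Seq F_def H_def)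
  have "\<exists>c. \<forall>z\<in>H. T z / S z = c"
  proof (rule has_field_derivative_zero_constant[OF H(1)])
    fix z assume z: "z \<in> H"
    have "((\<lambda>z. T z / S z) has_field_derivative (deriv T z * S z - T z * deriv S z) / (S z * S z)) (at z)"
      using DS(1)[OF Hs[OF z]] DT(1)[OF Hs[OF z]] Snz[OF z] by (intro DERIV_divide)
    moreover have "deriv T z * S z - T z * deriv S z = 0" using W0[OF z] by (simp add: W_def algebra_simps)
    ultimately show "((\<lambda>z. T z / S z) has_field_derivative 0) (at z within H)"
      by (simp add: has_field_derivative_at_within)
  qed
  then obtain c where c: "\<And>z. z \<in> H \<Longrightarrow> T z / S z = c" by blast
  \<comment> \<open>The two sides have orders of different parity at a root \<open>e i\<close> where the exponents differ.\<close>
  have eq: "root_prod e (half_exp \<mu>) * (q * q) = Polynomial.smult (c\<^sup>2) (root_prod e (half_exp \<kappa>) * (p * p))"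
  proof (rule poly_eq_half_plane[of r])
    fix z assume "r < Re z"
    then have z: "z \<in> H" by (simp add: H_def)
    have "T z = c * S z" using c[OF z] Snz[OF z] by (simp add: field_simps)
    then have "(G z)\<^sup>2 * (poly q z)\<^sup>2 = c\<^sup>2 * ((F z)\<^sup>2 * (poly p z)\<^sup>2)" unfolding Seq Teq by (metis power_mult_distrib)
    then show "poly (root_prod e (half_exp \<mu>) * (q * q)) z = poly (Polynomial.smult (c\<^sup>2) (root_prod e (half_exp \<kappa>) * (p * p))) z"
      unfolding F2[OF Hs[OF z]] G2[OF Hs[OF z]] by (simp add: power2_eq_square)
  qed
  have lnz: "root_prod e (half_exp \<mu>) * (q * q) \<noteq> 0" using q(1) by simp
  then have c0: "c \<noteq> 0" unfolding eq by auto
  have "\<exists>i\<in>{1..3}. \<kappa> i \<noteq> \<mu> i" using \<kappa> \<mu> by (metis PiE_ext)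
  then obtain i where i: "i \<in> {1..3}" "\<kappa> i \<noteq> \<mu> i" by blast
  then have odd: "half_exp \<kappa> i + half_exp \<mu> i = 1" using kv[OF i(1)] by (auto simp: half_exp_def)
  let ?o = "Polynomial.order (complex_of_real (e i))"
  have "half_exp \<mu> i + 2 * ?o q = ?o (root_prod e (half_exp \<mu>) * (q * q))"
    using q(1) by (simp add: order_mult order_root_prod[OF e i(1)])
  also have "\<dots> = half_exp \<kappa> i + 2 * ?o p"
    unfolding eq using p(1) c0 by (simp add: order_smult order_mult order_root_prod[OF e i(1)])
  finally have "half_exp \<mu> i + 2 * ?o q = half_exp \<kappa> i + 2 * ?o p" .
  moreover have "m + 2 * x \<noteq> k + 2 * y" if "k + m = 1" for m k x y :: nat using that by presburger
  ultimately show False using odd by blast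
qed

section \<open>The spectral polynomials\<close>

definition "lame_spectrum e n \<kappa> = {E. has_lame_solution e n \<kappa> E}"
definition "lame_jacobi_roots e n \<kappa> N = {t. poly (jacobi_poly (lame_diag e n \<kappa>) (lame_offdiag e n \<kappa>) (Suc N)) t = 0}"

lemma lame_spectrum_eq:
  assumes e: "e 3 < e 2" "e 2 < e 1" and \<kappa>: "\<kappa> \<in> lame_exponents" and n: "n > 0" "n = 2 * N + half_count \<kappa>"
  shows "lame_spectrum e n \<kappa> = (\<lambda>t. - of_real (energy_unit n) * (of_real (e 2) + t)) ` lame_jacobi_roots e n \<kappa> N"
proof (rule Set.set_eqI)
  fix E :: complex
  have nn0: "complex_of_real (energy_unit n) \<noteq> 0" using energy_unit_pos[OF n(1)] by simp
  define t where "t = - E / of_real (energy_unit n) - of_real (e 2)"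
  have E: "E = - of_real (energy_unit n) * (of_real (e 2) + t)" using nn0 by (simp add: t_def)
  have inj: "t = s" if "E = - of_real (energy_unit n) * (of_real (e 2) + s)" for s
    using that nn0 unfolding E by simp
  have "E \<in> lame_spectrum e n \<kappa> \<longleftrightarrow> t \<in> lame_jacobi_roots e n \<kappa> N"
    unfolding lame_spectrum_def mem_Collect_eq has_lame_solution_iff[OF e \<kappa>]
    unfolding E lame_eigenvalue_iff[OF e \<kappa> n(1)] lame_jacobi_roots_def mem_Collect_eq using n(2) by auto
  also have "\<dots> \<longleftrightarrow> E \<in> (\<lambda>t. - of_real (energy_unit n) * (of_real (e 2) + t)) ` lame_jacobi_roots e n \<kappa> N"
    using E inj by blast
  finally show "E \<in> lame_spectrum e n \<kappa> \<longleftrightarrow> E \<in> (\<lambda>t. - of_real (energy_unit n) * (of_real (e 2) + t)) ` lame_jacobi_roots e n \<kappa> N" .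
qed

lemma lame_spectrum_empty:
  assumes e: "e 3 < e 2" "e 2 < e 1" and \<kappa>: "\<kappa> \<in> lame_exponents" and n: "n > 0" "\<nexists>N. n = 2 * N + half_count \<kappa>"
  shows "lame_spectrum e n \<kappa> = {}"
proof -
  have nn0: "complex_of_real (energy_unit n) \<noteq> 0" using energy_unit_pos[OF n(1)] by simp
  have "\<not> has_lame_solution e n \<kappa> E" for E
  proof -
    define t where "t = - E / of_real (energy_unit n) - of_real (e 2)"
    have E: "E = - of_real (energy_unit n) * (of_real (e 2) + t)" using nn0 by (simp add: t_def)
    show ?thesis unfolding has_lame_solution_iff[OF e \<kappa>] E lame_eigenvalue_iff[OF e \<kappa> n(1)] using n(2) by blast
  qed
  then show ?thesis by (auto simp: lame_spectrum_def)
qed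

lemma half_count_le: "half_count \<kappa> \<le> 3"
proof -
  have "half_count \<kappa> \<le> card {1..3::nat}" unfolding half_count_def by (intro card_mono) auto
  then show ?thesis by simp
qed

lemma admissible_iff: "admissible_exponents n \<kappa> \<longleftrightarrow> even (n + half_count \<kappa>)"
proof -
  have "half_count \<kappa> \<in> {0, 1, 2, 3}" using half_count_le[of \<kappa>] by auto
  then show ?thesis unfolding admissible_exponents_def half_count_def[symmetric] by auto
qed

text \<open>At most three exponents are 1/2, so \<open>n >= 3\<close> makes
  \<open>n - half_count \<kappa>\<close> a genuine difference; half of it is the degree
  \<open>N\<close>, and there are \<open>N + 1\<close> simple eigenvalues.\<close>

lemma card_lame_spectrum:
  assumes e: "e 3 < e 2" "e 2 < e 1" and \<kappa>: "\<kappa> \<in> lame_exponents" and n: "n \<ge> 3"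
  shows "finite (lame_spectrum e n \<kappa>)"
    and "card (lame_spectrum e n \<kappa>) = (if even (n + half_count \<kappa>) then (n - half_count \<kappa>) div 2 + 1 else 0)"
proof -
  have npos: "n > 0" using n by simp
  have "finite (lame_spectrum e n \<kappa>) \<and> card (lame_spectrum e n \<kappa>) = (if even (n + half_count \<kappa>) then (n - half_count \<kappa>) div 2 + 1 else 0)"
  proof (cases "even (n + half_count \<kappa>)")
    case True
    define N where "N = (n - half_count \<kappa>) div 2"
    have le: "half_count \<kappa> \<le> n" using half_count_le[of \<kappa>] n by simp
    then have "even (n - half_count \<kappa>)" using True by simp
    then have nN: "n = 2 * N + half_count \<kappa>" using le by (simp add: N_def)
    interpret jacobi "lame_diag e n \<kappa>" "lame_offdiag e n \<kappa>" N by (rule jacobi_lame[OF e \<kappa> nN npos])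
    have Z: "lame_jacobi_roots e n \<kappa> N = Z" by (simp only: lame_jacobi_roots_def Z_def)
    have "complex_of_real (energy_unit n) \<noteq> 0" using energy_unit_pos[OF npos] by simp
    then have "inj_on (\<lambda>t. - of_real (energy_unit n) * (of_real (e 2) + t)) Z" by (auto simp: inj_on_def)
    then show ?thesis unfolding lame_spectrum_eq[OF e \<kappa> npos nN] Z
      using finite_Z card_Z True by (simp add: card_image N_def)
  next
    case False
    then have "\<nexists>N. n = 2 * N + half_count \<kappa>" by auto
    then show ?thesis using False lame_spectrum_empty[OF e \<kappa> npos] by simp
  qed
  then show "finite (lame_spectrum e n \<kappa>)" "card (lame_spectrum e n \<kappa>) = (if even (n + half_count \<kappa>) then (n - half_count \<kappa>) div 2 + 1 else 0)"
    by auto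
qed

lemma finite_lame_exponents: "finite lame_exponents"
  by (intro finite_PiE) auto

text \<open>Exponent vectors correspond to subsets of a three-element set; the multiplicities are
  the binomials 1, 3, 3, 1.\<close>

lemma sum_lame_exponents:
  "(\<Sum>\<kappa>\<in>lame_exponents. g (half_count \<kappa>)) = g 0 + 3 * g 1 + 3 * g 2 + (g 3 :: nat)"
proof -
  have "(\<Sum>\<kappa>\<in>lame_exponents. g (half_count \<kappa>)) = (\<Sum>X\<in>Pow {1..3::nat}. g (card X))"
    by (rule sum.reindex_bij_witness[of _ "\<lambda>X. \<lambda>i\<in>{1..3}. if i \<in> X then 1/2 else 0" "\<lambda>\<kappa>. {i\<in>{1..3}. \<kappa> i = 1/2}"])
       (auto simp: half_count_def PiE_iff extensional_def restrict_def fun_eq_iff split: if_splits)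
  also have "\<dots> = g 0 + 3 * g 1 + 3 * g 2 + g 3"
  proof -
    have "Pow {1..3::nat} = {{}, {1}, {2}, {3}, {1,2}, {1,3}, {2,3}, {1,2,3}}"
      unfolding atLeastAtMost_1_3 by (auto simp: Pow_insert)
    moreover have "(\<Sum>X\<in>{{}, {1}, {2}, {3}, {1,2}, {1,3}, {2,3}, {1,2,3::nat}}. g (card X)) = g 0 + 3 * g 1 + 3 * g 2 + g 3"
      by (subst sum.insert, simp, fastforce)+ (simp add: card_insert_if numeral_2_eq_2 numeral_3_eq_3)
    ultimately show ?thesis by simp
  qed
  finally show ?thesis .
qed

text \<open>The cardinalities add up as \<open>(n / 2 + 1) + 3 * (n / 2)\<close> for even
  \<open>n\<close> and as \<open>3 * ((n + 1) / 2) + (n - 1) / 2\<close> for odd \<open>n\<close>.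
  With disjointness this yields the prescribed number of distinct energies, so
  \<open>spectral_poly\<close> is well defined.\<close>

lemma lame_spectrum_union:
  assumes e: "e 3 < e 2" "e 2 < e 1" and n: "n \<ge> 3"
  shows "finite (\<Union>\<kappa>\<in>lame_exponents. lame_spectrum e n \<kappa>)"
    and "card (\<Union>\<kappa>\<in>lame_exponents. lame_spectrum e n \<kappa>) = 2 * n + 1"
    and "disjoint_family_on (lame_spectrum e n) lame_exponents"
proof -
  show "finite (\<Union>\<kappa>\<in>lame_exponents. lame_spectrum e n \<kappa>)"
    using finite_lame_exponents card_lame_spectrum(1)[OF e _ n] by auto
  show dis: "disjoint_family_on (lame_spectrum e n) lame_exponents"
    unfolding disjoint_family_on_def
  proof (intro ballI impI)
    fix \<kappa> \<mu> assume \<kappa>: "\<kappa> \<in> lame_exponents" and \<mu>: "\<mu> \<in> lame_exponents" and ne: "\<kappa> \<noteq> \<mu>"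
    show "lame_spectrum e n \<kappa> \<inter> lame_spectrum e n \<mu> = {}"
    proof (rule ccontr)
      assume "lame_spectrum e n \<kappa> \<inter> lame_spectrum e n \<mu> \<noteq> {}"
      then obtain E where E: "E \<in> lame_spectrum e n \<kappa>" "E \<in> lame_spectrum e n \<mu>" by blast
      then have "even (n + half_count \<kappa>)" "even (n + half_count \<mu>)"
        using card_lame_spectrum[OF e \<kappa> n] card_lame_spectrum[OF e \<mu> n] by (auto split: if_splits)
      then have "even (half_count \<kappa> + half_count \<mu>)" by auto
      then show False using has_lame_solution_disjoint[OF e \<kappa> \<mu> ne] E by (simp add: lame_spectrum_def)
    qed
  qed
  have "card (\<Union>\<kappa>\<in>lame_exponents. lame_spectrum e n \<kappa>) = (\<Sum>\<kappa>\<in>lame_exponents. card (lame_spectrum e n \<kappa>))"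
    using finite_lame_exponents card_lame_spectrum(1)[OF e _ n] dis
    by (intro card_UN_disjoint') auto
  also have "\<dots> = (\<Sum>\<kappa>\<in>lame_exponents. (\<lambda>c. if even (n + c) then (n - c) div 2 + 1 else 0) (half_count \<kappa>))"
    using card_lame_spectrum(2)[OF e _ n] by (intro sum.cong) auto
  also have "\<dots> = (\<lambda>c. if even (n + c) then (n - c) div 2 + 1 else 0) 0 + 3 * (\<lambda>c. if even (n + c) then (n - c) div 2 + 1 else 0) 1
      + 3 * (\<lambda>c. if even (n + c) then (n - c) div 2 + 1 else 0) 2 + (\<lambda>c. if even (n + c) then (n - c) div 2 + 1 else 0) 3"
    by (rule sum_lame_exponents)
  also have "\<dots> = 2 * n + 1"
  proof (cases "even n")
    case True
    then obtain b where b: "n = 2 * b" by (elim evenE)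
    then have "(2 * b - 2) div 2 = b - 1" by simp
    then show ?thesis using n b by simp
  next
    case False
    then show ?thesis using n by (auto elim!: oddE)
  qed
  finally show "card (\<Union>\<kappa>\<in>lame_exponents. lame_spectrum e n \<kappa>) = 2 * n + 1" .
qed

definition "poly_with_roots A = (\<Prod>E\<in>A. [:- E, 1:])" for A :: "complex set"

lemma poly_with_roots:
  assumes "finite A"
  shows "lead_coeff (poly_with_roots A) = 1" "degree (poly_with_roots A) = card A"
    "proots (poly_with_roots A) = mset_set A" "{E. poly (poly_with_roots A) E = 0} = A"
    "rsquarefree (poly_with_roots A)"
proof -
  show "lead_coeff (poly_with_roots A) = 1" unfolding poly_with_roots_def by (simp add: lead_coeff_prod)
  show "degree (poly_with_roots A) = card A" unfolding poly_with_roots_def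
    by (subst degree_prod_eq_sum_degree) auto
  have "proots (poly_with_roots A) = (\<Sum>E\<in>A. {#E#})" unfolding poly_with_roots_def
    by (subst proots_prod) auto
  then show pr: "proots (poly_with_roots A) = mset_set A" using assms
    by (simp add: sum_multiset_singleton)
  show roots: "{E. poly (poly_with_roots A) E = 0} = A" using assms by (auto simp: poly_with_roots_def poly_prod)
  have nz: "poly_with_roots A \<noteq> 0" by (simp add: poly_with_roots_def assms)
  have "Polynomial.order x (poly_with_roots A) = count (mset_set A) x" for x using nz by (simp flip: pr)
  then show "rsquarefree (poly_with_roots A)" unfolding rsquarefree_def using nz assms
    by (auto simp: count_mset_set')
qed

text \<open>Square-freeness, or as many distinct roots as the degree, forces simple roots; the two
  alternatives serve the descriptions of \<open>spectral_poly_exp\<close> and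
  \<open>spectral_poly\<close>.\<close>

lemma poly_with_roots_unique:
  assumes A: "finite A" and R: "lead_coeff R = 1" "{E. poly R E = 0} = A" and d: "rsquarefree R \<or> degree R = card A"
  shows "R = poly_with_roots A"
proof -
  have nz: "R \<noteq> 0" using R(1) by auto
  have "proots R = mset_set A"
  proof (cases "rsquarefree R")
    case True
    show ?thesis
    proof (rule multiset_eqI)
      fix x
      show "count (proots R) x = count (mset_set A) x"
        using rsquarefree_root_order[OF True _ nz, of x] nz A R(2) by (auto simp: count_mset_set' order_root)
    qed
  next
    case False
    have "mset_set A \<subseteq># proots R" unfolding subseteq_mset_def
    proof
      fix x
      show "count (mset_set A) x \<le> count (proots R) x"
      proof (cases "x \<in> A")
        case True
        then have "Polynomial.order x R > 0" using R(2) nz by (auto simp: order_root)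
        then show ?thesis using True A nz by simp
      qed simp
    qed
    moreover have "size (mset_set A) = size (proots R)" using d False by (simp add: size_proots_complex)
    ultimately show ?thesis by (metis mset_subset_size subset_mset.le_imp_less_or_eq less_irrefl)
  qed
  moreover have "Polynomial.smult (lead_coeff R) (\<Prod>x\<in>#proots R. [:-x, 1:]) = R" by (rule complex_poly_decompose_multiset)
  ultimately show ?thesis using R(1) by (simp add: poly_with_roots_def prod_unfold_prod_mset)
qed

lemma spectral_poly_exp_eq:
  assumes "finite (lame_spectrum e n \<kappa>)"
  shows "spectral_poly_exp e n \<kappa> = poly_with_roots (lame_spectrum e n \<kappa>)"
  unfolding spectral_poly_exp_def lame_spectrum_def[symmetric]
  by (rule the_equality) (use poly_with_roots[OF assms] poly_with_roots_unique[OF assms] in auto)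

lemma spectral_poly_eq:
  assumes e: "e 3 < e 2" "e 2 < e 1" and n: "n \<ge> 3"
  shows "spectral_poly e n = poly_with_roots (\<Union>\<kappa>\<in>lame_exponents. lame_spectrum e n \<kappa>)"
proof -
  note U = lame_spectrum_union[OF e n]
  have "{E. \<exists>\<kappa>\<in>lame_exponents. has_lame_solution e n \<kappa> E} = (\<Union>\<kappa>\<in>lame_exponents. lame_spectrum e n \<kappa>)"
    by (auto simp: lame_spectrum_def)
  then show ?thesis unfolding spectral_poly_def
    by (intro the_equality) (use poly_with_roots[OF U(1)] poly_with_roots_unique[OF U(1)] U(2) in auto)
qed

definition "scaled n A = (\<lambda>E. - E / complex_of_real (energy_unit n)) ` A"

lemma proots_normalize_energy:
  assumes A: "finite A" and n: "n > 0"
  shows "proots (normalize_energy n (poly_with_roots A)) = mset_set (scaled n A)"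
proof -
  define c where "c = complex_of_real (energy_unit n)"
  have c0: "c \<noteq> 0" using energy_unit_pos[OF n] by (simp add: c_def)
  have "normalize_energy n (poly_with_roots A) = (\<Prod>E\<in>A. [:- E, - c:])"
    unfolding normalize_energy_def poly_with_roots_def pcompose_prod
    by (intro prod.cong) (auto simp: pcompose_pCons c_def energy_unit_def algebra_simps)
  also have "proots \<dots> = (\<Sum>E\<in>A. proots [:- E, - c:])" using c0 by (intro proots_prod) auto
  also have "\<dots> = (\<Sum>E\<in>A. {#- E / c#})"
  proof (rule sum.cong)
    fix E
    have eq: "[:- E, - c:] = Polynomial.smult (- c) [:E / c, 1:]" using c0 by simp
    show "proots [:- E, - c:] = {#- E / c#}" unfolding eq using c0 by (subst proots_smult) simp_all
  qed simp
  also have "\<dots> = (\<Sum>t\<in>scaled n A. {#t#})"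
    unfolding scaled_def c_def[symmetric] using c0 by (subst sum.reindex) (auto simp: inj_on_def)
  also have "\<dots> = mset_set (scaled n A)" using A by (simp add: sum_multiset_singleton scaled_def)
  finally show ?thesis .
qed

lemma integral_root_counting_measure:
  fixes f :: "complex \<Rightarrow> real"
  assumes T: "proots p = mset_set T" "finite T" "T \<noteq> {}" and f: "continuous_on UNIV f"
  shows "(\<integral>z. f z \<partial>root_counting_measure p) = (\<Sum>z\<in>T. f z) / card T"
proof -
  have ne: "mset_set T \<noteq> {#}" using T by (simp add: mset_set_empty_iff)
  have "pmf_of_multiset (mset_set T) = pmf_of_set T"
    by (rule pmf_eqI) (use T ne in \<open>auto simp: indicator_def\<close>)
  moreover have "f \<in> borel_measurable borel" using f by (rule borel_measurable_continuous_onI)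
  ultimately show ?thesis unfolding root_counting_measure_def T(1)
    using T by (subst integral_distr) (auto simp: integral_pmf_of_set)
qed

section \<open>Convergence of the root-counting measures\<close>

lemma approx_uminus: "approx f g \<Longrightarrow> approx (\<lambda>N k. - f N k) (\<lambda>x. - g x)"
  using approx_mult[OF approx_const[of "-1"]] by simp

text \<open>Only the term \<open>4 * (b - a) * x * (x - 1)\<close> of \<open>lame_D\<close> has
  order \<open>N^2\<close>, like \<open>n (n + 1)\<close>. The exponents enter through lower orders
  and disappear in the limit.\<close>

lemma approx_lame_diag:
  assumes \<kappa>: "\<kappa> \<in> lame_exponents"
  shows "approx (\<lambda>N k. lame_diag e (2 * N + half_count \<kappa>) \<kappa> (int k + i)) (\<lambda>x. ((e 1 - e 2) - (e 2 - e 3)) * x\<^sup>2)"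
proof -
  define a b where "a = e 1 - e 2" and "b = e 2 - e 3"
  define c where "c = real (half_count \<kappa>)"
  define r where "r = real_of_int i"
  define A B where "A = ode_A \<kappa> 1 * b + ode_A \<kappa> 2 * (b - a) - ode_A \<kappa> 3 * a" and "B = ode_B \<kappa> 1 2 * b - ode_B \<kappa> 2 3 * a"
  have c: "c \<ge> 0" by (simp add: c_def)
  have half: "approx (\<lambda>N k. real N / (2 * real N + c) * (real N / (2 * real N + (c + 1)))) (\<lambda>x. 1/2 * (1/2))"
    using c by (intro approx_mult approx_half) auto
  have D: "approx (\<lambda>N k. 4 * (b - a) * ((real k + r) / real N * ((real k + (r - 1)) / real N))
      + (A * ((real k + r) / real N * (1 / real N)) + B * (1 / real N * (1 / real N)))) (\<lambda>x. 4 * (b - a) * (x * x) + (A * (x * 0) + B * (0 * 0)))"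
    by (intro approx_add approx_mult approx_const approx_index approx_inverse)
  show ?thesis
  proof (rule approx_cong[OF approx_uminus[OF approx_mult[OF D half]]])
    fix N k :: nat assume N: "N > 0"
    define h where "h = real N / (2 * real N + c) * (real N / (2 * real N + (c + 1)))"
    define n where "n = 2 * N + half_count \<kappa>"
    have nz: "2 * real N + c \<noteq> 0" "2 * real N + (c + 1) \<noteq> 0" using N c by auto
    have energy_unit: "energy_unit n = (2 * real N + c) * (2 * real N + (c + 1))" by (simp add: energy_unit_def n_def c_def)
    have hN: "h = (real N)\<^sup>2 / energy_unit n" unfolding h_def energy_unit using nz by (simp add: power2_eq_square)
    have "(4 * (b - a) * ((real k + r) / real N * ((real k + (r - 1)) / real N))
      + (A * ((real k + r) / real N * (1 / real N)) + B * (1 / real N * (1 / real N)))) * (real N)\<^sup>2 = lame_D e \<kappa> (real_of_int (int k + i))"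
      unfolding lame_D_def Let_def a_def[symmetric] b_def[symmetric] A_def[symmetric] B_def[symmetric]
      using N by (simp add: r_def[symmetric] field_simps power2_eq_square)
    then show "- ((4 * (b - a) * ((real k + r) / real N * ((real k + (r - 1)) / real N))
      + (A * ((real k + r) / real N * (1 / real N)) + B * (1 / real N * (1 / real N)))) * (real N / (2 * real N + c) * (real N / (2 * real N + (c + 1)))))
      = lame_diag e (2 * N + half_count \<kappa>) \<kappa> (int k + i)"
      unfolding h_def[symmetric] n_def[symmetric] hN lame_diag_def by (simp only: times_divide_eq_right minus_divide_left)
  qed (simp add: a_def b_def power2_eq_square algebra_simps)
qed

text \<open>Divided by \<open>n (n + 1)\<close>, which grows like \<open>4 * N^2\<close>, the
  up-weight tends to \<open>x^2 - 1\<close> and the down-weight to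
  \<open>- (e 1 - e 2) * (e 2 - e 3) * x^2\<close>.\<close>

lemma approx_lame_offdiag:
  assumes \<kappa>: "\<kappa> \<in> lame_exponents"
  shows "approx (\<lambda>N k. lame_offdiag e (2 * N + half_count \<kappa>) \<kappa> (int k + i)) (\<lambda>x. (e 1 - e 2) * (e 2 - e 3) * x\<^sup>2 * (1 - x\<^sup>2))"
proof -
  define ab where "ab = (e 1 - e 2) * (e 2 - e 3)"
  define c where "c = real (half_count \<kappa>)"
  define r where "r = real_of_int i"
  define A where "A = ode_A \<kappa> 2"
  have c: "c \<ge> 0" by (simp add: c_def)
  have half: "approx (\<lambda>N k. real N / (2 * real N + c) * (real N / (2 * real N + (c + 1)))) (\<lambda>x. 1/2 * (1/2))"
    using c by (intro approx_mult approx_half) auto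
  have U: "approx (\<lambda>N k. (2 * ((real k + (r - 1)) / real N) + (- 2)) * (2 * ((real k + (r - 1)) / real N) + (2 + (2 * c + 1) * (1 / real N))))
      (\<lambda>x. (2 * x + (- 2)) * (2 * x + (2 + (2 * c + 1) * 0)))"
    by (intro approx_add approx_mult approx_const approx_index approx_inverse)
  have V: "approx (\<lambda>N k. - ab * (4 * ((real k + r) / real N * ((real k + (r - 1)) / real N)) + A * ((real k + r) / real N * (1 / real N))))
      (\<lambda>x. - ab * (4 * (x * x) + A * (x * 0)))"
    by (intro approx_add approx_mult approx_const approx_index approx_inverse)
  show ?thesis
  proof (rule approx_cong[OF approx_mult[OF approx_mult[OF U half] approx_mult[OF V half]]])
    fix N k :: nat assume N: "N > 0"
    define h where "h = real N / (2 * real N + c) * (real N / (2 * real N + (c + 1)))"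
    define n where "n = 2 * N + half_count \<kappa>"
    have nz: "2 * real N + c \<noteq> 0" "2 * real N + (c + 1) \<noteq> 0" using N c by auto
    have energy_unit: "energy_unit n = (2 * real N + c) * (2 * real N + (c + 1))" by (simp add: energy_unit_def n_def c_def)
    have hN: "h = (real N)\<^sup>2 / energy_unit n" unfolding h_def energy_unit using nz by (simp add: power2_eq_square)
    have nn0: "energy_unit n \<noteq> 0" unfolding energy_unit using nz by simp
    have u: "(2 * ((real k + (r - 1)) / real N) + (- 2)) * (2 * ((real k + (r - 1)) / real N) + (2 + (2 * c + 1) * (1 / real N))) * (real N)\<^sup>2
       = lame_U n \<kappa> (real_of_int (int k + i) - 1)"
      unfolding lame_U_eq[OF \<kappa>] using N by (simp add: n_def c_def[symmetric] r_def[symmetric] field_simps power2_eq_square)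
    have v: "- ab * (4 * ((real k + r) / real N * ((real k + (r - 1)) / real N)) + A * ((real k + r) / real N * (1 / real N))) * (real N)\<^sup>2
       = lame_V e \<kappa> (real_of_int (int k + i))"
      unfolding lame_V_def ab_def[symmetric] A_def[symmetric] using N by (simp add: r_def[symmetric] field_simps power2_eq_square)
    have "lame_offdiag e n \<kappa> (int k + i) = (lame_U n \<kappa> (real_of_int (int k + i) - 1) / energy_unit n) * (lame_V e \<kappa> (real_of_int (int k + i)) / energy_unit n)"
      unfolding lame_offdiag_def by (simp add: power2_eq_square)
    also have "\<dots> = ((2 * ((real k + (r - 1)) / real N) + (- 2)) * (2 * ((real k + (r - 1)) / real N) + (2 + (2 * c + 1) * (1 / real N))) * h)
      * (- ab * (4 * ((real k + r) / real N * ((real k + (r - 1)) / real N)) + A * ((real k + r) / real N * (1 / real N))) * h)"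
      unfolding u[symmetric] v[symmetric] hN by (simp only: times_divide_eq_right)
    finally show "(2 * ((real k + (r - 1)) / real N) + (- 2)) * (2 * ((real k + (r - 1)) / real N) + (2 + (2 * c + 1) * (1 / real N))) * (real N / (2 * real N + c) * (real N / (2 * real N + (c + 1))))
      * (- ab * (4 * ((real k + r) / real N * ((real k + (r - 1)) / real N)) + A * ((real k + r) / real N * (1 / real N))) * (real N / (2 * real N + c) * (real N / (2 * real N + (c + 1)))))
      = lame_offdiag e (2 * N + half_count \<kappa>) \<kappa> (int k + i)" unfolding h_def n_def by (rule sym)
  next
    fix x :: real
    show "(2 * x + (- 2)) * (2 * x + (2 + (2 * c + 1) * 0)) * (1/2 * (1/2)) * (- ab * (4 * (x * x) + A * (x * 0)) * (1/2 * (1/2)))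
      = (e 1 - e 2) * (e 2 - e 3) * x\<^sup>2 * (1 - x\<^sup>2)"
      unfolding ab_def[symmetric] by (simp add: power2_eq_square algebra_simps)
  qed
qed

lemma approx_bounded:
  assumes "approx f g"
  obtains K where "\<And>N k. 0 < N \<Longrightarrow> k \<le> N \<Longrightarrow> \<bar>f N k\<bar> \<le> K"
proof -
  obtain C B where *: "C \<ge> 0" "B \<ge> 0"
    "\<And>N k. 0 < N \<Longrightarrow> k \<le> N \<Longrightarrow> \<bar>f N k - g (real k / real N)\<bar> \<le> C / real N"
    "\<And>x. 0 \<le> x \<Longrightarrow> x \<le> 1 \<Longrightarrow> \<bar>g x\<bar> \<le> B" using approxE[OF assms] by metis
  show ?thesis
  proof (rule that[of "C + B"])
    fix N k :: nat assume Nk: "0 < N" "k \<le> N"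
    have "C / real N \<le> C / 1" using Nk *(1) by (intro divide_left_mono) auto
    moreover have "\<bar>g (real k / real N)\<bar> \<le> B" using Nk by (intro *(4)) auto
    ultimately show "\<bar>f N k\<bar> \<le> C + B" using *(3)[OF Nk] by linarith
  qed
qed

lemma lame_jacobi_roots_mean_tendsto:
  fixes f :: "complex \<Rightarrow> real"
  assumes e: "e 3 < e 2" "e 2 < e 1" and \<kappa>: "\<kappa> \<in> lame_exponents" and f: "continuous_on UNIV f"
  shows "(\<lambda>N. (\<Sum>t\<in>lame_jacobi_roots e (2 * N + half_count \<kappa>) \<kappa> N. f (of_real (e 2) + t)) / real (Suc N))
    \<longlonglongrightarrow> (\<integral>z. f z \<partial>mu_Q e)"
proof -
  define n where "n N = 2 * N + half_count \<kappa>" for N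
  define Z where "Z N = lame_jacobi_roots e (n N) \<kappa> N" for N
  have jacobi_poly: "jacobi (lame_offdiag e (n N) \<kappa>) N" if "N > 0" for N
    using jacobi_lame[OF e \<kappa>, of "n N" N] that by (simp add: n_def)
  have Zj: "Z N = jacobi.Z (lame_diag e (n N) \<kappa>) (lame_offdiag e (n N) \<kappa>) N" if "N > 0" for N
    unfolding Z_def lame_jacobi_roots_def jacobi.Z_def[OF jacobi_poly[OF that]] ..
  have finZ: "finite (Z N)" and cardZ: "card (Z N) = Suc N" and realZ: "\<And>t. t \<in> Z N \<Longrightarrow> t \<in> \<real>" if "N > 0" for N
    unfolding Zj[OF that] using jacobi.finite_Z[OF jacobi_poly[OF that]] jacobi.card_Z[OF jacobi_poly[OF that]] jacobi.Z_real[OF jacobi_poly[OF that]] by blast+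
  note ad = approx_lame_diag[OF \<kappa>, of e, folded n_def] and ab = approx_lame_offdiag[OF \<kappa>, of e, folded n_def]
  obtain K1 where K1: "\<And>N k. 0 < N \<Longrightarrow> k \<le> N \<Longrightarrow> \<bar>lame_diag e (n N) \<kappa> (int k + 0)\<bar> \<le> K1" using approx_bounded[OF ad[of 0]] by metis
  obtain K2 where K2: "\<And>N k. 0 < N \<Longrightarrow> k \<le> N \<Longrightarrow> \<bar>lame_offdiag e (n N) \<kappa> (int k + 0)\<bar> \<le> K2" using approx_bounded[OF ab[of 0]] by metis
  define K where "K = max K1 K2"
  have bound: "norm t \<le> 2 * K + 1" if N: "N > 0" and t: "t \<in> Z N" for N t
  proof (rule jacobi.Z_bound[OF jacobi_poly[OF N]])
    show "t \<in> jacobi.Z (lame_diag e (n N) \<kappa>) (lame_offdiag e (n N) \<kappa>) N" using t Zj[OF N] by simp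
    fix k assume "0 \<le> k" "k \<le> int N"
    then have "nat k \<le> N" "k = int (nat k) + 0" by auto
    then show "\<bar>lame_diag e (n N) \<kappa> k\<bar> \<le> K" "\<bar>lame_offdiag e (n N) \<kappa> k\<bar> \<le> K"
      using K1[OF N, of "nat k"] K2[OF N, of "nat k"] unfolding K_def by (auto simp: le_max_iff_disj)
  qed
  \<comment> \<open>The roots are real, so taking real parts loses nothing and gives measures on the
    line for the moment argument.\<close>
  define M where "M N = measure_pmf (map_pmf (\<lambda>t. e 2 + Re t) (pmf_of_set (Z N)))" for N
  have intM: "(\<integral>x. g x \<partial>M N) = (\<Sum>t\<in>Z N. g (e 2 + Re t)) / real (Suc N)" if "N > 0" for N and g :: "real \<Rightarrow> real"
  proof -
    have "Z N \<noteq> {}" using cardZ[OF that] by auto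
    then show ?thesis unfolding M_def using finZ[OF that] cardZ[OF that] by (simp add: integral_pmf_of_set)
  qed
  have mom: "(\<lambda>N. \<integral>x. (x - e 2) ^ j \<partial>M N) \<longlonglongrightarrow> moment (e 1 - e 2) (e 2 - e 3) j" for j :: nat
  proof -
    let ?g = "\<lambda>x. coeff ([:(e 1 - e 2) * (e 2 - e 3) * x\<^sup>2 * (1 - x\<^sup>2), ((e 1 - e 2) - (e 2 - e 3)) * x\<^sup>2, 1:] ^ j) j"
    have "(\<lambda>N. (\<Sum>k\<le>N. path_weight (lame_diag e (n N) \<kappa>) (lame_offdiag e (n N) \<kappa>) j (int k) j) / real (Suc N)) \<longlonglongrightarrow> integral {0..1} ?g"
      by (rule approx_mean_tendsto[OF approx_path_weight[OF ad ab]]) (rule integral_symbol(2))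
    moreover have "(\<Sum>k\<le>N. path_weight (lame_diag e (n N) \<kappa>) (lame_offdiag e (n N) \<kappa>) j (int k) j) / real (Suc N) = (\<integral>x. (x - e 2) ^ j \<partial>M N)" if N: "N > 0" for N
    proof -
      have "(\<Sum>t\<in>Z N. (Re t) ^ j) = Re (\<Sum>t\<in>Z N. t ^ j)"
        unfolding Re_sum
      proof (rule sum.cong)
        fix t assume "t \<in> Z N"
        then obtain x where "t = of_real x" using realZ[OF N] Reals_cases by metis
        then show "Re t ^ j = Re (t ^ j)" by (simp flip: of_real_power)
      qed simp
      also have "\<dots> = (\<Sum>k\<le>N. path_weight (lame_diag e (n N) \<kappa>) (lame_offdiag e (n N) \<kappa>) j (int k) j)"
        unfolding Zj[OF N] jacobi.sum_power_Z[OF jacobi_poly[OF N]] by simp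
      finally show ?thesis unfolding intM[OF N] by simp
    qed
    ultimately show ?thesis unfolding integral_symbol(1)
      by (rule_tac Lim_transform_eventually) (auto intro: eventually_sequentiallyI[of 1])
  qed
  \<comment> \<open>One interval that contains both the limiting support and all shifted
    roots.\<close>
  define l u where "l = min (e 3) (e 2 - (2 * K + 1))" and "u = max (e 1) (e 2 + (2 * K + 1))"
  have "(\<lambda>N. \<integral>x. f (of_real x) \<partial>M N) \<longlonglongrightarrow> (\<integral>x. f (of_real x) \<partial>sphere_law (e 3) (e 2) (e 1))"
  proof (rule tendsto_integral_of_moments[where I = "{0<..}" and l = l and u = u and c = "e 2"])
    interpret L: real_distribution "sphere_law (e 3) (e 2) (e 1)" by (rule real_distribution_sphere_law)
    show "prob_space (sphere_law (e 3) (e 2) (e 1))" by (rule L.prob_space_axioms)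
    show "(\<lambda>x. x) \<in> borel_measurable (sphere_law (e 3) (e 2) (e 1))" by (simp add: sphere_law_def)
    show "AE x in sphere_law (e 3) (e 2) (e 1). x \<in> {l..u}"
      using AE_sphere_law[OF e] by eventually_elim (auto simp: l_def u_def)
    show "(\<lambda>x. x) \<in> borel_measurable (M N)" "prob_space (M N)" for N
      unfolding M_def by (auto intro: prob_space_measure_pmf)
    show "AE x in M N. x \<in> {l..u}" if "N \<in> {0<..}" for N
    proof -
      have N: "N > 0" using that by simp
      have ne: "Z N \<noteq> {}" using cardZ[OF N] by auto
      have "e 2 + Re t \<in> {l..u}" if "t \<in> Z N" for t
        using bound[OF N that] abs_Re_le_cmod[of t] by (auto simp: l_def u_def min_le_iff_disj le_max_iff_disj)
      then show ?thesis unfolding M_def by (simp add: AE_measure_pmf_iff set_pmf_of_set[OF ne finZ[OF N]])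
    qed
    show "eventually (\<lambda>N. N \<in> {0<..}) sequentially" using eventually_gt_at_top[of 0] by simp
    show "(\<lambda>N. \<integral>x. (x - e 2) ^ j \<partial>M N) \<longlonglongrightarrow> (\<integral>x. (x - e 2) ^ j \<partial>sphere_law (e 3) (e 2) (e 1))" for j
      using mom[of j] by (simp add: integral_sphere_law_moment)
    show "continuous_on UNIV (\<lambda>x. f (complex_of_real x))"
      by (intro continuous_on_compose2[OF f]) (auto intro!: continuous_intros)
  qed
  moreover have "(\<integral>x. f (of_real x) \<partial>M N) = (\<Sum>t\<in>Z N. f (of_real (e 2) + t)) / real (Suc N)" if "N > 0" for N
    unfolding intM[OF that] using realZ[OF that] by (auto intro!: arg_cong[where f = "\<lambda>x. x / _"] sum.cong elim!: Reals_cases)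
  ultimately have "(\<lambda>N. (\<Sum>t\<in>Z N. f (of_real (e 2) + t)) / real (Suc N)) \<longlonglongrightarrow> (\<integral>x. f (of_real x) \<partial>sphere_law (e 3) (e 2) (e 1))"
    by (rule_tac Lim_transform_eventually) (auto intro: eventually_sequentiallyI[of 1])
  then show ?thesis unfolding integral_mu_Q[OF e f] Z_def n_def .
qed

text \<open>Stated as an eventual implication, so that all exponent vectors can be treated at one
  common \<open>n\<close> when their spectra are united.\<close>

lemma scaled_spectrum_mean_tendsto:
  fixes f :: "complex \<Rightarrow> real"
  assumes e: "e 3 < e 2" "e 2 < e 1" and \<kappa>: "\<kappa> \<in> lame_exponents" and f: "continuous_on UNIV f" and \<epsilon>: "\<epsilon> > 0"
  shows "eventually (\<lambda>n. admissible_exponents n \<kappa> \<longrightarrow>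
     \<bar>(\<Sum>t\<in>scaled n (lame_spectrum e n \<kappa>). f t) / card (scaled n (lame_spectrum e n \<kappa>)) - (\<integral>z. f z \<partial>mu_Q e)\<bar> < \<epsilon>) sequentially"
proof -
  have "eventually (\<lambda>N. dist ((\<Sum>t\<in>lame_jacobi_roots e (2 * N + half_count \<kappa>) \<kappa> N. f (of_real (e 2) + t)) / real (Suc N)) (\<integral>z. f z \<partial>mu_Q e) < \<epsilon>) sequentially"
    using lame_jacobi_roots_mean_tendsto[OF e \<kappa> f] \<epsilon> by (rule tendstoD)
  then obtain N0 where N0: "\<And>N. N \<ge> N0 \<Longrightarrow> dist ((\<Sum>t\<in>lame_jacobi_roots e (2 * N + half_count \<kappa>) \<kappa> N. f (of_real (e 2) + t)) / real (Suc N)) (\<integral>z. f z \<partial>mu_Q e) < \<epsilon>"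
    unfolding eventually_sequentially by blast
  show ?thesis
  \<comment> \<open>The summand 3 bounds \<open>half_count\<close>, so that
    \<open>n = 2 * N + half_count \<kappa>\<close> implies \<open>N >= N0\<close>.\<close>
  proof (rule eventually_sequentiallyI[of "2 * N0 + 3"], rule impI)
    fix n assume n: "2 * N0 + 3 \<le> n" and adm: "admissible_exponents n \<kappa>"
    then have npos: "n > 0" "n \<ge> 3" by auto
    define N where "N = (n - half_count \<kappa>) div 2"
    have le: "half_count \<kappa> \<le> n" using half_count_le[of \<kappa>] npos by simp
    moreover have "even (n - half_count \<kappa>)" using adm le by (simp add: admissible_iff)
    ultimately have nN: "n = 2 * N + half_count \<kappa>" by (simp add: N_def)
    have NN0: "N \<ge> N0" using n nN half_count_le[of \<kappa>] by linarith
    have nn0: "complex_of_real (energy_unit n) \<noteq> 0" using energy_unit_pos[OF npos(1)] by simp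
    \<comment> \<open>The minus signs of the energy substitution and of
      \<open>normalize_energy\<close> cancel, leaving the roots shifted by
      \<open>e 2\<close>.\<close>
    have sc: "scaled n (lame_spectrum e n \<kappa>) = (\<lambda>t. of_real (e 2) + t) ` lame_jacobi_roots e n \<kappa> N"
      unfolding scaled_def lame_spectrum_eq[OF e \<kappa> npos(1) nN] image_image using nn0 by simp
    interpret jacobi "lame_diag e n \<kappa>" "lame_offdiag e n \<kappa>" N by (rule jacobi_lame[OF e \<kappa> nN npos(1)])
    have Z: "lame_jacobi_roots e n \<kappa> N = Z" by (simp only: lame_jacobi_roots_def Z_def)
    have inj: "inj_on (\<lambda>t. complex_of_real (e 2) + t) Z" by simp
    show "\<bar>(\<Sum>t\<in>scaled n (lame_spectrum e n \<kappa>). f t) / card (scaled n (lame_spectrum e n \<kappa>)) - (\<integral>z. f z \<partial>mu_Q e)\<bar> < \<epsilon>"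
      using N0[OF NN0] unfolding nN[symmetric] sc Z
      by (simp add: sum.reindex[OF inj] card_image[OF inj] card_Z dist_real_def)
  qed
qed

theorem corollary1:
  fixes e :: "nat \<Rightarrow> real"
  assumes "e 1 > e 2" and "e 2 > e 3"
  shows "(\<forall>\<kappa>\<in>lame_exponents.
            converges_weakly
              (\<lambda>n. root_counting_measure (normalize_energy n (spectral_poly_exp e n \<kappa>)))
              (mu_Q e)
              (inf sequentially (principal {n. admissible_exponents n \<kappa>})))
       \<and> converges_weakly
            (\<lambda>n. root_counting_measure (normalize_energy n (spectral_poly e n)))
            (mu_Q e) sequentially"
proof (intro conjI ballI)
  have e: "e 3 < e 2" "e 2 < e 1" using assms by auto
  fix \<kappa> assume \<kappa>: "\<kappa> \<in> lame_exponents"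
  show "converges_weakly
              (\<lambda>n. root_counting_measure (normalize_energy n (spectral_poly_exp e n \<kappa>)))
              (mu_Q e)
              (inf sequentially (principal {n. admissible_exponents n \<kappa>}))"
    unfolding converges_weakly_def
  proof (intro allI impI tendstoI)
    fix f :: "complex \<Rightarrow> real" and \<epsilon> :: real
    assume f: "continuous_on UNIV f" and "bounded (range f)" and \<epsilon>: "\<epsilon> > 0"
    have "eventually (\<lambda>n. n \<ge> (3::nat)) sequentially" by (rule eventually_ge_at_top)
    with scaled_spectrum_mean_tendsto[OF e \<kappa> f \<epsilon>]
    show "eventually (\<lambda>n. dist (\<integral>z. f z \<partial>root_counting_measure (normalize_energy n (spectral_poly_exp e n \<kappa>))) (\<integral>z. f z \<partial>mu_Q e) < \<epsilon>)
      (inf sequentially (principal {n. admissible_exponents n \<kappa>}))"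
      unfolding eventually_inf_principal mem_Collect_eq
    proof eventually_elim
      case (elim n)
      show ?case
      proof
        assume adm: "admissible_exponents n \<kappa>"
        let ?A = "lame_spectrum e n \<kappa>"
        have fin: "finite ?A" and "card ?A > 0" using card_lame_spectrum[OF e \<kappa> elim(2)] adm by (auto simp: admissible_iff)
        then have ne: "?A \<noteq> {}" by auto
        have "(\<integral>z. f z \<partial>root_counting_measure (normalize_energy n (spectral_poly_exp e n \<kappa>)))
           = (\<Sum>t\<in>scaled n ?A. f t) / card (scaled n ?A)"
          unfolding spectral_poly_exp_eq[OF fin]
          using fin ne f elim(2) by (intro integral_root_counting_measure proots_normalize_energy) (auto simp: scaled_def)
        then show "dist (\<integral>z. f z \<partial>root_counting_measure (normalize_energy n (spectral_poly_exp e n \<kappa>))) (\<integral>z. f z \<partial>mu_Q e) < \<epsilon>"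
          using elim(1) adm by (simp add: dist_real_def)
      qed
    qed
  qed
next
  have e: "e 3 < e 2" "e 2 < e 1" using assms by auto
  show "converges_weakly
            (\<lambda>n. root_counting_measure (normalize_energy n (spectral_poly e n)))
            (mu_Q e) sequentially"
    unfolding converges_weakly_def
  proof (intro allI impI tendstoI)
    fix f :: "complex \<Rightarrow> real" and \<epsilon> :: real
    assume f: "continuous_on UNIV f" and "bounded (range f)" and \<epsilon>: "\<epsilon> > 0"
    define I where "I = (\<integral>z. f z \<partial>mu_Q e)"
    have "eventually (\<lambda>n. n \<ge> (3::nat)) sequentially" by (rule eventually_ge_at_top)
    \<comment> \<open>Half of \<epsilon>, since the weighted average below only preserves a
      non-strict bound.\<close>
    moreover have "eventually (\<lambda>n. \<forall>\<kappa>\<in>lame_exponents. admissible_exponents n \<kappa> \<longrightarrow>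
       \<bar>(\<Sum>t\<in>scaled n (lame_spectrum e n \<kappa>). f t) / card (scaled n (lame_spectrum e n \<kappa>)) - I\<bar> < \<epsilon> / 2) sequentially"
      unfolding I_def using \<epsilon> by (intro eventually_ball_finite finite_lame_exponents ballI scaled_spectrum_mean_tendsto e f) auto
    ultimately show "eventually (\<lambda>n. dist (\<integral>z. f z \<partial>root_counting_measure (normalize_energy n (spectral_poly e n))) (\<integral>z. f z \<partial>mu_Q e) < \<epsilon>) sequentially"
    proof eventually_elim
      case (elim n)
      let ?A = "lame_spectrum e n"
      let ?U = "\<Union>\<kappa>\<in>lame_exponents. ?A \<kappa>"
      note U = lame_spectrum_union[OF e elim(1)]
      have inj: "inj_on (\<lambda>E. - E / complex_of_real (energy_unit n)) A" for A
        using energy_unit_pos[of n] elim(1) by (auto simp: inj_on_def)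
      have cs: "card (scaled n A) = card A" for A unfolding scaled_def by (rule card_image[OF inj])
      have ss: "(\<Sum>t\<in>scaled n A. f t) = (\<Sum>E\<in>A. f (- E / complex_of_real (energy_unit n)))" for A
        unfolding scaled_def by (rule sum.reindex[OF inj, unfolded comp_def])
      have cU: "(\<Sum>\<kappa>\<in>lame_exponents. card (?A \<kappa>)) = 2 * n + 1"
        unfolding U(2)[symmetric] using finite_lame_exponents card_lame_spectrum(1)[OF e _ elim(1)] U(3)
        by (intro card_UN_disjoint'[symmetric]) auto
      have "card ?U \<noteq> 0" unfolding U(2) by simp
      then have "?U \<noteq> {}" by (metis card.empty)
      then have "(\<integral>z. f z \<partial>root_counting_measure (normalize_energy n (spectral_poly e n))) = (\<Sum>t\<in>scaled n ?U. f t) / card (scaled n ?U)"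
        unfolding spectral_poly_eq[OF e elim(1)]
        using U(1) f elim(1) by (intro integral_root_counting_measure proots_normalize_energy) (auto simp: scaled_def)
      also have "\<dots> = (\<Sum>E\<in>?U. f (- E / complex_of_real (energy_unit n))) / real (2 * n + 1)" unfolding cs ss U(2) ..
      also have "(\<Sum>E\<in>?U. f (- E / complex_of_real (energy_unit n))) = (\<Sum>\<kappa>\<in>lame_exponents. \<Sum>E\<in>?A \<kappa>. f (- E / complex_of_real (energy_unit n)))"
        using finite_lame_exponents card_lame_spectrum(1)[OF e _ elim(1)] U(3)
        by (intro sum.UNION_disjoint) (auto simp: disjoint_family_on_def)
      finally have int: "(\<integral>z. f z \<partial>root_counting_measure (normalize_energy n (spectral_poly e n)))
         = (\<Sum>\<kappa>\<in>lame_exponents. \<Sum>E\<in>?A \<kappa>. f (- E / complex_of_real (energy_unit n))) / real (2 * n + 1)" .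
      \<comment> \<open>Multiplied by the cardinality, the estimate also covers inadmissible
        exponents, whose spectrum is empty; summing then gives the mean over the union.\<close>
      have each: "\<bar>(\<Sum>E\<in>?A \<kappa>. f (- E / complex_of_real (energy_unit n))) - card (?A \<kappa>) * I\<bar> \<le> card (?A \<kappa>) * (\<epsilon> / 2)" if \<kappa>: "\<kappa> \<in> lame_exponents" for \<kappa>
      proof (cases "admissible_exponents n \<kappa>")
        case True
        have c: "card (?A \<kappa>) > 0" using card_lame_spectrum(2)[OF e \<kappa> elim(1)] True by (simp add: admissible_iff)
        have "\<bar>(\<Sum>E\<in>?A \<kappa>. f (- E / complex_of_real (energy_unit n))) / card (?A \<kappa>) - I\<bar> < \<epsilon> / 2"
          using elim(2) \<kappa> True unfolding cs ss by blast
        then have "real (card (?A \<kappa>)) * \<bar>(\<Sum>E\<in>?A \<kappa>. f (- E / complex_of_real (energy_unit n))) / card (?A \<kappa>) - I\<bar> \<le> card (?A \<kappa>) * (\<epsilon> / 2)"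
          by (intro mult_left_mono) auto
        also have "real (card (?A \<kappa>)) * \<bar>(\<Sum>E\<in>?A \<kappa>. f (- E / complex_of_real (energy_unit n))) / card (?A \<kappa>) - I\<bar>
           = \<bar>(\<Sum>E\<in>?A \<kappa>. f (- E / complex_of_real (energy_unit n))) - card (?A \<kappa>) * I\<bar>"
          using c by (subst abs_of_nat[symmetric], subst abs_mult[symmetric]) (simp add: right_diff_distrib)
        finally show ?thesis .
      next
        case False
        then have "card (?A \<kappa>) = 0" using card_lame_spectrum(2)[OF e \<kappa> elim(1)] by (simp add: admissible_iff)
        then have "?A \<kappa> = {}" using card_lame_spectrum(1)[OF e \<kappa> elim(1)] by simp
        then show ?thesis by simp
      qed
      have "\<bar>(\<Sum>\<kappa>\<in>lame_exponents. \<Sum>E\<in>?A \<kappa>. f (- E / complex_of_real (energy_unit n))) - real (2 * n + 1) * I\<bar>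
         = \<bar>\<Sum>\<kappa>\<in>lame_exponents. (\<Sum>E\<in>?A \<kappa>. f (- E / complex_of_real (energy_unit n))) - card (?A \<kappa>) * I\<bar>"
        unfolding cU[symmetric] by (simp add: sum_subtractf sum_distrib_right)
      also have "\<dots> \<le> (\<Sum>\<kappa>\<in>lame_exponents. \<bar>(\<Sum>E\<in>?A \<kappa>. f (- E / complex_of_real (energy_unit n))) - card (?A \<kappa>) * I\<bar>)" by (rule sum_abs)
      also have "\<dots> \<le> (\<Sum>\<kappa>\<in>lame_exponents. card (?A \<kappa>) * (\<epsilon> / 2))" by (intro sum_mono each)
      also have "\<dots> = real (2 * n + 1) * (\<epsilon> / 2)" unfolding cU[symmetric] by (simp add: sum_distrib_right)
      finally have b: "\<bar>(\<Sum>\<kappa>\<in>lame_exponents. \<Sum>E\<in>?A \<kappa>. f (- E / complex_of_real (energy_unit n))) - real (2 * n + 1) * I\<bar> \<le> real (2 * n + 1) * (\<epsilon> / 2)" .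
      define m where "m = real (2 * n + 1)"
      have m: "m > 0" by (simp add: m_def)
      define s where "s = (\<Sum>\<kappa>\<in>lame_exponents. \<Sum>E\<in>?A \<kappa>. f (- E / complex_of_real (energy_unit n)))"
      have "s / m - I = (s - m * I) / m" using m by (simp add: field_simps)
      then have "\<bar>s / m - I\<bar> = \<bar>s - m * I\<bar> / m" using m by simp
      also have "\<dots> \<le> (m * (\<epsilon> / 2)) / m" using b m by (intro divide_right_mono) (auto simp: s_def m_def)
      also have "\<dots> < \<epsilon>" using m \<epsilon> by simp
      finally show ?case unfolding int I_def[symmetric] by (simp add: dist_real_def s_def m_def)
    qed
  qed
qed

end
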